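(* Let $n\ge 1$ be an integer and let $\Omega$ be a bounded domain in $\mathbb{R}^n$ with a Lipschitz-continuous boundary. Let $p\in[1,\infty)$ and $l\in\mathbb{N}$. Then, for any $v\in W^{l+1,p}(\Omega)$, $$\lim_{\sigma\to1^{-}}(1-\sigma)\,|v|_{l+\sigma,p,\Omega}^p=p^{-1}K_{p,n}\,|\nabla v|_{l,p,\Omega}^p,$$ where $$K_{p,n}=\int_{S_{n-1}}|\omega\cdot\nu|^p\,d\omega,$$ $\nu$ being any unit vector in $\mathbb{R}^n$.
   Context: $\mathbb{N}$ contains $0$. $|\cdot|$ is the Euclidean norm on $\mathbb{R}^n$; $S_{n-1}=\{x\in\mathbb{R}^n : |x|=1\}$ is the unit sphere, with surface measure $d\omega$. For a multi-index $\alpha\in\mathbb{N}^n$, $|\alpha|=\alpha_1+\cdots+\alpha_n$ and $\partial^\alpha$ is the corresponding distributional derivative. For $r\in\mathbb{N}$, $W^{r,p}(\Omega)$ is the usual Sobolev space of $v\in L^p(\Omega)$ with $\partial^\alpha v\in L^p(\Omega)$ for all $|\alpha|\le r$. For $l\in\mathbb{N}$ and $\sigma\in(0,1)$, the intrinsic (Gagliardo) semi-norm of order $l+\sigma$ is defined by $$|v|_{l+\sigma,p,\Omega}^p=\sum_{|\alpha|=l}\int_{\Omega\times\Omega}\frac{|\partial^\alpha v(x)-\partial^\alpha v(y)|^p}{|x-y|^{n+p\sigma}}\,dx\,dy.$$ For $l\in\mathbb{N}$ and $v\in W^{l+1,p}(\Omega)$, $$|\nabla v|_{0,p,\Omega}=\Bigl(\int_\Omega|\nabla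 v(x)|^p\,dx\Bigr)^{1/p},\qquad |\nabla v|_{l,p,\Omega}=\Bigl(\sum_{|\alpha|=l}|\nabla(\partial^\alpha v)|_{0,p,\Omega}^p\Bigr)^{1/p}.$$ *)

theory Defs
  imports "HOL-Analysis.Analysis"
begin

section \<open>Multi-indices, test functions and weak derivatives\<close>

definition mi_order :: "('n::finite \<Rightarrow> nat) \<Rightarrow> nat" where
  "mi_order \<alpha> = (\<Sum>i\<in>UNIV. \<alpha> i)"

definition mi_unit :: "'n \<Rightarrow> 'n \<Rightarrow> nat" where
  "mi_unit i = (\<lambda>j. if j = i then 1 else 0)"

text \<open>The sums over all multi-indices of a given order are finite sums.\<close>

lemma finite_mi_order: "finite {\<alpha> :: 'n::finite \<Rightarrow> nat. mi_order \<alpha> = l}"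
proof (rule finite_subset)
  show "{\<alpha> :: 'n \<Rightarrow> nat. mi_order \<alpha> = l} \<subseteq> Pi\<^sub>E UNIV (\<lambda>_. {..l})"
    by (auto simp: mi_order_def intro: member_le_sum)
  show "finite (Pi\<^sub>E (UNIV :: 'n set) (\<lambda>_. {..l}))"
    by (intro finite_PiE) auto
qed

definition partial_deriv :: "'n \<Rightarrow> (real^'n \<Rightarrow> real) \<Rightarrow> real^'n \<Rightarrow> real" where
  "partial_deriv i \<phi> = (\<lambda>x. frechet_derivative \<phi> (at x) (axis i 1))"

definition iter_partial_deriv :: "'n list \<Rightarrow> (real^'n \<Rightarrow> real) \<Rightarrow> real^'n \<Rightarrow> real" where
  "iter_partial_deriv is \<phi> = fold partial_deriv is \<phi>"

definition C_infinity :: "(real^'n \<Rightarrow> real) \<Rightarrow> bool" where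
  "C_infinity \<phi> \<longleftrightarrow> (\<forall>is. iter_partial_deriv is \<phi> differentiable_on UNIV)"

text \<open>The classical derivative of multi-index \<open>\<alpha>\<close>. It is only applied to smooth functions,
  for which the order in which the partial derivatives are taken does not matter, so any list
  containing each index \<open>i\<close> exactly \<open>\<alpha> i\<close> times may be used.\<close>

definition mi_deriv :: "('n::finite \<Rightarrow> nat) \<Rightarrow> (real^'n \<Rightarrow> real) \<Rightarrow> real^'n \<Rightarrow> real" where
  "mi_deriv \<alpha> \<phi> = iter_partial_deriv (SOME is. \<forall>i. count_list is i = \<alpha> i) \<phi>"

text \<open>Elements of \<open>C\<^sub>c\<^sup>\<infinity>(\<Omega>)\<close>, extended by zero to the whole space.\<close>

definition test_function :: "(real^'n) set \<Rightarrow> (real^'n \<Rightarrow> real) \<Rightarrow> bool" where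
  "test_function \<Omega> \<phi> \<longleftrightarrow>
     C_infinity \<phi> \<and> compact (closure {x. \<phi> x \<noteq> 0}) \<and> closure {x. \<phi> x \<noteq> 0} \<subseteq> \<Omega>"

definition locally_integrable :: "(real^'n) set \<Rightarrow> (real^'n \<Rightarrow> real) \<Rightarrow> bool" where
  "locally_integrable \<Omega> v \<longleftrightarrow> (\<forall>C. compact C \<and> C \<subseteq> \<Omega> \<longrightarrow> integrable (lebesgue_on C) v)"

text \<open>The distributional derivative of order \<open>\<alpha>\<close> of \<open>v\<close> on \<open>\<Omega>\<close> is the function \<open>g\<close>.\<close>

definition has_weak_deriv ::
  "(real^'n) set \<Rightarrow> ('n::finite \<Rightarrow> nat) \<Rightarrow> (real^'n \<Rightarrow> real) \<Rightarrow> (real^'n \<Rightarrow> real) \<Rightarrow> bool" where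
  "has_weak_deriv \<Omega> \<alpha> v g \<longleftrightarrow>
     locally_integrable \<Omega> v \<and> locally_integrable \<Omega> g \<and>
     (\<forall>\<phi>. test_function \<Omega> \<phi> \<longrightarrow>
        (LINT x|lebesgue_on \<Omega>. v x * mi_deriv \<alpha> \<phi> x) =
        (-1) ^ mi_order \<alpha> * (LINT x|lebesgue_on \<Omega>. g x * \<phi> x))"

text \<open>A representative of the distributional derivative, when this derivative is a function.
  Representatives agree almost everywhere on \<open>\<Omega>\<close>, and only integrals over \<open>\<Omega>\<close> are formed
  from them.\<close>

definition weak_deriv ::
  "(real^'n) set \<Rightarrow> ('n::finite \<Rightarrow> nat) \<Rightarrow> (real^'n \<Rightarrow> real) \<Rightarrow> real^'n \<Rightarrow> real" where
  "weak_deriv \<Omega> \<alpha> v = (SOME g. has_weak_deriv \<Omega> \<alpha> v g)"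

definition weak_grad :: "(real^'n) set \<Rightarrow> (real^'n::finite \<Rightarrow> real) \<Rightarrow> real^'n \<Rightarrow> real^'n" where
  "weak_grad \<Omega> v x = (\<chi> i. weak_deriv \<Omega> (mi_unit i) v x)"


section \<open>Sobolev spaces and semi-norms\<close>

definition Lp_space :: "real \<Rightarrow> (real^'n) set \<Rightarrow> (real^'n \<Rightarrow> real) set" where
  "Lp_space p \<Omega> = {v. v \<in> borel_measurable (lebesgue_on \<Omega>) \<and>
                       integrable (lebesgue_on \<Omega>) (\<lambda>x. \<bar>v x\<bar> powr p)}"

definition sobolev_space :: "nat \<Rightarrow> real \<Rightarrow> (real^'n::finite) set \<Rightarrow> (real^'n \<Rightarrow> real) set" where
  "sobolev_space r p \<Omega> =
     {v \<in> Lp_space p \<Omega>. \<forall>\<alpha>. mi_order \<alpha> \<le> r \<longrightarrow> (\<exists>g\<in>Lp_space p \<Omega>. has_weak_deriv \<Omega> \<alpha> v g)}"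

text \<open>The \<open>p\<close>-th power of the Gagliardo semi-norm of order \<open>l + \<sigma>\<close>, as an element of
  \<open>[0, \<infinity>]\<close>.\<close>

definition gagliardo_pow ::
  "nat \<Rightarrow> real \<Rightarrow> real \<Rightarrow> (real^'n::finite) set \<Rightarrow> (real^'n \<Rightarrow> real) \<Rightarrow> ennreal" where
  "gagliardo_pow l \<sigma> p \<Omega> v =
     (\<Sum>\<alpha> | mi_order \<alpha> = l.
        \<integral>\<^sup>+(x, y). ennreal (\<bar>weak_deriv \<Omega> \<alpha> v x - weak_deriv \<Omega> \<alpha> v y\<bar> powr p
                        / norm (x - y) powr (real CARD('n) + p * \<sigma>))
           \<partial>lebesgue_on (\<Omega> \<times> \<Omega>))"

definition grad_norm0 :: "real \<Rightarrow> (real^'n::finite) set \<Rightarrow> (real^'n \<Rightarrow> real) \<Rightarrow> real" where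
  "grad_norm0 p \<Omega> v = (LINT x|lebesgue_on \<Omega>. norm (weak_grad \<Omega> v x) powr p) powr (1 / p)"

definition grad_seminorm :: "nat \<Rightarrow> real \<Rightarrow> (real^'n::finite) set \<Rightarrow> (real^'n \<Rightarrow> real) \<Rightarrow> real" where
  "grad_seminorm l p \<Omega> v =
     (\<Sum>\<alpha> | mi_order \<alpha> = l. grad_norm0 p \<Omega> (weak_deriv \<Omega> \<alpha> v) powr p) powr (1 / p)"


section \<open>Lipschitz boundaries\<close>

text \<open>Near each boundary point, \<open>\<Omega>\<close> is the set lying strictly on one side of the graph of a
  Lipschitz function in suitable orthogonal coordinates: \<open>e\<close> is the direction of the last
  coordinate axis, and the hyperplane orthogonal to \<open>e\<close> plays the role of the space of the first
  \<open>n - 1\<close> coordinates. It follows that the boundary is the graph itself near that point.\<close>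

definition lipschitz_boundary :: "(real^'n) set \<Rightarrow> bool" where
  "lipschitz_boundary \<Omega> \<longleftrightarrow>
     (\<forall>z\<in>frontier \<Omega>. \<exists>r>0. \<exists>e g L. norm e = 1 \<and> L-lipschitz_on {y. y \<bullet> e = 0} g \<and>
        \<Omega> \<inter> ball z r = {x \<in> ball z r. x \<bullet> e > g (x - (x \<bullet> e) *\<^sub>R e)})"


section \<open>Surface measure of the unit sphere\<close>

text \<open>The surface measure of \<open>A \<subseteq> S\<^bsub>n-1\<^esub>\<close> is \<open>n\<close> times the volume of the cone
  \<open>{t \<omega> | 0 < t < 1, \<omega> \<in> A}\<close>; equivalently, it is the measure of the polar coordinate formula
  \<open>dx = r\<^bsup>n-1\<^esup> dr d\<omega>\<close>. For \<open>n = 1\<close> it is the counting measure on \<open>{-1, 1}\<close>.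
  Recall that \<open>sgn x = x / |x|\<close>.\<close>

definition sphere_measure :: "(real^'n) measure" where
  "sphere_measure =
     scale_measure (of_nat CARD('n))
       (distr (restrict_space lborel (ball 0 1 - {0})) (restrict_space borel (sphere 0 1)) sgn)"

lemma emeasure_sphere_measure:
  fixes A :: "(real^'n) set"
  assumes "A \<in> sets borel" "A \<subseteq> sphere 0 1"
  shows "emeasure sphere_measure A =
           of_nat CARD('n) * emeasure lborel {t *\<^sub>R \<omega> | t \<omega>. 0 < t \<and> t < 1 \<and> \<omega> \<in> A}"
proof -
  let ?B = "ball 0 1 - {0} :: (real^'n) set"
  have sgn_m: "sgn \<in> restrict_space lborel ?B \<rightarrow>\<^sub>M restrict_space borel (sphere 0 1)"
  proof (rule measurable_restrict_space2)
    show "sgn \<in> space (restrict_space lborel ?B) \<rightarrow> sphere 0 1"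
      by (auto simp: space_restrict_space norm_sgn)
    have "(\<lambda>x. x /\<^sub>R norm x) \<in> borel_measurable (lborel :: (real^'n) measure)"
      by measurable
    then show "sgn \<in> borel_measurable (restrict_space lborel ?B)"
      by (intro measurable_restrict_space1) (simp add: sgn_div_norm[abs_def])
  qed
  have A: "A \<in> sets (restrict_space borel (sphere 0 1))"
    using assms by (auto simp: sets_restrict_space_iff)
  have eq: "sgn -` A \<inter> ?B = {t *\<^sub>R \<omega> | t \<omega>. 0 < t \<and> t < 1 \<and> \<omega> \<in> A}"
  proof (intro equalityI subsetI)
    fix x assume "x \<in> sgn -` A \<inter> ?B"
    then show "x \<in> {t *\<^sub>R \<omega> | t \<omega>. 0 < t \<and> t < 1 \<and> \<omega> \<in> A}"
      by (intro CollectI exI[of _ "norm x"] exI[of _ "sgn x"]) (auto simp: sgn_div_norm)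
  next
    fix x assume "x \<in> {t *\<^sub>R \<omega> | t \<omega>. 0 < t \<and> t < 1 \<and> \<omega> \<in> A}"
    then obtain t \<omega> where t: "x = t *\<^sub>R \<omega>" "0 < t" "t < 1" and w: "\<omega> \<in> A"
      by blast
    have "norm \<omega> = 1" using w assms by auto
    with t w show "x \<in> sgn -` A \<inter> ?B"
      by (auto simp: sgn_div_norm)
  qed
  have "emeasure sphere_measure A =
      of_nat CARD('n) * emeasure (restrict_space lborel ?B) (sgn -` A \<inter> ?B)"
    using A sgn_m by (simp add: sphere_measure_def emeasure_distr space_restrict_space)
  also have "emeasure (restrict_space lborel ?B) (sgn -` A \<inter> ?B) = emeasure lborel (sgn -` A \<inter> ?B)"
    by (intro emeasure_restrict_space) auto
  finally show ?thesis by (simp add: eq)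
qed

definition K_const :: "real \<Rightarrow> real^'n \<Rightarrow> real" where
  "K_const p \<nu> = (LINT \<omega>|sphere_measure. \<bar>\<omega> \<bullet> \<nu>\<bar> powr p)"

end

theory Submission
  imports Defs "HOL-Probability.Probability" "HOL-Real_Asymp.Real_Asymp"
begin

text \<open>
  Let \<open>u\<close> be one of the derivatives \<open>\<partial>\<^sup>\<alpha> v\<close> with \<open>|\<alpha>| = l\<close>, and let \<open>g\<close> be its weak gradient. After the
  substitution \<open>y = x + h\<close> the Gagliardo integral is \<open>\<integral> F h / |h| powr (n + p \<sigma>) dh\<close>, where
  \<open>F h = \<integral> |u (x + h) - u x| powr p dx\<close> extends over all \<open>x\<close> with \<open>x\<close> and \<open>x + h\<close> in \<open>\<Omega>\<close>
  (\<open>diff_energy\<close>). The factor \<open>1 - \<sigma>\<close> kills the contribution of \<open>|h| \<ge> \<eta>\<close>, so only the behaviour of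
  \<open>F\<close> at \<open>0\<close> counts, and the heart of the matter is
  \<open>F h = M h + o(|h| powr p)\<close> with \<open>M h = \<integral> |g x \<bullet> h| powr p dx\<close> (\<open>grad_energy\<close>).
  For \<open>M\<close> in place of \<open>F\<close> polar coordinates give the limit: with \<open>s = p (1 - \<sigma>)\<close>, the integral of
  \<open>|w \<bullet> h| powr p / |h| powr (n + p \<sigma>)\<close> over \<open>|h| < \<eta>\<close> is \<open>(K / s) \<eta> powr s |w| powr p\<close>, and
  \<open>(1 - \<sigma>) / s = 1 / p\<close> while \<open>\<eta> powr s\<close> tends to \<open>1\<close>.

  Both halves of the expansion of \<open>F\<close> come from one identity, \<open>difference_eq_segment_integral\<close>: for fixed
  \<open>h\<close> and almost every \<open>x\<close> such that the segment from \<open>x\<close> to \<open>x + h\<close> stays in \<open>\<Omega>\<close>, the increment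
  \<open>u (x + h) - u x\<close> is the integral of \<open>g (x + t h) \<bullet> h\<close> over \<open>0 \<le> t \<le> 1\<close>. It is the fundamental theorem of
  calculus for test functions, moved to \<open>u\<close> by duality and the fundamental lemma of the calculus of
  variations. Jensen's inequality then bounds integrals of \<open>|u (x + h) - u x| powr p\<close> by integrals of
  \<open>|g \<bullet> h| powr p\<close> over the points which the segments visit (\<open>increment_bound\<close>), and the continuity of
  translations in \<open>L\<^sup>p\<close> makes the difference of \<open>u (x + h) - u x\<close> and \<open>g x \<bullet> h\<close> negligible away from
  the boundary (\<open>linearization_bound\<close>).

  Near the boundary the segment may leave \<open>\<Omega>\<close>. There the increment is taken along a detour: from \<open>x\<close> by
  \<open>c e\<close> into the domain, then by \<open>h\<close>, then back by \<open>- c e\<close>, where \<open>e\<close> is the axis of a Lipschitz chart and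
  \<open>c = (L + 1) |h|\<close>. In the chart \<open>\<Omega>\<close> is the region above a graph of slope at most \<open>L\<close>, so all three legs
  stay inside (\<open>chart_detour\<close>). Hence the part of \<open>F h\<close> that comes from a boundary strip is at most
  \<open>C |h| powr p\<close> times the mass of \<open>|g| powr p\<close> in a strip of twice the width, which is small
  (\<open>boundary_estimate\<close>, \<open>strip_mass_small\<close>). This replaces the extension of \<open>u\<close> to the whole space.

  Two formal points concern the definitions. Weak derivatives are chosen representatives; they are unique almost
  everywhere by the fundamental lemma, and \<open>\<partial>\<^sub>i \<partial>\<^sup>\<alpha> v\<close> is the weak derivative of order \<open>\<alpha> + e\<^sub>i\<close>
  because mixed derivatives of test functions commute. The constant \<open>K\<close> is the same for all unit vectors because
  Lebesgue measure is invariant under orthogonal maps.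
\<close>

section \<open>Mixed partial derivatives of smooth functions\<close>

lemma C_infinity_differentiable:
  assumes "C_infinity \<phi>"
  shows "\<phi> differentiable (at x)"
proof -
  have "iter_partial_deriv [] \<phi> differentiable_on UNIV"
    using assms unfolding C_infinity_def by blast
  then show ?thesis
    by (simp add: iter_partial_deriv_def differentiable_on_def)
qed

lemma C_infinity_continuous_on:
  assumes "C_infinity \<phi>"
  shows "continuous_on S \<phi>"
  using C_infinity_differentiable[OF assms]
  by (intro continuous_at_imp_continuous_on ballI differentiable_imp_continuous_within)

lemma C_infinity_borel_measurable:
  assumes "C_infinity \<phi>"
  shows "\<phi> \<in> borel_measurable borel"
  using C_infinity_continuous_on[OF assms] by (rule borel_measurable_continuous_onI)

lemma C_infinity_partial_deriv:
  assumes "C_infinity \<phi>"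
  shows "C_infinity (partial_deriv i \<phi>)"
  unfolding C_infinity_def
proof
  fix js
  have "iter_partial_deriv (i # js) \<phi> differentiable_on UNIV"
    using assms unfolding C_infinity_def by blast
  then show "iter_partial_deriv js (partial_deriv i \<phi>) differentiable_on UNIV"
    by (simp add: iter_partial_deriv_def)
qed

lemma C_infinity_line_derivative:
  assumes "C_infinity \<phi>"
  shows "((\<lambda>t. \<phi> (a + t *\<^sub>R axis i 1)) has_real_derivative
           partial_deriv i \<phi> (a + t *\<^sub>R axis i 1)) (at t)"
proof -
  let ?x = "a + t *\<^sub>R axis i 1" and ?D = "frechet_derivative \<phi> (at (a + t *\<^sub>R axis i 1))"
  have D: "(\<phi> has_derivative ?D) (at ?x)"
    using C_infinity_differentiable[OF assms] frechet_derivative_works by blast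
  have "((\<lambda>t. a + t *\<^sub>R axis i 1) has_derivative (\<lambda>s. s *\<^sub>R axis i 1)) (at t)"
    by (auto intro!: derivative_eq_intros)
  from has_derivative_compose[OF this] D
  have "((\<lambda>t. \<phi> (a + t *\<^sub>R axis i 1)) has_derivative (\<lambda>s. ?D (s *\<^sub>R axis i 1))) (at t)"
    by blast
  moreover have "?D (s *\<^sub>R axis i 1) = s * ?D (axis i 1)" for s
    using has_derivative_linear[OF D] by (simp add: linear_cmul)
  ultimately show ?thesis
    by (simp add: has_field_derivative_def partial_deriv_def mult_commute_abs)
qed

text \<open>The mean value theorem, applied to the increment in direction \<open>j\<close> along \<open>e\<^sub>i\<close> and then to \<open>\<partial>\<^sub>i \<phi>\<close>
along \<open>e\<^sub>j\<close>. The left-hand side is symmetric in \<open>i\<close> and \<open>j\<close>, the right-hand side is not.\<close>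

lemma second_difference_mean_value:
  assumes "C_infinity \<phi>" "0 < s"
  obtains \<theta> \<eta> where "0 < \<theta>" "\<theta> < s" "0 < \<eta>" "\<eta> < s"
    "\<phi> (a + s *\<^sub>R axis i 1 + s *\<^sub>R axis j 1) - \<phi> (a + s *\<^sub>R axis i 1) - \<phi> (a + s *\<^sub>R axis j 1) + \<phi> a
       = s * s * partial_deriv j (partial_deriv i \<phi>) (a + \<theta> *\<^sub>R axis i 1 + \<eta> *\<^sub>R axis j 1)"
proof -
  let ?i = "axis i 1 :: real^'a" and ?j = "axis j 1 :: real^'a"
  let ?H = "\<lambda>t. \<phi> (a + s *\<^sub>R ?j + t *\<^sub>R ?i) - \<phi> (a + t *\<^sub>R ?i)"
  have "\<exists>\<theta>. 0 < \<theta> \<and> \<theta> < s \<and> ?H s - ?H 0 =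
      (s - 0) * (partial_deriv i \<phi> (a + s *\<^sub>R ?j + \<theta> *\<^sub>R ?i) - partial_deriv i \<phi> (a + \<theta> *\<^sub>R ?i))"
    by (rule MVT2[OF assms(2)]) (intro DERIV_diff C_infinity_line_derivative assms(1))
  then obtain \<theta> where \<theta>: "0 < \<theta>" "\<theta> < s" and 1: "?H s - ?H 0 =
      s * (partial_deriv i \<phi> (a + s *\<^sub>R ?j + \<theta> *\<^sub>R ?i) - partial_deriv i \<phi> (a + \<theta> *\<^sub>R ?i))"
    by auto
  let ?G = "\<lambda>t. partial_deriv i \<phi> (a + \<theta> *\<^sub>R ?i + t *\<^sub>R ?j)"
  have "\<exists>\<eta>. 0 < \<eta> \<and> \<eta> < s \<and> ?G s - ?G 0 =
      (s - 0) * partial_deriv j (partial_deriv i \<phi>) (a + \<theta> *\<^sub>R ?i + \<eta> *\<^sub>R ?j)"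
    by (rule MVT2[OF assms(2)])
      (intro C_infinity_line_derivative C_infinity_partial_deriv assms(1))
  then obtain \<eta> where \<eta>: "0 < \<eta>" "\<eta> < s" and 2: "?G s - ?G 0 =
      s * partial_deriv j (partial_deriv i \<phi>) (a + \<theta> *\<^sub>R ?i + \<eta> *\<^sub>R ?j)"
    by auto
  have "a + s *\<^sub>R ?j + t *\<^sub>R ?i = a + t *\<^sub>R ?i + s *\<^sub>R ?j" for t
    by simp
  with 1 2 show ?thesis
    by (intro that[OF \<theta> \<eta>]) simp
qed

text \<open>Both mixed derivatives at \<open>a\<close> are limits of the same second difference quotients, taken at nearby points, and
both are continuous.\<close>

lemma partial_deriv_commute:
  assumes "C_infinity \<phi>"
  shows "partial_deriv i (partial_deriv j \<phi>) = partial_deriv j (partial_deriv i \<phi>)"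
proof (rule ext, rule ccontr)
  fix a
  let ?P = "partial_deriv i (partial_deriv j \<phi>)" and ?Q = "partial_deriv j (partial_deriv i \<phi>)"
  let ?i = "axis i 1 :: real^'a" and ?j = "axis j 1 :: real^'a"
  assume ne: "?P a \<noteq> ?Q a"
  define e where "e = dist (?P a) (?Q a) / 2"
  have e: "e > 0" using ne by (simp add: e_def)
  have "isCont ?P a" "isCont ?Q a"
    using assms by (auto intro!: differentiable_imp_continuous_within C_infinity_differentiable
      C_infinity_partial_deriv)
  then obtain d1 d2 where d: "d1 > 0" "d2 > 0"
    "\<And>x. dist x a < d1 \<Longrightarrow> dist (?P x) (?P a) < e" "\<And>x. dist x a < d2 \<Longrightarrow> dist (?Q x) (?Q a) < e"
    using e unfolding continuous_at_eps_delta by blast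
  define s where "s = min d1 d2 / 3"
  have s: "0 < s" "2 * s < d1" "2 * s < d2" using d by (auto simp: s_def)
  have near: "dist (a + \<theta> *\<^sub>R axis k 1 + \<eta> *\<^sub>R axis m 1) a < 2 * s"
    if "0 < \<theta>" "\<theta> < s" "0 < \<eta>" "\<eta> < s" for \<theta> \<eta> and k m :: 'a
  proof -
    have "norm (\<theta> *\<^sub>R axis k 1 + \<eta> *\<^sub>R axis m 1 :: real^'a) \<le> \<theta> + \<eta>"
      using that by (intro norm_triangle_le) (simp add: norm_axis_1)
    then show ?thesis using that by (simp add: dist_norm add.assoc)
  qed
  obtain \<theta> \<eta> where 1: "0 < \<theta>" "\<theta> < s" "0 < \<eta>" "\<eta> < s"
    "\<phi> (a + s *\<^sub>R ?i + s *\<^sub>R ?j) - \<phi> (a + s *\<^sub>R ?i) - \<phi> (a + s *\<^sub>R ?j) + \<phi> a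
       = s * s * ?Q (a + \<theta> *\<^sub>R ?i + \<eta> *\<^sub>R ?j)"
    by (rule second_difference_mean_value[OF assms s(1)])
  obtain \<theta>' \<eta>' where 2: "0 < \<theta>'" "\<theta>' < s" "0 < \<eta>'" "\<eta>' < s"
    "\<phi> (a + s *\<^sub>R ?j + s *\<^sub>R ?i) - \<phi> (a + s *\<^sub>R ?j) - \<phi> (a + s *\<^sub>R ?i) + \<phi> a
       = s * s * ?P (a + \<theta>' *\<^sub>R ?j + \<eta>' *\<^sub>R ?i)"
    by (rule second_difference_mean_value[OF assms s(1)])
  have sw: "a + s *\<^sub>R ?j + s *\<^sub>R ?i = a + s *\<^sub>R ?i + s *\<^sub>R ?j" by simp
  have mm: "s * s * ?Q (a + \<theta> *\<^sub>R ?i + \<eta> *\<^sub>R ?j) = s * s * ?P (a + \<theta>' *\<^sub>R ?j + \<eta>' *\<^sub>R ?i)"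
    using 1(5) 2(5) unfolding sw by linarith
  have ss: "s * s \<noteq> 0" using s(1) by simp
  have eq: "?Q (a + \<theta> *\<^sub>R ?i + \<eta> *\<^sub>R ?j) = ?P (a + \<theta>' *\<^sub>R ?j + \<eta>' *\<^sub>R ?i)"
    by (rule mult_left_cancel[OF ss, THEN iffD1, OF mm])
  have "dist (?P (a + \<theta>' *\<^sub>R ?j + \<eta>' *\<^sub>R ?i)) (?P a) < e"
    by (rule d(3)) (rule less_trans[OF near[OF 2(1-4)] s(2)])
  moreover have "dist (?Q (a + \<theta> *\<^sub>R ?i + \<eta> *\<^sub>R ?j)) (?Q a) < e"
    by (rule d(4)) (rule less_trans[OF near[OF 1(1-4)] s(3)])
  ultimately have "dist (?P a) (?Q a) < e + e"
    unfolding eq using dist_triangle2[of "?P a" "?Q a" "?P (a + \<theta>' *\<^sub>R ?j + \<eta>' *\<^sub>R ?i)"]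
    by (simp add: dist_commute)
  then show False by (simp add: e_def)
qed

lemma iter_partial_deriv_permute:
  assumes "C_infinity \<phi>" "mset ks = mset js"
  shows "iter_partial_deriv ks \<phi> = iter_partial_deriv js \<phi>"
  unfolding iter_partial_deriv_def
  by (rule fold_permuted_eq[where P=C_infinity, OF assms(2) assms(1)])
    (rule C_infinity_partial_deriv partial_deriv_commute, assumption)+

lemma ex_list_with_counts: "\<exists>ks. \<forall>i. count_list ks i = (\<alpha> i :: nat)" for \<alpha> :: "'n::finite \<Rightarrow> nat"
proof -
  obtain ks where "mset ks = Abs_multiset \<alpha>"
    using ex_mset by blast
  moreover have "count (Abs_multiset \<alpha>) = \<alpha>"
    by (rule count_Abs_multiset) simp
  ultimately show ?thesis
    by (metis count_mset)
qed

text \<open>The list of indices chosen in the definition of \<open>mi_deriv\<close> may be replaced by any other one with the same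
multiplicities.\<close>

lemma mi_deriv_eq_iter:
  fixes \<alpha> :: "'n::finite \<Rightarrow> nat"
  assumes "C_infinity \<phi>" "\<And>i. count_list ks i = \<alpha> i"
  shows "mi_deriv \<alpha> \<phi> = iter_partial_deriv ks \<phi>"
  unfolding mi_deriv_def
proof (rule iter_partial_deriv_permute[OF assms(1)], rule multiset_eqI)
  fix i
  have "\<forall>i. count_list (SOME ks. \<forall>i. count_list ks i = \<alpha> i) i = \<alpha> i"
    by (rule someI_ex[OF ex_list_with_counts])
  then show "count (mset (SOME ks. \<forall>i. count_list ks i = \<alpha> i)) i = count (mset ks) i"
    using assms(2) by (simp add: count_mset)
qed

lemma mi_deriv_unit:
  assumes "C_infinity \<phi>"
  shows "mi_deriv (mi_unit i) \<phi> = partial_deriv i \<phi>"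
proof -
  have "mi_deriv (mi_unit i) \<phi> = iter_partial_deriv [i] \<phi>"
    by (rule mi_deriv_eq_iter[OF assms]) (simp add: mi_unit_def)
  then show ?thesis by (simp add: iter_partial_deriv_def)
qed

text \<open>This composition rule turns a weak derivative of a weak derivative into one of higher order.\<close>

lemma mi_deriv_partial_deriv:
  fixes \<alpha> :: "'n::finite \<Rightarrow> nat"
  assumes "C_infinity \<phi>"
  shows "mi_deriv \<alpha> (partial_deriv i \<phi>) = mi_deriv (\<lambda>j. \<alpha> j + mi_unit i j) \<phi>"
proof -
  obtain js where js: "\<And>j. count_list js j = \<alpha> j"
    using ex_list_with_counts[of \<alpha>] by blast
  have "mi_deriv (\<lambda>j. \<alpha> j + mi_unit i j) \<phi> = iter_partial_deriv (i # js) \<phi>"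
    by (rule mi_deriv_eq_iter[OF assms]) (simp add: js mi_unit_def)
  moreover have "mi_deriv \<alpha> (partial_deriv i \<phi>) = iter_partial_deriv js (partial_deriv i \<phi>)"
    by (rule mi_deriv_eq_iter[OF C_infinity_partial_deriv[OF assms] js])
  ultimately show ?thesis by (simp add: iter_partial_deriv_def)
qed

lemma test_function_partial_deriv:
  assumes "test_function \<Omega> \<phi>"
  shows "test_function \<Omega> (partial_deriv i \<phi>)"
proof -
  \<comment> \<open>Off the support \<open>\<phi>\<close> vanishes on an open set, so its derivatives vanish there too.\<close>
  define K where "K = closure {x. \<phi> x \<noteq> 0}"
  have sm: "C_infinity \<phi>" and K: "compact K" "K \<subseteq> \<Omega>"
    using assms unfolding K_def test_function_def by blast+
  have zero: "0 = \<phi> y" if "y \<in> - K" for y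
    using that closure_subset[of "{x. \<phi> x \<noteq> 0}"] unfolding K_def by force
  have cl: "closed K" by (simp add: K_def)
  have "partial_deriv i \<phi> x = 0" if "x \<notin> K" for x
  proof -
    have "(\<phi> has_derivative (\<lambda>_. 0)) (at x)"
      by (rule has_derivative_transform_within_open[of "\<lambda>_. 0" _ x UNIV "- K"])
        (use that cl zero in \<open>simp_all add: open_Compl\<close>)
    then have "frechet_derivative \<phi> (at x) = (\<lambda>_. 0)"
      by (rule frechet_derivative_at[symmetric])
    then show ?thesis
      by (simp add: partial_deriv_def)
  qed
  then have "{x. partial_deriv i \<phi> x \<noteq> 0} \<subseteq> K" by blast
  then have sub: "closure {x. partial_deriv i \<phi> x \<noteq> 0} \<subseteq> K"
    using cl by (rule closure_minimal)
  then have "closure {x. partial_deriv i \<phi> x \<noteq> 0} = K \<inter> closure {x. partial_deriv i \<phi> x \<noteq> 0}"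
    by blast
  also have "compact \<dots>"
    by (rule compact_Int_closed[OF K(1) closed_closure])
  finally have "compact (closure {x. partial_deriv i \<phi> x \<noteq> 0})" .
  then show ?thesis
    using sub K(2) C_infinity_partial_deriv[OF sm] unfolding test_function_def by blast
qed

section \<open>Smooth bump functions on boxes\<close>

text \<open>Smoothness in one variable is coinductive: a class of differentiable functions which contains a derivative of
  each of its members consists of smooth functions, without any count of orders of differentiation.\<close>

coinductive smooth_real :: "(real \<Rightarrow> real) \<Rightarrow> bool" where
  smooth_realI: "(\<And>x. (f has_real_derivative f' x) (at x)) \<Longrightarrow> smooth_real f' \<Longrightarrow> smooth_real f"

lemma smooth_real_affine:
  assumes "smooth_real f"
  shows "smooth_real (\<lambda>t. f (c * t + d))"
proof -
  have "smooth_real h" if "\<exists>C f. smooth_real f \<and> h = (\<lambda>t. C * f (c * t + d))" for h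
    using that
  proof (coinduction arbitrary: h)
    case smooth_real
    then obtain C f where f: "smooth_real f" and h: "h = (\<lambda>t. C * f (c * t + d))"
      by blast
    from f obtain f' where f': "\<And>x. (f has_real_derivative f' x) (at x)" "smooth_real f'"
      by (cases rule: smooth_real.cases) blast
    have "(h has_real_derivative (C * c) * f' (c * x + d)) (at x)" for x
      unfolding h by (rule derivative_eq_intros DERIV_chain2[OF f'(1)] refl)+ simp
    with f'(2) show ?case
      by (intro exI[of _ h] exI[of _ "\<lambda>x. (C * c) * f' (c * x + d)"]) blast
  qed
  from this[of "\<lambda>t. 1 * f (c * t + d)"] assms show ?thesis
    by (metis (no_types, lifting) ext mult_1)
qed

text \<open>Products of two smooth functions are not closed under differentiation, but finite sums of them are, by
  the product rule; they form the invariant for the coinduction below.\<close>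

inductive sum_of_smooth_products :: "(real \<Rightarrow> real) \<Rightarrow> bool" where
  "smooth_real f \<Longrightarrow> smooth_real g \<Longrightarrow> sum_of_smooth_products (\<lambda>x. f x * g x)"
| "sum_of_smooth_products u \<Longrightarrow> sum_of_smooth_products v \<Longrightarrow> sum_of_smooth_products (\<lambda>x. u x + v x)"

lemma smooth_real_mult:
  assumes "smooth_real f" "smooth_real g"
  shows "smooth_real (\<lambda>t. f t * g t)"
proof -
  have D: "\<exists>w'. (\<forall>x. (w has_real_derivative w' x) (at x)) \<and> sum_of_smooth_products w'"
    if "sum_of_smooth_products w" for w
    using that
  proof induction
    case (1 f g)
    obtain f' where f': "\<And>x. (f has_real_derivative f' x) (at x)" "smooth_real f'"
      using 1(1) by (cases rule: smooth_real.cases) blast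
    obtain g' where g': "\<And>x. (g has_real_derivative g' x) (at x)" "smooth_real g'"
      using 1(2) by (cases rule: smooth_real.cases) blast
    have "((\<lambda>x. f x * g x) has_real_derivative f' x * g x + f x * g' x) (at x)" for x
      by (rule derivative_eq_intros f' g' refl)+ simp
    moreover have "sum_of_smooth_products (\<lambda>x. f' x * g x + f x * g' x)"
      by (intro sum_of_smooth_products.intros 1 f' g')
    ultimately show ?case
      using exI[of "\<lambda>w'. (\<forall>x. ((\<lambda>x. f x * g x) has_real_derivative w' x) (at x)) \<and> sum_of_smooth_products w'"
          "\<lambda>x. f' x * g x + f x * g' x"]
      by simp
  next
    case (2 u v)
    then obtain u' v' where
      "\<And>x. (u has_real_derivative u' x) (at x)" "sum_of_smooth_products u'"
      "\<And>x. (v has_real_derivative v' x) (at x)" "sum_of_smooth_products v'"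
      by blast
    then show ?case
      by (intro exI[of _ "\<lambda>x. u' x + v' x"]) (auto intro: DERIV_add sum_of_smooth_products.intros)
  qed
  have "sum_of_smooth_products (\<lambda>t. f t * g t)"
    using assms by (rule sum_of_smooth_products.intros)
  then show ?thesis
  proof (rule smooth_real.coinduct[where X=sum_of_smooth_products])
    fix w assume "sum_of_smooth_products w"
    from D[OF this] obtain w' where
      "\<And>x. (w has_real_derivative w' x) (at x)" "sum_of_smooth_products w'"
      by (elim exE conjE) (rule that, simp_all)
    then show "\<exists>f f'. w = f \<and> (\<forall>x. (f has_real_derivative f' x) (at x)) \<and>
        (sum_of_smooth_products f' \<or> smooth_real f')"
      by (intro exI[of _ w] exI[of _ w']) simp
  qed
qed

text \<open>The classical flat function \<open>exp (- 1 / t)\<close>, extended by zero, together with all functions that arise from it by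
differentiation: each derivative multiplies it by a polynomial in \<open>1 / t\<close>.\<close>

definition flat_exp :: "real poly \<Rightarrow> real \<Rightarrow> real" where
  "flat_exp q t = (if t > 0 then poly q (1 / t) * exp (- (1 / t)) else 0)"

lemma poly_over_exp_tendsto_0: "((\<lambda>y. poly q y * exp (- y)) \<longlongrightarrow> 0) at_top" for q :: "real poly"
proof -
  have "((\<lambda>y. \<Sum>i\<le>degree q. coeff q i * (y ^ i / exp y)) \<longlongrightarrow> (\<Sum>i\<le>degree q. coeff q i * 0)) at_top"
    by (intro tendsto_intros tendsto_power_div_exp_0)
  moreover have "(\<Sum>i\<le>degree q. coeff q i * (y ^ i / exp y)) = poly q y * exp (- y)" for y
    by (simp add: poly_altdef sum_distrib_right exp_minus divide_inverse mult.assoc)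
  ultimately show ?thesis by simp
qed

text \<open>For \<open>t > 0\<close> the chain rule produces the factor \<open>1 / t\<^sup>2\<close>, which is the polynomial \<open>[:0, 0, 1:]\<close> in \<open>1 / t\<close>. At
\<open>t = 0\<close> the exponential beats every power of \<open>1 / t\<close>.\<close>

lemma flat_exp_derivative:
  "(flat_exp q has_real_derivative flat_exp ([:0, 0, 1:] * (q - pderiv q)) t) (at t)"
proof -
  consider "t > 0" | "t < 0" | "t = 0" by linarith
  then show ?thesis
  proof cases
    case 1
    have "((\<lambda>t. poly q (1 / t) * exp (- (1 / t))) has_real_derivative
        poly (pderiv q) (1 / t) * (- (1 / t\<^sup>2)) * exp (- (1 / t)) + poly q (1 / t) * (exp (- (1 / t)) * (1 / t\<^sup>2))) (at t)"
      using 1 by (auto intro!: derivative_eq_intros DERIV_chain2[OF poly_DERIV] simp: power2_eq_square)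
    moreover have "poly (pderiv q) (1 / t) * (- (1 / t\<^sup>2)) * exp (- (1 / t)) + poly q (1 / t) * (exp (- (1 / t)) * (1 / t\<^sup>2))
        = flat_exp ([:0, 0, 1:] * (q - pderiv q)) t"
      using 1 by (simp add: flat_exp_def algebra_simps power2_eq_square)
    ultimately have "((\<lambda>t. poly q (1 / t) * exp (- (1 / t))) has_real_derivative
        flat_exp ([:0, 0, 1:] * (q - pderiv q)) t) (at t)"
      by simp
    then show ?thesis
      by (rule has_field_derivative_transform_within_open[where S="{0<..}"])
        (use 1 in \<open>auto simp: flat_exp_def\<close>)
  next
    case 2
    have "((\<lambda>_. 0) has_real_derivative 0) (at t)" by simp
    then have "(flat_exp q has_real_derivative 0) (at t)"
      by (rule has_field_derivative_transform_within_open[where S="{..<0}"])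
        (use 2 in \<open>auto simp: flat_exp_def\<close>)
    with 2 show ?thesis by (simp add: flat_exp_def)
  next
    case 3
    have R: "((\<lambda>h. poly (pCons 0 q) (inverse h) * exp (- inverse h)) \<longlongrightarrow> 0) (at_right 0)"
      by (rule filterlim_compose[OF poly_over_exp_tendsto_0 filterlim_inverse_at_top_right])
    have "((\<lambda>h. flat_exp q h / h) \<longlongrightarrow> 0) (at_right 0)"
      by (rule Lim_transform_eventually[OF R], rule eventually_at_right_less[THEN eventually_mono])
        (auto simp: flat_exp_def field_simps)
    moreover have "((\<lambda>h. flat_exp q h / h) \<longlongrightarrow> 0) (at_left 0)"
      by (rule Lim_transform_eventually[of "\<lambda>_. 0"])
        (auto simp: flat_exp_def eventually_at_left_field intro: exI[of _ "-1"])
    ultimately have "((\<lambda>h. flat_exp q h / h) \<longlongrightarrow> 0) (at 0)"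
      by (simp add: filterlim_split_at)
    with 3 show ?thesis
      by (simp add: DERIV_def flat_exp_def)
  qed
qed

lemma smooth_real_flat_exp: "smooth_real (flat_exp q)"
proof (coinduction arbitrary: q)
  case smooth_real
  then show ?case using flat_exp_derivative by blast
qed

lemma prod_has_derivative_coordinates:
  fixes f f' :: "'n::finite \<Rightarrow> real \<Rightarrow> real"
  assumes "\<And>i t. (f i has_real_derivative f' i t) (at t)"
  shows "((\<lambda>x::real^'n. \<Prod>i\<in>UNIV. f i (x $ i)) has_derivative
           (\<lambda>h. \<Sum>i\<in>UNIV. (f' i (x $ i) * (h $ i)) * (\<Prod>j\<in>UNIV - {i}. f j (x $ j)))) (at x)"
proof (rule has_derivative_prod)
  fix i :: 'n
  have "((\<lambda>x::real^'n. x $ i) has_derivative (\<lambda>h. h $ i)) (at x)"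
    by (rule bounded_linear_imp_has_derivative[OF bounded_linear_vec_nth])
  then show "((\<lambda>x::real^'n. f i (x $ i)) has_derivative (\<lambda>h. f' i (x $ i) * h $ i)) (at x)"
    using has_derivative_compose[OF _ assms[of i, unfolded has_field_derivative_def]] by blast
qed

text \<open>A partial derivative only replaces one factor by its derivative, so the form of the function is preserved.\<close>

lemma C_infinity_prod_coordinates:
  fixes f :: "'n::finite \<Rightarrow> real \<Rightarrow> real"
  assumes "\<And>i. smooth_real (f i)"
  shows "C_infinity (\<lambda>x. \<Prod>i\<in>UNIV. f i (x $ i))"
  unfolding C_infinity_def
proof
  fix js
  show "iter_partial_deriv js (\<lambda>x::real^'n. \<Prod>i\<in>UNIV. f i (x $ i)) differentiable_on UNIV"
    using assms
  proof (induction js arbitrary: f)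
    case Nil
    have "\<exists>f'. \<forall>t. (f i has_real_derivative f' t) (at t)" for i
      using Nil[of i] by (cases rule: smooth_real.cases) blast
    then obtain f' where "\<And>i t. (f i has_real_derivative f' i t) (at t)"
      by metis
    from prod_has_derivative_coordinates[where f=f and f'=f', OF this] show ?case
      by (auto simp: iter_partial_deriv_def differentiable_on_def differentiable_def)
  next
    case (Cons k js)
    have "\<exists>f'. (\<forall>t. (f i has_real_derivative f' t) (at t)) \<and> smooth_real f'" for i
      using Cons.prems[of i] by (cases rule: smooth_real.cases) blast
    then obtain f' where f': "\<And>i t. (f i has_real_derivative f' i t) (at t)" "\<And>i. smooth_real (f' i)"
      by metis
    define g where "g = f(k := f' k)"
    have "partial_deriv k (\<lambda>x::real^'n. \<Prod>i\<in>UNIV. f i (x $ i)) = (\<lambda>x. \<Prod>i\<in>UNIV. g i (x $ i))"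
    proof
      fix x :: "real^'n"
      have "partial_deriv k (\<lambda>x::real^'n. \<Prod>i\<in>UNIV. f i (x $ i)) x
          = (\<Sum>i\<in>UNIV. (f' i (x $ i) * (axis k 1 $ i)) * (\<Prod>j\<in>UNIV - {i}. f j (x $ j)))"
        unfolding partial_deriv_def
        by (subst frechet_derivative_at[OF prod_has_derivative_coordinates[OF f'(1)], symmetric]) simp
      also have "\<dots> = (\<Sum>i\<in>UNIV. if i = k then f' i (x $ i) * (\<Prod>j\<in>UNIV - {i}. f j (x $ j)) else 0)"
        by (intro sum.cong) (auto simp: axis_def)
      also have "\<dots> = f' k (x $ k) * (\<Prod>j\<in>UNIV - {k}. f j (x $ j))"
        by simp
      also have "\<dots> = (\<Prod>i\<in>UNIV. g i (x $ i))"
        by (subst prod.remove[of UNIV k]) (auto simp: g_def intro!: prod.cong)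
      finally show "partial_deriv k (\<lambda>x::real^'n. \<Prod>i\<in>UNIV. f i (x $ i)) x = (\<Prod>i\<in>UNIV. g i (x $ i))" .
    qed
    moreover have "iter_partial_deriv js (\<lambda>x::real^'n. \<Prod>i\<in>UNIV. g i (x $ i)) differentiable_on UNIV"
      by (rule Cons.IH) (auto simp: g_def Cons.prems f'(2))
    ultimately show ?case
      by (simp add: iter_partial_deriv_def)
  qed
qed

text \<open>Its support is the closure of \<open>box a b\<close> for every \<open>k\<close>. The dilation by \<open>k + 1\<close> makes the values
tend to \<open>1\<close> inside the box, since \<open>exp (- 1 / ((k + 1) t))\<close> tends to \<open>1\<close> for \<open>t > 0\<close>.\<close>

definition box_bump :: "nat \<Rightarrow> real^'n \<Rightarrow> real^'n \<Rightarrow> real^'n::finite \<Rightarrow> real" where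
  "box_bump k a b x = (\<Prod>i\<in>UNIV. flat_exp 1 (real (Suc k) * (x $ i - a $ i)) * flat_exp 1 (real (Suc k) * (b $ i - x $ i)))"

lemma C_infinity_box_bump: "C_infinity (box_bump k a b)"
proof -
  have "smooth_real (\<lambda>t. flat_exp 1 (real (Suc k) * (t - a $ i)) * flat_exp 1 (real (Suc k) * (b $ i - t)))" for i
  proof (rule smooth_real_mult)
    show "smooth_real (\<lambda>t. flat_exp 1 (real (Suc k) * (t - a $ i)))"
      using smooth_real_affine[OF smooth_real_flat_exp, of 1 "real (Suc k)" "- (real (Suc k) * a $ i)"]
      by (simp add: algebra_simps)
    show "smooth_real (\<lambda>t. flat_exp 1 (real (Suc k) * (b $ i - t)))"
      using smooth_real_affine[OF smooth_real_flat_exp, of 1 "- real (Suc k)" "real (Suc k) * b $ i"]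
      by (simp add: algebra_simps)
  qed
  from C_infinity_prod_coordinates[OF this] show ?thesis
    unfolding box_bump_def[abs_def] .
qed

lemma flat_exp_1: "0 \<le> flat_exp 1 t" "flat_exp 1 t \<le> 1" "flat_exp 1 t \<noteq> 0 \<longleftrightarrow> t > 0"
  by (auto simp: flat_exp_def)

lemma box_bump_nonneg: "0 \<le> box_bump k a b x"
  unfolding box_bump_def by (intro prod_nonneg mult_nonneg_nonneg flat_exp_1) 

lemma box_bump_le_1: "box_bump k a b x \<le> 1"
  unfolding box_bump_def by (intro prod_le_1 conjI mult_nonneg_nonneg mult_le_one flat_exp_1)

lemma box_bump_support: "{x. box_bump k a b x \<noteq> 0} = box a b"
proof -
  have "flat_exp 1 (real (Suc k) * t) \<noteq> 0 \<longleftrightarrow> 0 < t" for t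
    by (simp add: flat_exp_1(3) zero_less_mult_iff del: of_nat_Suc)
  then have "box_bump k a b x \<noteq> 0 \<longleftrightarrow> (\<forall>i. 0 < x $ i - a $ i \<and> 0 < b $ i - x $ i)" for x
    unfolding box_bump_def by (simp only: prod_zero_iff[OF finite] mult_eq_0_iff de_Morgan_disj) simp
  then show ?thesis by (auto simp: mem_box_cart)
qed

lemma box_bump_tendsto: "(\<lambda>k. box_bump k a b x) \<longlonglongrightarrow> indicator (box a b) x"
proof (cases "x \<in> box a b")
  case True
  have L: "(\<lambda>k. flat_exp 1 (real (Suc k) * t)) \<longlonglongrightarrow> 1" if "t > 0" for t
  proof -
    have "(\<lambda>k. exp (- (1 / (real (Suc k) * t)))) \<longlonglongrightarrow> 1"
      using that by real_asymp
    then show ?thesis using that by (simp add: flat_exp_def)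
  qed
  have "(\<lambda>k. box_bump k a b x) \<longlonglongrightarrow> (\<Prod>i\<in>(UNIV::'a set). 1 * 1)"
    unfolding box_bump_def using True
    by (intro tendsto_prod tendsto_mult L) (auto simp: mem_box_cart)
  with True show ?thesis by simp
next
  case False
  then have "box_bump k a b x = 0" for k
    using box_bump_support[of k a b] by auto
  with False show ?thesis by simp
qed

lemma test_function_box_bump:
  assumes "cbox a b \<subseteq> \<Omega>"
  shows "test_function \<Omega> (box_bump k a b)"
proof -
  have sub: "closure (box a b) \<subseteq> cbox a b"
    by (intro closure_minimal box_subset_cbox closed_cbox)
  then have "closure (box a b) = cbox a b \<inter> closure (box a b)" by blast
  also have "compact \<dots>" by (intro compact_Int_closed compact_cbox closed_closure)
  finally show ?thesis
    using sub assms unfolding test_function_def box_bump_support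
    by (auto simp: C_infinity_box_bump)
qed

section \<open>The fundamental lemma of the calculus of variations\<close>

text \<open>Open boxes form a \<open>\<pi>\<close>-system which generates the Borel sets, and the sets over which \<open>F\<close> integrates to
zero form a Dynkin system.\<close>

lemma AE_zero_if_box_integrals_zero:
  fixes F :: "'a::euclidean_space \<Rightarrow> real"
  assumes F: "integrable lborel F" and total: "integral\<^sup>L lborel F = 0"
    and boxes: "\<And>c d. (LINT x:box c d|lborel. F x) = 0"
  shows "AE x in lborel. F x = 0"
proof (rule sigma_finite_measure.density_zero[OF sigma_finite_lborel F])
  fix A :: "'a set" assume "A \<in> sets lborel"
  have int: "set_integrable lborel B F" if "B \<in> sets borel" for B
    using integrable_mult_indicator[OF _ F, of B] that by (simp add: set_integrable_def)
  let ?E = "range (\<lambda>(a, b). box a b::'a set)"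
  have sig: "sigma_sets UNIV ?E = sets borel"
    by (simp add: borel_eq_box)
  have "Int_stable ?E" by (auto simp: Int_stable_def box_Int_box)
  moreover have "?E \<subseteq> Pow UNIV" by simp
  moreover have "A \<in> sigma_sets UNIV ?E"
    using \<open>A \<in> sets lborel\<close> by (simp add: sig)
  ultimately show "(LINT x:A|lborel. F x) = 0"
  proof (induction rule: sigma_sets_induct_disjoint)
    case (basic A)
    then show ?case using boxes by auto
  next
    case empty
    then show ?case by (simp add: set_lebesgue_integral_def)
  next
    case (compl A)
    then have A: "A \<in> sets borel" by (simp add: sig)
    have "(LINT x:UNIV - A|lborel. F x) = (LINT x|lborel. F x - indicator A x *\<^sub>R F x)"
      unfolding set_lebesgue_integral_def
      by (intro Bochner_Integration.integral_cong) (auto simp: indicator_def)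
    also have "\<dots> = (LINT x|lborel. F x) - (LINT x:A|lborel. F x)"
      unfolding set_lebesgue_integral_def
      by (rule Bochner_Integration.integral_diff[OF F int[OF A, unfolded set_integrable_def]])
    finally show ?case using total compl by simp
  next
    case (union A)
    then have A: "\<And>i. A i \<in> sets borel" by (auto simp: sig)
    have "(LINT x:(\<Union>i. A i)|lborel. F x) = (\<Sum>i. (LINT x:(A i)|lborel. F x))"
      using union(1) A
      by (intro lebesgue_integral_countable_add int) (auto simp: disjoint_family_on_def)
    then show ?case using union by simp
  qed
qed

lemma integrable_lebesgue_borel_representative:
  fixes f :: "'a::euclidean_space \<Rightarrow> real"
  assumes "integrable lebesgue f"
  obtains F where "integrable lborel F" "AE x in lebesgue. f x = F x"
proof -
  obtain F where F: "F \<in> borel_measurable lborel" "AE x in lborel. f x = F x"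
    using completion_ex_borel_measurable_real[OF borel_measurable_integrable[OF assms]] by blast
  have ae: "AE x in lebesgue. f x = F x" by (rule AE_completion[OF F(2)])
  have Fl: "F \<in> borel_measurable lebesgue" by (rule measurable_completion[OF F(1)])
  have "integrable lebesgue F"
    using integrable_cong_AE[OF borel_measurable_integrable[OF assms] Fl ae] assms by simp
  then have "integrable lborel F" using integrable_completion[OF F(1)] by simp
  with ae show ?thesis by (rule that[rotated])
qed

text \<open>The bump functions of a smaller box converge boundedly to its indicator function, so \<open>f\<close> integrates to zero over
every open box inside \<open>box a b\<close>.\<close>

lemma fundamental_lemma_box:
  fixes f :: "real^'n::finite \<Rightarrow> real"
  assumes "open \<Omega>" and f: "locally_integrable \<Omega> f"
    and zero: "\<And>\<phi>. test_function \<Omega> \<phi> \<Longrightarrow> (LINT x|lebesgue_on \<Omega>. f x * \<phi> x) = 0"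
    and sub: "cbox a b \<subseteq> \<Omega>"
  shows "AE x in lebesgue. x \<in> cbox a b \<longrightarrow> f x = 0"
proof -
  \<comment> \<open>Cutting off outside the open box makes the integral of \<open>G\<close> over any box one over a box inside \<open>box a b\<close>.\<close>
  define G where "G x = indicator (box a b) x * f x" for x
  have "integrable (lebesgue_on (cbox a b)) f"
    using f sub by (auto simp: locally_integrable_def)
  then have 1: "integrable lebesgue (\<lambda>x. indicator (cbox a b) x *\<^sub>R f x)"
    by (subst (asm) integrable_restrict_space) auto
  have "integrable lebesgue (\<lambda>x. indicator (box a b) x *\<^sub>R (indicator (cbox a b) x *\<^sub>R f x))"
    by (rule integrable_mult_indicator[OF _ 1]) auto
  moreover have "(\<lambda>x. indicator (box a b) x *\<^sub>R (indicator (cbox a b) x *\<^sub>R f x)) = G"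
    using box_subset_cbox[of a b] by (auto simp: G_def indicator_def fun_eq_iff)
  ultimately have G: "integrable lebesgue G" by simp
  have small: "(LINT x|lebesgue. G x * indicator (box c d) x) = 0" if cd: "box c d \<subseteq> box a b" for c d
  proof (cases "box c d = {}")
    case False
    have "cbox c d \<subseteq> cbox a b"
      using closure_mono[OF cd] closure_box False cd by (metis closure_empty subset_empty)
    then have tf: "test_function \<Omega> (box_bump k c d)" for k
      using sub by (intro test_function_box_bump) blast
    have bm: "box_bump k c d \<in> borel_measurable lebesgue" for k
      by (rule measurable_completion) (simp add: C_infinity_borel_measurable C_infinity_box_bump)
    have z: "box_bump k c d x = 0" if "x \<notin> box a b" for k x
      using box_bump_support[of k c d] cd that by auto
    have "(LINT x|lebesgue. G x * box_bump k c d x) = 0" for k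
    proof -
      have "(LINT x|lebesgue. G x * box_bump k c d x)
          = (LINT x|lebesgue. indicator \<Omega> x *\<^sub>R (f x * box_bump k c d x))"
        using sub box_subset_cbox[of a b] z
        by (intro Bochner_Integration.integral_cong) (auto simp: G_def indicator_def)
      also have "\<dots> = (LINT x|lebesgue_on \<Omega>. f x * box_bump k c d x)"
        using \<open>open \<Omega>\<close> by (subst integral_restrict_space) auto
      finally show ?thesis using zero[OF tf] by simp
    qed
    moreover have "(\<lambda>k. LINT x|lebesgue. G x * box_bump k c d x) \<longlonglongrightarrow> (LINT x|lebesgue. G x * indicator (box c d) x)"
    proof (rule integral_dominated_convergence[where w="\<lambda>x. norm (G x)"])
      show "(\<lambda>x. G x * indicator (box c d) x) \<in> borel_measurable lebesgue"
        using G by (intro borel_measurable_times borel_measurable_indicator) auto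
      show "(\<lambda>x. G x * box_bump k c d x) \<in> borel_measurable lebesgue" for k
        using G bm by (intro borel_measurable_times) auto
      show "integrable lebesgue (\<lambda>x. norm (G x))" using G by simp
      show "AE x in lebesgue. (\<lambda>k. G x * box_bump k c d x) \<longlonglongrightarrow> G x * indicator (box c d) x"
        by (intro AE_I2 tendsto_mult tendsto_const box_bump_tendsto)
      show "AE x in lebesgue. norm (G x * box_bump k c d x) \<le> norm (G x)" for k
        using box_bump_nonneg[of k c d] box_bump_le_1[of k c d]
        by (intro AE_I2) (simp add: abs_mult mult_left_le)
    qed
    ultimately show ?thesis
      by (simp add: LIMSEQ_const_iff)
  qed simp
  obtain F where F: "integrable lborel F" and ae: "AE x in lebesgue. G x = F x"
    using integrable_lebesgue_borel_representative[OF G] .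
  have Fm: "F \<in> borel_measurable borel" using F by auto
  have boxF: "(LINT x:box c d|lborel. F x) = (LINT x|lebesgue. G x * indicator (box c d) x)" for c d
  proof -
    have "(LINT x:box c d|lborel. F x) = (LINT x|lebesgue. indicator (box c d) x *\<^sub>R F x)"
      unfolding set_lebesgue_integral_def using Fm by (subst integral_completion) auto
    also have "\<dots> = (LINT x|lebesgue. G x * indicator (box c d) x)"
    proof (rule integral_cong_AE)
      show "(\<lambda>x. indicator (box c d) x *\<^sub>R F x) \<in> borel_measurable lebesgue"
        using Fm by (intro measurable_completion) measurable
      show "(\<lambda>x. G x * indicator (box c d) x) \<in> borel_measurable lebesgue"
        using G by (intro borel_measurable_times borel_measurable_indicator) auto
      show "AE x in lebesgue. indicator (box c d) x *\<^sub>R F x = G x * indicator (box c d) x"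
        using ae by eventually_elim simp
    qed
    finally show ?thesis .
  qed
  \<comment> \<open>The intersection of two boxes is a box, hence \<open>small\<close> applies to every box.\<close>
  have cut: "G x * indicator B x = G x * indicator (box a b \<inter> B) x" for x B
    by (auto simp: G_def indicator_def)
  have "AE x in lborel. F x = 0"
  proof (rule AE_zero_if_box_integrals_zero[OF F])
    show "(LINT x:box c d|lborel. F x) = 0" for c d
      unfolding boxF cut[of _ "box c d"] box_Int_box by (rule small) (auto simp: mem_box)
    have "F \<in> borel_measurable lebesgue"
      by (rule measurable_completion) (use Fm in simp)
    then have "integral\<^sup>L lebesgue G = integral\<^sup>L lebesgue F"
      using G by (intro integral_cong_AE ae) auto
    then have "integral\<^sup>L lborel F = integral\<^sup>L lebesgue G"
      using Fm by (simp add: integral_completion)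
    also have "\<dots> = (LINT x|lebesgue. G x * indicator (box a b) x)"
      by (intro Bochner_Integration.integral_cong) (auto simp: G_def indicator_def)
    finally show "integral\<^sup>L lborel F = 0" using small by simp
  qed
  then have "AE x in lebesgue. F x = 0" by (rule AE_completion)
  moreover have "AE x in lebesgue. x \<notin> cbox a b - box a b"
    using negligible_frontier_interval by (intro AE_not_in) (simp add: negligible_iff_null_sets)
  ultimately show ?thesis
    using ae by eventually_elim (auto simp: G_def indicator_def split: if_splits)
qed

lemma fundamental_lemma:
  fixes f :: "real^'n::finite \<Rightarrow> real"
  assumes "open \<Omega>" and "locally_integrable \<Omega> f"
    and "\<And>\<phi>. test_function \<Omega> \<phi> \<Longrightarrow> (LINT x|lebesgue_on \<Omega>. f x * \<phi> x) = 0"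
  shows "AE x in lebesgue. x \<in> \<Omega> \<longrightarrow> f x = 0"
proof -
  obtain \<D> where \<D>: "countable \<D>" "\<D> \<subseteq> Pow \<Omega>" "\<And>X. X \<in> \<D> \<Longrightarrow> \<exists>a b. X = cbox a b" "\<Union>\<D> = \<Omega>"
    using open_countable_Union_open_cbox[OF assms(1)] by metis
  have "AE x in lebesgue. x \<in> X \<longrightarrow> f x = 0" if X: "X \<in> \<D>" for X
  proof -
    obtain a b where "X = cbox a b" using \<D>(3)[OF X] by blast
    then show ?thesis
      using fundamental_lemma_box[OF assms, of a b] X \<D>(2) by auto
  qed
  then have "AE x in lebesgue. \<forall>X\<in>\<D>. x \<in> X \<longrightarrow> f x = 0"
    unfolding AE_ball_countable[OF \<D>(1)] by blast
  then show ?thesis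
    by eventually_elim (use \<D>(4) in blast)
qed

lemma test_function_bounded:
  assumes "test_function \<Omega> \<phi>"
  obtains B where "\<And>x. \<bar>\<phi> x\<bar> \<le> B"
proof -
  define K where "K = closure {x. \<phi> x \<noteq> 0}"
  have K: "compact K" and sm: "C_infinity \<phi>"
    using assms unfolding K_def test_function_def by blast+
  have "bounded (\<phi> ` K)"
    using compact_continuous_image[OF C_infinity_continuous_on[OF sm] K] by (rule compact_imp_bounded)
  then obtain B where B: "\<And>x. x \<in> K \<Longrightarrow> \<bar>\<phi> x\<bar> \<le> B"
    unfolding bounded_iff by auto
  have "\<phi> x = 0" if "x \<notin> K" for x
    using that closure_subset[of "{x. \<phi> x \<noteq> 0}"] unfolding K_def by force
  then have "\<bar>\<phi> x\<bar> \<le> max B 0" for x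
    using B[of x] by (cases "x \<in> K") auto
  then show ?thesis by (rule that)
qed

lemma integrable_times_test_function:
  fixes f :: "real^'n::finite \<Rightarrow> real"
  assumes "open \<Omega>" "locally_integrable \<Omega> f" and tf: "test_function \<Omega> \<phi>"
  shows "integrable (lebesgue_on \<Omega>) (\<lambda>x. f x * \<phi> x)"
proof -
  define K where "K = closure {x. \<phi> x \<noteq> 0}"
  have K: "compact K" "K \<subseteq> \<Omega>" and sm: "C_infinity \<phi>"
    using tf unfolding K_def test_function_def by blast+
  have zero: "\<phi> x = 0" if "x \<notin> K" for x
    using that closure_subset[of "{x. \<phi> x \<noteq> 0}"] unfolding K_def by force
  obtain B where B: "\<And>x. \<bar>\<phi> x\<bar> \<le> B"
    by (rule test_function_bounded[OF tf]) (rule that)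
  have Ks: "K \<in> sets lebesgue" using compact_imp_closed[OF K(1)] by auto
  have "integrable (lebesgue_on K) f"
    using assms(2) K by (simp add: locally_integrable_def)
  then have fK: "integrable lebesgue (\<lambda>x. indicator K x *\<^sub>R f x)"
    using Ks by (subst (asm) integrable_restrict_space) auto
  have "integrable lebesgue (\<lambda>x. (indicator K x *\<^sub>R f x) * \<phi> x)"
  proof (rule Bochner_Integration.integrable_bound)
    show "integrable lebesgue (\<lambda>x. B * norm (indicator K x *\<^sub>R f x))"
      using fK by (intro integrable_mult_right integrable_norm)
    have "\<phi> \<in> borel_measurable lebesgue"
      by (rule measurable_completion) (simp add: C_infinity_borel_measurable sm)
    then show "(\<lambda>x. (indicator K x *\<^sub>R f x) * \<phi> x) \<in> borel_measurable lebesgue"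
      using fK by (intro borel_measurable_times) auto
    have "norm ((indicator K x *\<^sub>R f x) * \<phi> x) \<le> norm (B * norm (indicator K x *\<^sub>R f x))" for x
    proof -
      have "norm ((indicator K x *\<^sub>R f x) * \<phi> x) \<le> norm (indicator K x *\<^sub>R f x) * B"
        unfolding norm_mult by (rule mult_left_mono) (use B in auto)
      also have "\<dots> \<le> norm (B * norm (indicator K x *\<^sub>R f x))"
        by (simp add: abs_mult mult.commute mult_right_mono)
      finally show ?thesis .
    qed
    then show "AE x in lebesgue. norm ((indicator K x *\<^sub>R f x) * \<phi> x) \<le> norm (B * norm (indicator K x *\<^sub>R f x))"
      by blast
  qed
  moreover have "(\<lambda>x. (indicator K x *\<^sub>R f x) * \<phi> x) = (\<lambda>x. indicator \<Omega> x *\<^sub>R (f x * \<phi> x))"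
    using K(2) zero by (auto simp: indicator_def fun_eq_iff)
  ultimately show ?thesis
    using assms(1) by (subst integrable_restrict_space) auto
qed

lemma locally_integrable_diff:
  "locally_integrable \<Omega> f \<Longrightarrow> locally_integrable \<Omega> g \<Longrightarrow> locally_integrable \<Omega> (\<lambda>x. f x - g x)"
  unfolding locally_integrable_def by (blast intro: Bochner_Integration.integrable_diff)

lemma weak_deriv_unique:
  fixes v :: "real^'n::finite \<Rightarrow> real"
  assumes "open \<Omega>" and g: "has_weak_deriv \<Omega> \<alpha> v g" and h: "has_weak_deriv \<Omega> \<alpha> v h"
  shows "AE x in lebesgue. x \<in> \<Omega> \<longrightarrow> g x = h x"
proof -
  have loc: "locally_integrable \<Omega> g" "locally_integrable \<Omega> h"
    using g h by (auto simp: has_weak_deriv_def)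
  have "AE x in lebesgue. x \<in> \<Omega> \<longrightarrow> g x - h x = 0"
  proof (rule fundamental_lemma[OF assms(1) locally_integrable_diff[OF loc]])
    fix \<phi> assume tf: "test_function \<Omega> \<phi>"
    have "(LINT x|lebesgue_on \<Omega>. v x * mi_deriv \<alpha> \<phi> x) = (-1) ^ mi_order \<alpha> * (LINT x|lebesgue_on \<Omega>. g x * \<phi> x)"
      using g tf unfolding has_weak_deriv_def by blast
    moreover have "(LINT x|lebesgue_on \<Omega>. v x * mi_deriv \<alpha> \<phi> x) = (-1) ^ mi_order \<alpha> * (LINT x|lebesgue_on \<Omega>. h x * \<phi> x)"
      using h tf unfolding has_weak_deriv_def by blast
    ultimately have "(-1) ^ mi_order \<alpha> * (LINT x|lebesgue_on \<Omega>. g x * \<phi> x)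
        = (-1) ^ mi_order \<alpha> * (LINT x|lebesgue_on \<Omega>. h x * \<phi> x)"
      by simp
    then have "(LINT x|lebesgue_on \<Omega>. g x * \<phi> x) = (LINT x|lebesgue_on \<Omega>. h x * \<phi> x)"
      by simp
    moreover have "(LINT x|lebesgue_on \<Omega>. (g x - h x) * \<phi> x)
        = (LINT x|lebesgue_on \<Omega>. g x * \<phi> x) - (LINT x|lebesgue_on \<Omega>. h x * \<phi> x)"
      unfolding left_diff_distrib
      by (intro Bochner_Integration.integral_diff integrable_times_test_function assms loc tf)
    ultimately show "(LINT x|lebesgue_on \<Omega>. (g x - h x) * \<phi> x) = 0" by simp
  qed
  then show ?thesis by simp
qed

lemma has_weak_deriv_weak_deriv:
  assumes "has_weak_deriv \<Omega> \<alpha> v g"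
  shows "has_weak_deriv \<Omega> \<alpha> v (weak_deriv \<Omega> \<alpha> v)"
  unfolding weak_deriv_def by (rule someI[of "\<lambda>g. has_weak_deriv \<Omega> \<alpha> v g", OF assms])

lemma mi_order_add_unit: "mi_order (\<lambda>j. \<alpha> j + mi_unit i j) = mi_order \<alpha> + 1" for \<alpha> :: "'n::finite \<Rightarrow> nat"
  by (simp add: mi_order_def mi_unit_def sum.distrib)

lemma mi_order_unit: "mi_order (mi_unit i :: 'n::finite \<Rightarrow> nat) = 1"
  by (simp add: mi_order_def mi_unit_def)

text \<open>Test \<open>u\<close> with \<open>\<partial>\<^sub>i \<phi>\<close>, which is again a test function, and move all derivatives to \<open>v\<close>. The sign
\<open>(-1) ^ |\<alpha>|\<close> occurs on both sides.\<close>

lemma has_weak_deriv_iterated: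
  fixes v :: "real^'n::finite \<Rightarrow> real"
  assumes u: "has_weak_deriv \<Omega> \<alpha> v u" and w: "has_weak_deriv \<Omega> (\<lambda>j. \<alpha> j + mi_unit i j) v w"
  shows "has_weak_deriv \<Omega> (mi_unit i) u w"
  unfolding has_weak_deriv_def
proof (intro conjI allI impI)
  show "locally_integrable \<Omega> u" "locally_integrable \<Omega> w"
    using u w by (auto simp: has_weak_deriv_def)
  fix \<phi> assume tf: "test_function \<Omega> \<phi>"
  then have sm: "C_infinity \<phi>" by (simp add: test_function_def)
  let ?s = "(-1::real) ^ mi_order \<alpha>"
  have "(LINT x|lebesgue_on \<Omega>. v x * mi_deriv \<alpha> (partial_deriv i \<phi>) x)
      = ?s * (LINT x|lebesgue_on \<Omega>. u x * partial_deriv i \<phi> x)"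
    using u test_function_partial_deriv[OF tf] unfolding has_weak_deriv_def by blast
  moreover have "(LINT x|lebesgue_on \<Omega>. v x * mi_deriv (\<lambda>j. \<alpha> j + mi_unit i j) \<phi> x)
      = - ?s * (LINT x|lebesgue_on \<Omega>. w x * \<phi> x)"
    using w tf unfolding has_weak_deriv_def mi_order_add_unit by simp
  ultimately have "?s * (LINT x|lebesgue_on \<Omega>. u x * partial_deriv i \<phi> x) = ?s * - (LINT x|lebesgue_on \<Omega>. w x * \<phi> x)"
    unfolding mi_deriv_partial_deriv[OF sm] by simp
  then have "(LINT x|lebesgue_on \<Omega>. u x * partial_deriv i \<phi> x) = - (LINT x|lebesgue_on \<Omega>. w x * \<phi> x)"
    by (subst (asm) mult_left_cancel) simp_all
  then show "(LINT x|lebesgue_on \<Omega>. u x * mi_deriv (mi_unit i) \<phi> x) = (-1) ^ mi_order (mi_unit i) * (LINT x|lebesgue_on \<Omega>. w x * \<phi> x)"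
    by (simp add: mi_deriv_unit[OF sm] mi_order_unit)
qed

lemma C_infinity_shift_deriv:
  assumes "C_infinity \<phi>"
  shows "partial_deriv i (\<lambda>x. \<phi> (x + a)) = (\<lambda>x. partial_deriv i \<phi> (x + a))"
    and "(\<lambda>x. \<phi> (x + a)) differentiable (at y)"
proof -
  have D: "((\<lambda>x. \<phi> (x + a)) has_derivative frechet_derivative \<phi> (at (x + a))) (at x)" for x
  proof -
    have "(\<phi> has_derivative frechet_derivative \<phi> (at (x + a))) (at (x + a))"
      using C_infinity_differentiable[OF assms] frechet_derivative_works by blast
    moreover have "((\<lambda>x. x + a) has_derivative (\<lambda>h. h)) (at x)"
      by (auto intro!: derivative_eq_intros)
    ultimately show ?thesis
      using has_derivative_compose[of "\<lambda>x. x + a" "\<lambda>h. h" x UNIV \<phi>] by simp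
  qed
  show "partial_deriv i (\<lambda>x. \<phi> (x + a)) = (\<lambda>x. partial_deriv i \<phi> (x + a))"
    unfolding partial_deriv_def using frechet_derivative_at[OF D] by simp
  show "(\<lambda>x. \<phi> (x + a)) differentiable (at y)"
    using D unfolding differentiable_def by blast
qed

lemma C_infinity_shift:
  assumes "C_infinity \<phi>"
  shows "C_infinity (\<lambda>x. \<phi> (x + a))"
  unfolding C_infinity_def
proof
  fix js
  show "iter_partial_deriv js (\<lambda>x. \<phi> (x + a)) differentiable_on UNIV"
    using assms
  proof (induction js arbitrary: \<phi>)
    case Nil
    show ?case
      using C_infinity_shift_deriv(2)[OF Nil] by (simp add: iter_partial_deriv_def differentiable_on_def)
  next
    case (Cons k js)
    from Cons.IH[OF C_infinity_partial_deriv[OF Cons.prems, of k]] show ?case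
      by (simp add: iter_partial_deriv_def C_infinity_shift_deriv(1)[OF Cons.prems])
  qed
qed

text \<open>Translates of test functions are needed for domains other than \<open>\<Omega>\<close>: the segments that start in the shifted support
must stay in the original domain.\<close>

lemma test_function_shift:
  assumes tf: "test_function \<Omega> \<phi>" and sub: "\<And>x. x + a \<in> closure {x. \<phi> x \<noteq> 0} \<Longrightarrow> x \<in> \<Omega>'"
  shows "test_function \<Omega>' (\<lambda>x. \<phi> (x + a))"
proof -
  define S where "S = {x. \<phi> x \<noteq> 0}"
  have tf': "C_infinity \<phi>" "compact (closure S)"
    using tf unfolding test_function_def S_def by blast+
  have "{x. \<phi> (x + a) \<noteq> 0} = (\<lambda>x. - a + x) ` S"
  proof (intro set_eqI iffI)
    fix x assume "x \<in> {x. \<phi> (x + a) \<noteq> 0}"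
    then show "x \<in> (\<lambda>x. - a + x) ` S"
      by (intro image_eqI[of _ _ "x + a"]) (auto simp: S_def)
  qed (auto simp: S_def)
  then have cl: "closure {x. \<phi> (x + a) \<noteq> 0} = (\<lambda>x. - a + x) ` closure S"
    by (simp only: closure_translation)
  have "compact ((\<lambda>x. - a + x) ` closure S)"
    by (rule compact_translation[OF tf'(2)])
  moreover have "(\<lambda>x. - a + x) ` closure S \<subseteq> \<Omega>'"
    using sub unfolding S_def by (auto simp: image_iff)
  ultimately show ?thesis
    unfolding test_function_def cl using C_infinity_shift[OF tf'(1)] by blast
qed

section \<open>Averages over a segment\<close>

text \<open>The convexity of \<open>x powr p\<close> on the open half-line is extended to zero by \<open>r powr p \<le> r\<close> for \<open>0 \<le> r \<le> 1\<close>, and to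
the whole line by the triangle inequality.\<close>

lemma abs_powr_convex:
  fixes x y :: real
  assumes "1 \<le> p" "0 \<le> s" "0 \<le> t" "s + t = 1"
  shows "\<bar>s * x + t * y\<bar> powr p \<le> s * \<bar>x\<bar> powr p + t * \<bar>y\<bar> powr p"
proof -
  have small: "(r * z) powr p \<le> r * z powr p" if "0 \<le> r" "r \<le> 1" "0 \<le> z" for r z :: real
  proof -
    have "r powr p \<le> r"
    proof (cases "r = 0")
      case False
      then show ?thesis using powr_mono'[of 1 p r] that assms(1) by simp
    qed simp
    then show ?thesis using that by (simp add: powr_mult mult_right_mono)
  qed
  have key: "(s * a + t * b) powr p \<le> s * a powr p + t * b powr p" if ab: "0 \<le> a" "0 \<le> b" for a b
  proof -
    consider "a = 0" | "b = 0" | "0 < a" "0 < b" using ab by linarith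
    then show ?thesis
    proof cases
      case 1
      then show ?thesis using small[of t b] ab assms by simp
    next
      case 2
      then show ?thesis using small[of s a] ab assms by simp
    next
      case 3
      have "s = 1 - t" "t \<le> 1" using assms by auto
      with 3 show ?thesis
        using convex_onD[OF powr_convex[OF assms(1)], of t a b] assms(3) by simp
    qed
  qed
  have "\<bar>s * x + t * y\<bar> \<le> s * \<bar>x\<bar> + t * \<bar>y\<bar>"
    using assms abs_triangle_ineq[of "s * x" "t * y"] by (simp add: abs_mult)
  then have "\<bar>s * x + t * y\<bar> powr p \<le> (s * \<bar>x\<bar> + t * \<bar>y\<bar>) powr p"
    using assms by (intro powr_mono2) auto
  also have "\<dots> \<le> s * \<bar>x\<bar> powr p + t * \<bar>y\<bar> powr p"
    by (rule key) auto
  finally show ?thesis .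
qed

text \<open>The uniform distribution on the unit interval, as a measure on all Borel sets of the line. In this form functions
on the product with \<open>lborel\<close> are measurable for the usual product of Borel \<open>\<sigma>\<close>-algebras.\<close>

definition unit_interval_measure :: "real measure" where
  "unit_interval_measure = density lborel (\<lambda>t. ennreal (indicator {0..1} t))"

lemma sets_unit_interval_measure [simp, measurable_cong]: "sets unit_interval_measure = sets borel"
  by (simp add: unit_interval_measure_def)

lemma space_unit_interval_measure [simp]: "space unit_interval_measure = UNIV"
  by (simp add: unit_interval_measure_def)

lemma prob_space_unit_interval: "prob_space unit_interval_measure"
  by (rule prob_spaceI) (simp add: unit_interval_measure_def emeasure_density ennreal_indicator)

interpretation unit_interval: prob_space unit_interval_measure
  by (rule prob_space_unit_interval)

interpretation lborel_unit: pair_sigma_finite "lborel :: ('a::euclidean_space) measure" unit_interval_measure ..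

lemma AE_unit_interval: "AE t in unit_interval_measure. 0 \<le> t \<and> t \<le> 1"
  unfolding unit_interval_measure_def by (subst AE_density) (auto simp: indicator_def)

lemma unit_interval_FTC:
  assumes "\<And>t. (f has_real_derivative f' t) (at t)" "continuous_on UNIV f'"
  shows "(LINT t|unit_interval_measure. f' t) = f 1 - f 0"
proof -
  have "f' \<in> borel_measurable borel"
    using assms(2) by (rule borel_measurable_continuous_onI)
  then have "(LINT t|unit_interval_measure. f' t) = (LINT t|lborel. indicator {0..1} t *\<^sub>R f' t)"
    unfolding unit_interval_measure_def by (subst integral_density) auto
  also have "\<dots> = f 1 - f 0"
    using integral_FTC_Icc_real[of 0 1 f f'] assms
    by (auto simp: mult.commute continuous_on_eq_continuous_at)
  finally show ?thesis .
qed

lemma unit_interval_Jensen: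
  assumes "1 \<le> p" and f: "integrable unit_interval_measure f"
  shows "ennreal (\<bar>LINT t|unit_interval_measure. f t\<bar> powr p) \<le> (\<integral>\<^sup>+t. ennreal (\<bar>f t\<bar> powr p) \<partial>unit_interval_measure)"
proof (cases "(\<integral>\<^sup>+t. ennreal (\<bar>f t\<bar> powr p) \<partial>unit_interval_measure) = \<infinity>")
  case False
  have m: "(\<lambda>t. \<bar>f t\<bar> powr p) \<in> borel_measurable unit_interval_measure"
    using borel_measurable_integrable[OF f] by measurable
  have fp: "integrable unit_interval_measure (\<lambda>t. \<bar>f t\<bar> powr p)"
    using False m by (intro integrableI_nonneg) (auto simp: top.not_eq_extremum)
  have "convex_on UNIV (\<lambda>x::real. \<bar>x\<bar> powr p)"
  proof (rule convex_onI)
    fix t x y :: real assume "0 < t" "t < 1"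
    then show "\<bar>(1 - t) *\<^sub>R x + t *\<^sub>R y\<bar> powr p \<le> (1 - t) * \<bar>x\<bar> powr p + t * \<bar>y\<bar> powr p"
      using abs_powr_convex[OF assms(1), of "1 - t" t x y] by simp
  qed simp
  then have "\<bar>LINT t|unit_interval_measure. f t\<bar> powr p \<le> (LINT t|unit_interval_measure. \<bar>f t\<bar> powr p)"
    by (intro unit_interval.jensens_inequality[where I=UNIV] f fp) auto
  then show ?thesis
    using fp by (subst nn_integral_eq_integral) (auto intro: ennreal_leI)
qed simp

lemma nn_integral_lborel_shift:
  fixes c :: "'a::euclidean_space"
  assumes "f \<in> borel_measurable borel"
  shows "(\<integral>\<^sup>+x. f (x + c) \<partial>lborel) = (\<integral>\<^sup>+x. f x \<partial>lborel)"
  using assms by (subst lborel_distr_plus[of c, symmetric], subst nn_integral_distr) (auto simp: add.commute)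

lemma integral_lborel_shift:
  fixes c :: "'a::euclidean_space" and f :: "'a \<Rightarrow> real"
  assumes "f \<in> borel_measurable borel"
  shows "(LINT x|lborel. f (x + c)) = (LINT x|lborel. f x)"
  using assms by (subst lborel_distr_plus[of c, symmetric], subst integral_distr) (auto simp: add.commute)

lemma integrable_lborel_shift:
  fixes c :: "'a::euclidean_space" and f :: "'a \<Rightarrow> 'b::{banach, second_countable_topology}"
  assumes "integrable lborel f"
  shows "integrable lborel (\<lambda>x. f (x + c))"
proof -
  have "integrable (distr lborel borel ((+) c)) f"
    using assms by (subst lborel_distr_plus)
  then have "integrable lborel (\<lambda>x. f (c + x))"
    by (subst (asm) integrable_distr_eq) (use assms in auto)
  then show ?thesis by (simp add: add.commute)
qed

text \<open>The form of the fundamental lemma used below, for Borel functions on the whole space.\<close>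

lemma fundamental_lemma_lborel:
  fixes f :: "real^'n::finite \<Rightarrow> real"
  assumes "open \<Omega>" and f: "integrable lborel f"
    and zero: "\<And>\<phi>. test_function \<Omega> \<phi> \<Longrightarrow> (LINT x|lborel. f x * \<phi> x) = 0"
  shows "AE x in lborel. x \<in> \<Omega> \<longrightarrow> f x = 0"
proof -
  have fm: "f \<in> borel_measurable borel" using f by auto
  have fl: "integrable lebesgue f" using f fm by (subst integrable_completion) auto
  have loc: "locally_integrable \<Omega> f"
    unfolding locally_integrable_def
  proof (intro allI impI)
    fix C assume "compact C \<and> C \<subseteq> \<Omega>"
    then have "C \<in> sets lebesgue" using compact_imp_closed[of C] by auto
    then show "integrable (lebesgue_on C) f"
      using integrable_mult_indicator[OF _ fl, of C] by (subst integrable_restrict_space) auto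
  qed
  have "AE x in lebesgue. x \<in> \<Omega> \<longrightarrow> f x = 0"
  proof (rule fundamental_lemma[OF assms(1) loc])
    fix \<phi> assume tf: "test_function \<Omega> \<phi>"
    then have sm: "C_infinity \<phi>" and sub: "closure {x. \<phi> x \<noteq> 0} \<subseteq> \<Omega>" by (auto simp: test_function_def)
    then have "\<phi> x = 0" if "x \<notin> \<Omega>" for x
      using that closure_subset[of "{x. \<phi> x \<noteq> 0}"] by blast
    then have "(LINT x|lebesgue_on \<Omega>. f x * \<phi> x) = (LINT x|lebesgue. f x * \<phi> x)"
      using assms(1) by (subst integral_restrict_space) (auto intro!: Bochner_Integration.integral_cong simp: indicator_def)
    also have "\<dots> = (LINT x|lborel. f x * \<phi> x)"
      using fm C_infinity_borel_measurable[OF sm] by (intro integral_completion) auto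
    finally show "(LINT x|lebesgue_on \<Omega>. f x * \<phi> x) = 0" using zero[OF tf] by simp
  qed
  then show ?thesis by (simp add: AE_completion_iff)
qed

definition directional_deriv :: "real^'n \<Rightarrow> (real^'n::finite \<Rightarrow> real) \<Rightarrow> real^'n \<Rightarrow> real" where
  "directional_deriv k \<phi> x = (\<Sum>i\<in>UNIV. k $ i * partial_deriv i \<phi> x)"

lemma directional_deriv_line:
  assumes "C_infinity \<phi>"
  shows "((\<lambda>t. \<phi> (x + t *\<^sub>R k)) has_real_derivative directional_deriv k \<phi> (x + t *\<^sub>R k)) (at t)"
proof -
  let ?x = "x + t *\<^sub>R k" and ?D = "frechet_derivative \<phi> (at (x + t *\<^sub>R k))"
  have D: "(\<phi> has_derivative ?D) (at ?x)"
    using C_infinity_differentiable[OF assms] frechet_derivative_works by blast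
  then have lin: "linear ?D" by (rule has_derivative_linear)
  have "((\<lambda>t. x + t *\<^sub>R k) has_derivative (\<lambda>s. s *\<^sub>R k)) (at t)"
    by (auto intro!: derivative_eq_intros)
  from has_derivative_compose[OF this] D
  have "((\<lambda>t. \<phi> (x + t *\<^sub>R k)) has_derivative (\<lambda>s. ?D (s *\<^sub>R k))) (at t)"
    by blast
  moreover have "?D (s *\<^sub>R k) = s * directional_deriv k \<phi> ?x" for s
  proof -
    have "?D k = ?D (\<Sum>i\<in>UNIV. k $ i *\<^sub>R axis i 1)"
      using basis_expansion[of k] by (simp add: scalar_mult_eq_scaleR)
    also have "\<dots> = directional_deriv k \<phi> ?x"
      by (simp add: linear_sum[OF lin] linear_cmul[OF lin] directional_deriv_def partial_deriv_def)
    finally show ?thesis by (simp add: linear_cmul[OF lin])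
  qed
  ultimately show ?thesis
    by (simp add: has_field_derivative_def mult_commute_abs)
qed

lemma continuous_directional_deriv:
  assumes "C_infinity \<phi>"
  shows "continuous_on S (directional_deriv k \<phi>)"
  unfolding directional_deriv_def
  by (intro continuous_intros C_infinity_continuous_on C_infinity_partial_deriv assms)

text \<open>This is the identity for increments when the function is smooth; its dual form gives the one for Sobolev
functions.\<close>

lemma directional_deriv_FTC:
  assumes "C_infinity \<phi>"
  shows "(LINT t|unit_interval_measure. directional_deriv k \<phi> (x + t *\<^sub>R k)) = \<phi> (x + k) - \<phi> x"
proof -
  have "continuous_on UNIV (\<lambda>t. directional_deriv k \<phi> (x + t *\<^sub>R k))"
    by (rule continuous_on_compose2[OF continuous_directional_deriv[OF assms, of UNIV]])
      (auto intro!: continuous_intros)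
  from unit_interval_FTC[OF directional_deriv_line[OF assms] this] show ?thesis
    by simp
qed

lemma open_segment_inside:
  fixes \<Omega> :: "'a::euclidean_space set"
  assumes "open \<Omega>"
  shows "open {x. \<forall>t\<in>{0..1}. x + t *\<^sub>R h \<in> \<Omega>}"
  unfolding open_contains_ball
proof
  fix x assume x: "x \<in> {x. \<forall>t\<in>{0..1}. x + t *\<^sub>R h \<in> \<Omega>}"
  let ?K = "(\<lambda>t. x + t *\<^sub>R h) ` {0..1}"
  have "compact ?K" by (intro compact_continuous_image continuous_intros compact_Icc)
  moreover have "?K \<subseteq> \<Omega>" using x by auto
  ultimately obtain e where e: "e > 0" "(\<Union>y\<in>?K. ball y e) \<subseteq> \<Omega>"
    using compact_subset_open_imp_ball_epsilon_subset[OF _ assms] by metis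
  have "y + t *\<^sub>R h \<in> \<Omega>" if "y \<in> ball x e" "t \<in> {0..1}" for y t
  proof -
    have "y + t *\<^sub>R h \<in> ball (x + t *\<^sub>R h) e"
      using that by (simp add: dist_norm)
    then show ?thesis using e(2) that(2) by blast
  qed
  with e(1) show "\<exists>e>0. ball x e \<subseteq> {x. \<forall>t\<in>{0..1}. x + t *\<^sub>R h \<in> \<Omega>}"
    by blast
qed

section \<open>Increments of Sobolev functions along segments\<close>

lemma integrable_pair_unit_bound:
  fixes F :: "'a::euclidean_space \<times> real \<Rightarrow> real"
  assumes [measurable]: "F \<in> borel_measurable (lborel \<Otimes>\<^sub>M unit_interval_measure)"
    and w: "integrable lborel w" and bound: "\<And>x t. \<bar>F (x, t)\<bar> \<le> w x"
  shows "integrable (lborel \<Otimes>\<^sub>M unit_interval_measure) F"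
proof (rule integrableI_bounded)
  have [measurable]: "w \<in> borel_measurable borel" using w by auto
  have "(\<integral>\<^sup>+z. ennreal (norm (F z)) \<partial>(lborel \<Otimes>\<^sub>M unit_interval_measure))
      = (\<integral>\<^sup>+x. \<integral>\<^sup>+t. ennreal (norm (F (x, t))) \<partial>unit_interval_measure \<partial>lborel)"
    by (rule unit_interval.nn_integral_fst[symmetric]) measurable
  also have "\<dots> \<le> (\<integral>\<^sup>+x. \<integral>\<^sup>+t. ennreal (w x) \<partial>unit_interval_measure \<partial>(lborel::'a measure))"
    using bound by (intro nn_integral_mono ennreal_leI) auto
  also have "\<dots> = (\<integral>\<^sup>+x. ennreal (w x) \<partial>lborel)"
    using unit_interval.emeasure_space_1 by simp
  also have "\<dots> \<le> (\<integral>\<^sup>+x. ennreal (norm (w x)) \<partial>lborel)"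
    by (intro nn_integral_mono ennreal_leI) auto
  also have "\<dots> < \<infinity>"
    using w by (simp add: integrable_iff_bounded)
  finally show "(\<integral>\<^sup>+z. ennreal (norm (F z)) \<partial>(lborel \<Otimes>\<^sub>M unit_interval_measure)) < \<infinity>" .
qed simp

lemma le_one_plus_powr:
  fixes y :: real
  assumes "1 \<le> p" "0 \<le> y"
  shows "y \<le> 1 + y powr p"
proof (cases "y \<le> 1")
  case False
  then have "y powr 1 \<le> y powr p" using assms by (intro powr_mono) auto
  then show ?thesis using assms False by simp
qed (use powr_ge_zero[of y p] in linarith)

text \<open>On a bounded set \<open>L\<^sup>p\<close> is contained in \<open>L\<^sup>1\<close>, by \<open>y \<le> 1 + y powr p\<close>.\<close>

lemma integrable_if_powr_integrable:
  fixes f :: "'a::euclidean_space \<Rightarrow> 'b::{banach, second_countable_topology}"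
  assumes "f \<in> borel_measurable borel" "open \<Omega>" "bounded \<Omega>" "1 \<le> p"
    and zero: "\<And>x. x \<notin> \<Omega> \<Longrightarrow> f x = 0" and fp: "integrable lborel (\<lambda>x. norm (f x) powr p)"
  shows "integrable lborel f"
proof (rule Bochner_Integration.integrable_bound)
  have "emeasure lborel \<Omega> < \<infinity>"
    using emeasure_bounded_finite[OF assms(3)] by simp
  then have "integrable lborel (indicat_real \<Omega>)"
    using assms(2) by (intro integrable_real_indicator) auto
  then show "integrable lborel (\<lambda>x. indicat_real \<Omega> x + norm (f x) powr p)"
    using fp by (rule Bochner_Integration.integrable_add)
  show "f \<in> borel_measurable lborel" using assms(1) by simp
  have "norm (f x) \<le> norm (indicat_real \<Omega> x + norm (f x) powr p)" for x
    using le_one_plus_powr[OF assms(4) norm_ge_zero, of "f x"] zero[of x] powr_ge_zero[of "norm (f x)" p]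
    by (cases "x \<in> \<Omega>") auto
  then show "AE x in lborel. norm (f x) \<le> norm (indicat_real \<Omega> x + norm (f x) powr p)"
    by blast
qed

text \<open>A function \<open>u\<close> in \<open>W\<^sup>1\<^sup>,\<^sup>p(\<Omega>)\<close> with weak gradient \<open>g\<close>, both represented by Borel functions on the whole
  space that vanish outside \<open>\<Omega>\<close>. All integrals can then be taken with respect to \<open>lborel\<close>, and Tonelli's theorem
  applies directly.\<close>

locale sobolev_W1 =
  fixes \<Omega> :: "(real^'n::finite) set" and u :: "real^'n \<Rightarrow> real" and g :: "real^'n \<Rightarrow> real^'n" and p :: real
  assumes open_dom: "open \<Omega>" and bounded_dom: "bounded \<Omega>" and p_ge_1: "1 \<le> p"
    and u_borel [measurable]: "u \<in> borel_measurable borel"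
    and g_borel [measurable]: "g \<in> borel_measurable borel"
    and u_outside: "\<And>x. x \<notin> \<Omega> \<Longrightarrow> u x = 0" and g_outside: "\<And>x. x \<notin> \<Omega> \<Longrightarrow> g x = 0"
    and u_Lp: "integrable lborel (\<lambda>x. \<bar>u x\<bar> powr p)"
    and g_Lp: "integrable lborel (\<lambda>x. norm (g x) powr p)"
    and weak_gradient: "\<And>\<phi> i. test_function \<Omega> \<phi> \<Longrightarrow>
          (LINT x|lborel. u x * partial_deriv i \<phi> x) = - (LINT x|lborel. g x $ i * \<phi> x)"
begin

lemma u_L1: "integrable lborel u"
  by (rule integrable_if_powr_integrable[OF u_borel open_dom bounded_dom p_ge_1 u_outside])
    (use u_Lp in simp_all)

lemma g_L1: "integrable lborel g"
  by (rule integrable_if_powr_integrable[OF g_borel open_dom bounded_dom p_ge_1 g_outside g_Lp])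

lemma integrable_times_bounded:
  fixes f \<phi> :: "real^'n \<Rightarrow> real"
  assumes f: "integrable lborel f" and "\<phi> \<in> borel_measurable borel" "\<And>x. \<bar>\<phi> x\<bar> \<le> B"
  shows "integrable lborel (\<lambda>x. f x * \<phi> x)"
proof (rule Bochner_Integration.integrable_bound)
  show "integrable lborel (\<lambda>x. B * norm (f x))"
    using f by (intro integrable_mult_right integrable_norm)
  show "(\<lambda>x. f x * \<phi> x) \<in> borel_measurable lborel"
    using f assms(2) by (intro borel_measurable_times) auto
  have "norm (f x * \<phi> x) \<le> norm (B * norm (f x))" for x
  proof -
    have "norm (f x * \<phi> x) \<le> norm (f x) * B"
      unfolding norm_mult by (rule mult_left_mono) (use assms(3) in auto)
    also have "\<dots> \<le> norm (B * norm (f x))"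
      by (simp add: abs_mult mult.commute mult_right_mono)
    finally show ?thesis .
  qed
  then show "AE x in lborel. norm (f x * \<phi> x) \<le> norm (B * norm (f x))" by blast
qed

lemma g_inner_L1: "integrable lborel (\<lambda>x. g x \<bullet> h)"
  by (rule integrable_inner_left[OF g_L1])

lemma segment_integrable:
  "integrable (lborel \<Otimes>\<^sub>M unit_interval_measure) (\<lambda>(x, t). g (x + t *\<^sub>R h) \<bullet> h)"
proof (rule integrableI_bounded)
  have m [measurable]: "(\<lambda>(x, t). g (x + t *\<^sub>R h) \<bullet> h) \<in> borel_measurable (lborel \<Otimes>\<^sub>M unit_interval_measure)"
    by measurable
  then show "(\<lambda>(x, t). g (x + t *\<^sub>R h) \<bullet> h) \<in> borel_measurable (lborel \<Otimes>\<^sub>M unit_interval_measure)" .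
  have "(\<integral>\<^sup>+z. ennreal (norm (case z of (x, t) \<Rightarrow> g (x + t *\<^sub>R h) \<bullet> h)) \<partial>(lborel \<Otimes>\<^sub>M unit_interval_measure))
      = (\<integral>\<^sup>+t. \<integral>\<^sup>+x. ennreal (norm (g (x + t *\<^sub>R h) \<bullet> h)) \<partial>lborel \<partial>unit_interval_measure)"
    by (subst lborel_unit.nn_integral_snd[symmetric]) auto
  also have "\<dots> = (\<integral>\<^sup>+t. \<integral>\<^sup>+x. ennreal (norm (g x \<bullet> h)) \<partial>lborel \<partial>unit_interval_measure)"
    by (intro nn_integral_cong nn_integral_lborel_shift[where f="\<lambda>x. ennreal (norm (g x \<bullet> h))"]) measurable
  also have "\<dots> = (\<integral>\<^sup>+x. ennreal (norm (g x \<bullet> h)) \<partial>lborel)"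
    using unit_interval.emeasure_space_1 by simp
  also have "\<dots> < \<infinity>"
    using g_inner_L1[of h] by (simp add: integrable_iff_bounded)
  finally show "(\<integral>\<^sup>+z. ennreal (norm (case z of (x, t) \<Rightarrow> g (x + t *\<^sub>R h) \<bullet> h)) \<partial>(lborel \<Otimes>\<^sub>M unit_interval_measure)) < \<infinity>" .
qed

lemma weak_directional:
  assumes "test_function \<Omega> \<phi>"
  shows "(LINT x|lborel. u x * directional_deriv (- h) \<phi> x) = (LINT x|lborel. (g x \<bullet> h) * \<phi> x)"
proof -
  have sm: "C_infinity \<phi>" using assms by (simp add: test_function_def)
  have int1: "integrable lborel (\<lambda>x. u x * partial_deriv i \<phi> x)" for i
  proof -
    obtain B where "\<And>x. \<bar>partial_deriv i \<phi> x\<bar> \<le> B"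
      by (rule test_function_bounded[OF test_function_partial_deriv[OF assms, of i]]) (rule that)
    then show ?thesis
      by (intro integrable_times_bounded u_L1 C_infinity_borel_measurable C_infinity_partial_deriv sm)
  qed
  obtain B where B: "\<And>x. \<bar>\<phi> x\<bar> \<le> B"
    by (rule test_function_bounded[OF assms]) (rule that)
  have int2: "integrable lborel (\<lambda>x. g x $ i * \<phi> x)" for i
  proof (rule integrable_times_bounded[OF _ C_infinity_borel_measurable[OF sm] B])
    show "integrable lborel (\<lambda>x. g x $ i)"
      using g_inner_L1[of "axis i 1"] by (simp add: inner_axis)
  qed
  have "(LINT x|lborel. u x * directional_deriv (- h) \<phi> x)
      = (LINT x|lborel. (\<Sum>i\<in>UNIV. - (h $ i) * (u x * partial_deriv i \<phi> x)))"
    by (simp add: directional_deriv_def sum_distrib_left sum_negf mult.left_commute)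
  also have "\<dots> = (\<Sum>i\<in>UNIV. - (h $ i) * (LINT x|lborel. u x * partial_deriv i \<phi> x))"
    by (subst Bochner_Integration.integral_sum) (auto intro!: integrable_mult_right int1)
  also have "\<dots> = (\<Sum>i\<in>UNIV. h $ i * (LINT x|lborel. g x $ i * \<phi> x))"
    by (simp add: weak_gradient[OF assms])
  also have "\<dots> = (LINT x|lborel. (\<Sum>i\<in>UNIV. h $ i * (g x $ i * \<phi> x)))"
    by (subst Bochner_Integration.integral_sum) (auto intro!: integrable_mult_right int2)
  also have "\<dots> = (LINT x|lborel. (g x \<bullet> h) * \<phi> x)"
    by (simp add: inner_vec_def sum_distrib_left sum_distrib_right mult_ac)
  finally show ?thesis .
qed

text \<open>Fix \<open>h\<close> and let \<open>\<Omega>h\<close> be the open set of all \<open>x\<close> whose segment to \<open>x + h\<close> stays in \<open>\<Omega>\<close>. For a test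
function \<open>\<phi>\<close> on \<open>\<Omega>h\<close>, a translation and the fundamental theorem of calculus for \<open>\<phi>\<close> give
\<open>\<integral> (u (x + h) - u x) \<phi> x dx = \<integral> u x (\<phi> (x - h) - \<phi> x) dx = \<integral> \<integral> u x D \<phi> (x - t h) (- h) dx dt\<close>.
Every \<open>\<phi> (x - t h)\<close> is a test function on \<open>\<Omega>\<close>, so the inner integral equals
\<open>\<integral> (g x \<bullet> h) \<phi> (x - t h) dx\<close>, and another translation moves the shift to \<open>g\<close>. The fundamental lemma on
\<open>\<Omega>h\<close> removes \<open>\<phi>\<close>.\<close>

lemma difference_eq_segment_integral:
  "AE x in lborel. (\<forall>t\<in>{0..1}. x + t *\<^sub>R h \<in> \<Omega>) \<longrightarrow>
      u (x + h) - u x = (LINT t|unit_interval_measure. g (x + t *\<^sub>R h) \<bullet> h)"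
proof -
  define \<Omega>h where "\<Omega>h = {x. \<forall>t\<in>{0..1}. x + t *\<^sub>R h \<in> \<Omega>}"
  define G where "G x = (LINT t|unit_interval_measure. g (x + t *\<^sub>R h) \<bullet> h)" for x
  have G: "integrable lborel G"
    using lborel_unit.integrable_fst'[OF segment_integrable[of h]] by (simp add: G_def[abs_def])
  have uh: "integrable lborel (\<lambda>x. u (x + h))" by (rule integrable_lborel_shift[OF u_L1])
  have "AE x in lborel. x \<in> \<Omega>h \<longrightarrow> (u (x + h) - u x) - G x = 0"
  proof (rule fundamental_lemma_lborel)
    show "open \<Omega>h" unfolding \<Omega>h_def by (rule open_segment_inside[OF open_dom])
    show "integrable lborel (\<lambda>x. (u (x + h) - u x) - G x)"
      by (intro Bochner_Integration.integrable_diff uh u_L1 G)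
    fix \<phi> assume tf: "test_function \<Omega>h \<phi>"
    then have sm: "C_infinity \<phi>" and supp: "closure {x. \<phi> x \<noteq> 0} \<subseteq> \<Omega>h"
      by (auto simp: test_function_def)
    have [measurable]: "\<phi> \<in> borel_measurable borel" by (rule C_infinity_borel_measurable[OF sm])
    obtain B where B: "\<And>x. \<bar>\<phi> x\<bar> \<le> B"
      by (rule test_function_bounded[OF tf]) (rule that)
    have tft: "test_function \<Omega> (\<lambda>x. \<phi> (x + t *\<^sub>R (- h)))" if "0 \<le> t" "t \<le> 1" for t
    proof (rule test_function_shift[OF tf])
      fix x assume "x + t *\<^sub>R (- h) \<in> closure {x. \<phi> x \<noteq> 0}"
      then have "x + t *\<^sub>R (- h) \<in> \<Omega>h" using supp by blast
      moreover have "t \<in> {0..1}" using that by simp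
      ultimately have "x + t *\<^sub>R (- h) + t *\<^sub>R h \<in> \<Omega>" unfolding \<Omega>h_def by blast
      then show "x \<in> \<Omega>" by simp
    qed
    have [measurable]: "directional_deriv (- h) \<phi> \<in> borel_measurable borel"
      by (rule borel_measurable_continuous_onI[OF continuous_directional_deriv[OF sm]])
    obtain B' where B': "\<And>x. \<bar>directional_deriv (- h) \<phi> x\<bar> \<le> B'"
    proof -
      have "\<exists>b. \<forall>i x. \<bar>partial_deriv i \<phi> x\<bar> \<le> b i"
      proof (intro choice allI)
        fix i
        obtain b where "\<And>x. \<bar>partial_deriv i \<phi> x\<bar> \<le> b"
          by (rule test_function_bounded[OF test_function_partial_deriv[OF tf, of i]]) (rule that)
        then show "\<exists>b. \<forall>x. \<bar>partial_deriv i \<phi> x\<bar> \<le> b" by blast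
      qed
      then obtain b where b: "\<And>i x. \<bar>partial_deriv i \<phi> x\<bar> \<le> b i" by blast
      have "\<bar>directional_deriv (- h) \<phi> x\<bar> \<le> (\<Sum>i\<in>UNIV. \<bar>h $ i\<bar> * b i)" for x
        unfolding directional_deriv_def
        by (rule order_trans[OF sum_abs sum_mono]) (simp add: abs_mult mult_left_mono b)
      then show ?thesis by (rule that)
    qed
    define F where "F = (\<lambda>(x, t). u x * directional_deriv (- h) \<phi> (x + t *\<^sub>R (- h)))"
    have F: "integrable (lborel \<Otimes>\<^sub>M unit_interval_measure) F"
    proof (rule integrable_pair_unit_bound[where w="\<lambda>x. \<bar>u x\<bar> * B'"])
      show "F \<in> borel_measurable (lborel \<Otimes>\<^sub>M unit_interval_measure)"
        unfolding F_def by measurable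
      show "integrable lborel (\<lambda>x. \<bar>u x\<bar> * B')" using u_L1 by simp
      show "\<bar>F (x, t)\<bar> \<le> \<bar>u x\<bar> * B'" for x t
        using B' by (auto simp: F_def abs_mult intro!: mult_left_mono)
    qed
    define H where "H = (\<lambda>(x, t). (g (x + t *\<^sub>R h) \<bullet> h) * \<phi> x)"
    have H: "integrable (lborel \<Otimes>\<^sub>M unit_interval_measure) H"
    proof (rule Bochner_Integration.integrable_bound)
      show "integrable (lborel \<Otimes>\<^sub>M unit_interval_measure) (\<lambda>z. B * norm (case z of (x, t) \<Rightarrow> g (x + t *\<^sub>R h) \<bullet> h))"
        using segment_integrable by (intro integrable_mult_right integrable_norm)
      show "H \<in> borel_measurable (lborel \<Otimes>\<^sub>M unit_interval_measure)"
        unfolding H_def by measurable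
      have "norm (H z) \<le> norm (B * norm (case z of (x, t) \<Rightarrow> g (x + t *\<^sub>R h) \<bullet> h))" for z
      proof (cases z)
        case (Pair x t)
        have "0 \<le> B" using B[of x] by linarith
        then show ?thesis
          using B[of x] by (simp add: H_def Pair abs_mult mult.commute mult_right_mono)
      qed
      then show "AE z in lborel \<Otimes>\<^sub>M unit_interval_measure. norm (H z) \<le> norm (B * norm (case z of (x, t) \<Rightarrow> g (x + t *\<^sub>R h) \<bullet> h))"
        by blast
    qed
    \<comment> \<open>Integration by parts for one value of \<open>t\<close>, followed by a translation by \<open>t h\<close>.\<close>
    have slice: "(LINT x|lborel. F (x, t)) = (LINT x|lborel. H (x, t))" if t: "0 \<le> t \<and> t \<le> 1" for t
    proof -
      let ?\<phi> = "\<lambda>x. \<phi> (x + t *\<^sub>R (- h))"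
      have "(LINT x|lborel. F (x, t)) = (LINT x|lborel. u x * directional_deriv (- h) ?\<phi> x)"
        by (simp add: F_def directional_deriv_def C_infinity_shift_deriv(1)[OF sm, of _ "t *\<^sub>R (- h)", simplified])
      also have "\<dots> = (LINT x|lborel. (g x \<bullet> h) * ?\<phi> x)"
        using t by (intro weak_directional tft) auto
      also have "\<dots> = (LINT x|lborel. (g (x + t *\<^sub>R h) \<bullet> h) * ?\<phi> (x + t *\<^sub>R h))"
        by (rule integral_lborel_shift[of "\<lambda>x. (g x \<bullet> h) * ?\<phi> x" "t *\<^sub>R h", symmetric]) measurable
      also have "\<dots> = (LINT x|lborel. H (x, t))"
        by (simp add: H_def)
      finally show ?thesis .
    qed
    have "(LINT x|lborel. u (x + h) * \<phi> x) = (LINT x|lborel. u x * \<phi> (x - h))"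
      using integral_lborel_shift[of "\<lambda>x. u x * \<phi> (x - h)" h] by simp
    moreover have "(LINT x|lborel. u x * \<phi> (x - h)) - (LINT x|lborel. u x * \<phi> x)
        = (LINT x|lborel. u x * \<phi> (x - h) - u x * \<phi> x)"
      by (rule Bochner_Integration.integral_diff[symmetric]) (intro integrable_times_bounded[where B=B] u_L1 B; measurable)+
    moreover have "\<dots> = (LINT x|lborel. LINT t|unit_interval_measure. F (x, t))"
      using directional_deriv_FTC[OF sm, of "- h"]
      by (intro Bochner_Integration.integral_cong) (simp_all add: F_def right_diff_distrib)
    moreover have "\<dots> = (LINT t|unit_interval_measure. LINT x|lborel. F (x, t))"
      using F by (intro lborel_unit.Fubini_integral[symmetric]) simp
    moreover have "\<dots> = (LINT t|unit_interval_measure. LINT x|lborel. H (x, t))"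
    proof (rule integral_cong_AE)
      show "(\<lambda>t. LINT x|lborel. F (x, t)) \<in> borel_measurable unit_interval_measure"
        using lborel_unit.integrable_snd[of "\<lambda>x t. F (x, t)"] F by simp
      show "(\<lambda>t. LINT x|lborel. H (x, t)) \<in> borel_measurable unit_interval_measure"
        using lborel_unit.integrable_snd[of "\<lambda>x t. H (x, t)"] H by simp
      show "AE t in unit_interval_measure. (LINT x|lborel. F (x, t)) = (LINT x|lborel. H (x, t))"
        using AE_unit_interval by eventually_elim (rule slice)
    qed
    moreover have "\<dots> = (LINT x|lborel. LINT t|unit_interval_measure. H (x, t))"
      using H by (intro lborel_unit.Fubini_integral) simp
    moreover have "\<dots> = (LINT x|lborel. G x * \<phi> x)"
      by (simp add: H_def G_def)
    ultimately have eq: "(LINT x|lborel. u (x + h) * \<phi> x) - (LINT x|lborel. u x * \<phi> x) = (LINT x|lborel. G x * \<phi> x)"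
      by simp
    have "(LINT x|lborel. (u (x + h) - u x - G x) * \<phi> x)
        = (LINT x|lborel. (u (x + h) * \<phi> x - u x * \<phi> x) - G x * \<phi> x)"
      by (simp add: left_diff_distrib)
    also have "\<dots> = (LINT x|lborel. u (x + h) * \<phi> x) - (LINT x|lborel. u x * \<phi> x) - (LINT x|lborel. G x * \<phi> x)"
      using integrable_times_bounded[OF uh _ B] integrable_times_bounded[OF u_L1 _ B] integrable_times_bounded[OF G _ B]
      by simp
    finally show "(LINT x|lborel. (u (x + h) - u x - G x) * \<phi> x) = 0"
      using eq by simp
  qed
  then show ?thesis
    by eventually_elim (simp add: \<Omega>h_def G_def)
qed

lemma increment_representation:
  "AE x in lborel. (\<forall>t\<in>{0..1}. x + t *\<^sub>R h \<in> \<Omega>) \<longrightarrow>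
      u (x + h) - u x = (LINT t|unit_interval_measure. g (x + t *\<^sub>R h) \<bullet> h) \<and>
      integrable unit_interval_measure (\<lambda>t. g (x + t *\<^sub>R h) \<bullet> h)"
  using difference_eq_segment_integral[of h] lborel_unit.AE_integrable_fst'[OF segment_integrable[of h]]
  by eventually_elim auto

text \<open>Jensen's inequality along each segment, Tonelli's theorem, and the invariance of Lebesgue measure under the
translation by \<open>t k\<close>, which maps \<open>A\<close> into \<open>S\<close>.\<close>

lemma increment_bound_unshifted:
  assumes [measurable]: "A \<in> sets borel" "S \<in> sets borel" and sub: "S \<subseteq> \<Omega>"
    and path: "\<And>x t. x \<in> A \<Longrightarrow> 0 \<le> t \<Longrightarrow> t \<le> 1 \<Longrightarrow> x + t *\<^sub>R k \<in> S"
  shows "(\<integral>\<^sup>+x\<in>A. ennreal (\<bar>u (x + k) - u x\<bar> powr p) \<partial>lborel) \<le> (\<integral>\<^sup>+x\<in>S. ennreal (\<bar>g x \<bullet> k\<bar> powr p) \<partial>lborel)"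
proof -
  define f where "f y = ennreal (\<bar>g y \<bullet> k\<bar> powr p) * indicator S y" for y
  have [measurable]: "f \<in> borel_measurable borel" unfolding f_def by measurable
  have "(\<integral>\<^sup>+x\<in>A. ennreal (\<bar>u (x + k) - u x\<bar> powr p) \<partial>lborel)
      \<le> (\<integral>\<^sup>+x. \<integral>\<^sup>+t. f (x + t *\<^sub>R k) \<partial>unit_interval_measure \<partial>lborel)"
  proof (rule nn_integral_mono_AE)
    show "AE x in lborel. ennreal (\<bar>u (x + k) - u x\<bar> powr p) * indicator A x
        \<le> (\<integral>\<^sup>+t. f (x + t *\<^sub>R k) \<partial>unit_interval_measure)"
      using increment_representation[of k]
    proof eventually_elim
      case (elim x)
      show ?case
      proof (cases "x \<in> A")
        case True
        then have "\<forall>t\<in>{0..1}. x + t *\<^sub>R k \<in> \<Omega>" using path sub by auto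
        with elim have eq: "u (x + k) - u x = (LINT t|unit_interval_measure. g (x + t *\<^sub>R k) \<bullet> k)"
          and int: "integrable unit_interval_measure (\<lambda>t. g (x + t *\<^sub>R k) \<bullet> k)" by auto
        have "ennreal (\<bar>u (x + k) - u x\<bar> powr p)
            \<le> (\<integral>\<^sup>+t. ennreal (\<bar>g (x + t *\<^sub>R k) \<bullet> k\<bar> powr p) \<partial>unit_interval_measure)"
          unfolding eq by (rule unit_interval_Jensen[OF p_ge_1 int])
        also have "\<dots> \<le> (\<integral>\<^sup>+t. f (x + t *\<^sub>R k) \<partial>unit_interval_measure)"
          using AE_unit_interval path[OF True]
          by (intro nn_integral_mono_AE) (auto simp: f_def)
        finally show ?thesis using True by simp
      qed simp
    qed
  qed
  also have "\<dots> = (\<integral>\<^sup>+t. \<integral>\<^sup>+x. f (x + t *\<^sub>R k) \<partial>lborel \<partial>unit_interval_measure)"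
    by (rule lborel_unit.Fubini'[symmetric]) measurable
  also have "\<dots> = (\<integral>\<^sup>+t. \<integral>\<^sup>+x. f x \<partial>lborel \<partial>unit_interval_measure)"
    by (intro nn_integral_cong nn_integral_lborel_shift) measurable
  also have "\<dots> = (\<integral>\<^sup>+x. f x \<partial>lborel)"
    using unit_interval.emeasure_space_1 by simp
  finally show ?thesis by (simp add: f_def)
qed

text \<open>The initial translation by \<open>a\<close> is what the three legs of the detour near the boundary require.\<close>

lemma increment_bound:
  assumes [measurable]: "A \<in> sets borel" "S \<in> sets borel" and sub: "S \<subseteq> \<Omega>"
    and path: "\<And>x t. x \<in> A \<Longrightarrow> 0 \<le> t \<Longrightarrow> t \<le> 1 \<Longrightarrow> x + a + t *\<^sub>R k \<in> S"
  shows "(\<integral>\<^sup>+x\<in>A. ennreal (\<bar>u (x + a + k) - u (x + a)\<bar> powr p) \<partial>lborel)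
      \<le> (\<integral>\<^sup>+x\<in>S. ennreal (\<bar>g x \<bullet> k\<bar> powr p) \<partial>lborel)"
proof -
  define A' where "A' = {x. x - a \<in> A}"
  have [measurable]: "A' \<in> sets borel"
  proof -
    have "(\<lambda>x. x - a) -` A \<inter> space borel \<in> sets borel" by (rule measurable_sets[of _ borel borel]) measurable
    then show ?thesis by (simp add: A'_def vimage_def)
  qed
  have "(\<integral>\<^sup>+x\<in>A. ennreal (\<bar>u (x + a + k) - u (x + a)\<bar> powr p) \<partial>lborel)
      = (\<integral>\<^sup>+x. ennreal (\<bar>u (x + a + k) - u (x + a)\<bar> powr p) * indicator A' (x + a) \<partial>lborel)"
    by (intro nn_integral_cong) (simp add: A'_def indicator_def)
  also have "\<dots> = (\<integral>\<^sup>+x\<in>A'. ennreal (\<bar>u (x + k) - u x\<bar> powr p) \<partial>lborel)"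
    by (rule nn_integral_lborel_shift[where f="\<lambda>x. ennreal (\<bar>u (x + k) - u x\<bar> powr p) * indicator A' x"]) measurable
  also have "\<dots> \<le> (\<integral>\<^sup>+x\<in>S. ennreal (\<bar>g x \<bullet> k\<bar> powr p) \<partial>lborel)"
    by (rule increment_bound_unshifted) (use sub path[of "_ - a"] in \<open>auto simp: A'_def\<close>)
  finally show ?thesis .
qed

text \<open>By the identity for increments, \<open>u (x + k) - u x - g x \<bullet> k\<close> is the average of \<open>(g (x + t k) - g x) \<bullet> k\<close>.\<close>

lemma linearization_bound:
  assumes [measurable]: "A \<in> sets borel"
    and path: "\<And>x t. x \<in> A \<Longrightarrow> 0 \<le> t \<Longrightarrow> t \<le> 1 \<Longrightarrow> x + t *\<^sub>R k \<in> \<Omega>"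
    and small: "\<And>t. 0 \<le> t \<Longrightarrow> t \<le> 1 \<Longrightarrow> (\<integral>\<^sup>+x. ennreal (norm (g (x + t *\<^sub>R k) - g x) powr p) \<partial>lborel) \<le> c"
  shows "(\<integral>\<^sup>+x\<in>A. ennreal (\<bar>u (x + k) - u x - g x \<bullet> k\<bar> powr p) \<partial>lborel) \<le> ennreal (norm k powr p) * c"
proof -
  define f where "f t x = ennreal (norm k powr p) * ennreal (norm (g (x + t *\<^sub>R k) - g x) powr p)" for t :: real and x
  have "(\<integral>\<^sup>+x\<in>A. ennreal (\<bar>u (x + k) - u x - g x \<bullet> k\<bar> powr p) \<partial>lborel)
      \<le> (\<integral>\<^sup>+x. \<integral>\<^sup>+t. f t x \<partial>unit_interval_measure \<partial>lborel)"
  proof (rule nn_integral_mono_AE)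
    show "AE x in lborel. ennreal (\<bar>u (x + k) - u x - g x \<bullet> k\<bar> powr p) * indicator A x
        \<le> (\<integral>\<^sup>+t. f t x \<partial>unit_interval_measure)"
      using increment_representation[of k]
    proof eventually_elim
      case (elim x)
      show ?case
      proof (cases "x \<in> A")
        case True
        then have "\<forall>t\<in>{0..1}. x + t *\<^sub>R k \<in> \<Omega>" using path by auto
        with elim have eq: "u (x + k) - u x = (LINT t|unit_interval_measure. g (x + t *\<^sub>R k) \<bullet> k)"
          and int: "integrable unit_interval_measure (\<lambda>t. g (x + t *\<^sub>R k) \<bullet> k)" by auto
        have eq': "u (x + k) - u x - g x \<bullet> k = (LINT t|unit_interval_measure. g (x + t *\<^sub>R k) \<bullet> k - g x \<bullet> k)"
          using int unit_interval.prob_space by (subst Bochner_Integration.integral_diff) (auto simp: eq)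
        have "ennreal (\<bar>u (x + k) - u x - g x \<bullet> k\<bar> powr p)
            \<le> (\<integral>\<^sup>+t. ennreal (\<bar>g (x + t *\<^sub>R k) \<bullet> k - g x \<bullet> k\<bar> powr p) \<partial>unit_interval_measure)"
          unfolding eq' by (rule unit_interval_Jensen[OF p_ge_1]) (use int in simp)
        also have "\<dots> \<le> (\<integral>\<^sup>+t. f t x \<partial>unit_interval_measure)"
        proof (rule nn_integral_mono)
          fix t
          have "\<bar>g (x + t *\<^sub>R k) \<bullet> k - g x \<bullet> k\<bar> \<le> norm k * norm (g (x + t *\<^sub>R k) - g x)"
            using Cauchy_Schwarz_ineq2[of "g (x + t *\<^sub>R k) - g x" k] by (simp add: inner_diff_left mult.commute)
          then have "\<bar>g (x + t *\<^sub>R k) \<bullet> k - g x \<bullet> k\<bar> powr p \<le> (norm k * norm (g (x + t *\<^sub>R k) - g x)) powr p"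
            using p_ge_1 by (intro powr_mono2) auto
          then show "ennreal (\<bar>g (x + t *\<^sub>R k) \<bullet> k - g x \<bullet> k\<bar> powr p) \<le> f t x"
            by (simp add: f_def powr_mult ennreal_mult[symmetric] ennreal_leI)
        qed
        finally show ?thesis using True by simp
      qed simp
    qed
  qed
  also have "\<dots> = (\<integral>\<^sup>+t. \<integral>\<^sup>+x. f t x \<partial>lborel \<partial>unit_interval_measure)"
    unfolding f_def by (rule lborel_unit.Fubini'[symmetric]) measurable
  also have "\<dots> \<le> (\<integral>\<^sup>+t. ennreal (norm k powr p) * c \<partial>unit_interval_measure)"
  proof (rule nn_integral_mono_AE)
    show "AE t in unit_interval_measure. (\<integral>\<^sup>+x. f t x \<partial>lborel) \<le> ennreal (norm k powr p) * c"
      using AE_unit_interval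
    proof eventually_elim
      case (elim t)
      have "(\<integral>\<^sup>+x. f t x \<partial>lborel) = ennreal (norm k powr p) * (\<integral>\<^sup>+x. ennreal (norm (g (x + t *\<^sub>R k) - g x) powr p) \<partial>lborel)"
        unfolding f_def by (rule nn_integral_cmult) measurable
      also have "\<dots> \<le> ennreal (norm k powr p) * c"
        using elim small by (intro mult_left_mono) auto
      finally show ?case .
    qed
  qed
  also have "\<dots> = ennreal (norm k powr p) * c"
    using unit_interval.emeasure_space_1 by simp
  finally show ?thesis .
qed

end

section \<open>Continuity of translations in Lebesgue spaces\<close>

lemma powr_sum3_le:
  fixes a b c :: real
  assumes "1 \<le> p" "0 \<le> a" "0 \<le> b" "0 \<le> c"
  shows "(a + b + c) powr p \<le> 3 powr p * (a powr p + b powr p + c powr p)"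
proof -
  define m where "m = max a (max b c)"
  have "(a + b + c) powr p \<le> (3 * m) powr p"
    using assms by (intro powr_mono2) (auto simp: m_def)
  also have "\<dots> = 3 powr p * m powr p"
    using assms by (intro powr_mult)
  also have "m powr p \<le> a powr p + b powr p + c powr p"
    unfolding m_def max_def by auto
  finally show ?thesis by (simp add: mult_left_mono)
qed

text \<open>Convexity for \<open>b = (1 - s) (a / (1 - s)) + s ((b - a) / s)\<close>. It serves in place of Minkowski's inequality: for small
\<open>s\<close> the first coefficient is close to \<open>1\<close>.\<close>

lemma abs_powr_split:
  fixes a b :: real
  assumes "1 \<le> p" "0 < s" "s < 1"
  shows "\<bar>b\<bar> powr p \<le> (1 - s) powr (1 - p) * \<bar>a\<bar> powr p + s powr (1 - p) * \<bar>a - b\<bar> powr p"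
proof -
  have scale: "r * \<bar>y / r\<bar> powr p = r powr (1 - p) * \<bar>y\<bar> powr p" if "r > 0" for r y :: real
  proof -
    have "r * \<bar>y / r\<bar> powr p = r powr 1 * (\<bar>y\<bar> powr p / r powr p)"
      using that by (simp add: powr_divide abs_divide)
    then show ?thesis using that by (simp add: powr_diff)
  qed
  have "\<bar>b\<bar> powr p = \<bar>(1 - s) * (a / (1 - s)) + s * ((b - a) / s)\<bar> powr p"
    using assms by simp
  also have "\<dots> \<le> (1 - s) * \<bar>a / (1 - s)\<bar> powr p + s * \<bar>(b - a) / s\<bar> powr p"
    using assms by (intro abs_powr_convex) auto
  also have "\<dots> = (1 - s) powr (1 - p) * \<bar>a\<bar> powr p + s powr (1 - p) * \<bar>a - b\<bar> powr p"
    using assms scale[of "1 - s" a] scale[of s "b - a"] by (simp only: abs_minus_commute[of b a])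
  finally show ?thesis .
qed

lemma norm_triangle3: "norm (a + b + c) \<le> norm a + norm b + norm c"
  using norm_triangle_ineq[of "a + b" c] norm_triangle_ineq[of a b] by linarith

text \<open>Inner regularity, applied to the finite measure that Lebesgue measure induces on \<open>A\<close>.\<close>

lemma inner_compact_lborel:
  fixes A :: "'a::euclidean_space set"
  assumes A: "A \<in> sets borel" "emeasure lborel A < \<infinity>" and e: "0 < e"
  obtains K where "compact K" "K \<subseteq> A" "emeasure lborel (A - K) \<le> ennreal e"
proof (cases "emeasure lborel A \<le> ennreal e")
  case True
  then show ?thesis by (intro that[of "{}"]) auto
next
  case False
  define M where "M = density lborel (indicator A :: 'a \<Rightarrow> ennreal)"
  have [measurable]: "A \<in> sets borel" by (rule A(1))
  have M: "emeasure M B = emeasure lborel (A \<inter> B)" if "B \<in> sets borel" for B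
    using that by (simp add: M_def emeasure_density indicator_inter_arith[symmetric] Int_commute)
  have "emeasure M A = (SUP K\<in>{K. K \<subseteq> A \<and> compact K}. emeasure M K)"
    by (rule inner_regular) (use A M[of UNIV] in \<open>auto simp: M_def\<close>)
  moreover have "emeasure M A - ennreal e < emeasure M A"
    using A False e M[of A] by (intro ennreal_between) (auto simp: not_le intro: le_less_trans[OF zero_le])
  ultimately obtain K where K: "K \<subseteq> A" "compact K" "emeasure M A - ennreal e < emeasure M K"
    by (auto simp: less_SUP_iff)
  have Kb [measurable]: "K \<in> sets borel" using compact_imp_closed[OF K(2)] by simp
  have "emeasure lborel A - ennreal e < emeasure lborel K"
    using K M[of A] M[of K] by (simp add: Int_absorb1)
  then have "emeasure lborel A \<le> emeasure lborel K + ennreal e"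
    by (auto dest!: less_imp_le simp: ennreal_minus_le_iff add.commute)
  moreover have "emeasure lborel A = emeasure lborel K + emeasure lborel (A - K)"
    using K(1) by (subst plus_emeasure) (auto simp: Un_absorb1)
  moreover have "emeasure lborel K < \<infinity>"
    using emeasure_bounded_finite[OF compact_imp_bounded[OF K(2)]] by simp
  ultimately have "emeasure lborel (A - K) \<le> ennreal e"
    by (auto simp: ennreal_add_left_cancel_le)
  with K show ?thesis by (intro that)
qed

text \<open>Choose a compact \<open>K\<close> inside \<open>A\<close> and an open \<open>U\<close> around it that differ little from \<open>A\<close>. A small translation moves
\<open>K\<close> into \<open>U\<close>, so \<open>x\<close> and \<open>x + k\<close> can lie on different sides of \<open>A\<close> only if one of them is in \<open>A - K\<close> or in
\<open>U - A\<close>.\<close>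

lemma translation_continuous_indicator:
  fixes A :: "'a::euclidean_space set"
  assumes A: "A \<in> sets borel" "emeasure lborel A < \<infinity>" and "0 < e"
  obtains d where "0 < d" "\<And>k. norm k < d \<Longrightarrow>
    (\<integral>\<^sup>+x. ennreal \<bar>indicat_real A (x + k) - indicat_real A x\<bar> \<partial>lborel) \<le> ennreal e"
proof -
  have e4: "e / 4 > 0" using \<open>0 < e\<close> by simp
  obtain K where K: "compact K" "K \<subseteq> A" "emeasure lborel (A - K) \<le> ennreal (e / 4)"
    by (rule inner_compact_lborel[OF A e4]) (rule that)
  have Al: "A \<in> sets lebesgue" using A(1) by simp
  obtain U where U: "open U" "A \<subseteq> U" "emeasure lebesgue (U - A) < ennreal (e / 4)"
    by (rule sets_lebesgue_outer_open[OF Al e4]) (rule that)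
  have bK [measurable]: "A - K \<in> sets borel" using A(1) borel_compact[OF K(1)] by (rule sets.Diff)
  have bU [measurable]: "U - A \<in> sets borel" using A U(1) by auto
  have mU: "emeasure lborel (U - A) \<le> ennreal (e / 4)"
    using U(3) bU by (simp add: less_imp_le)
  have "K \<subseteq> U" using K U by blast
  obtain d where d: "d > 0" "(\<Union>x\<in>K. ball x d) \<subseteq> U"
    by (rule compact_subset_open_imp_ball_epsilon_subset[OF K(1) U(1) \<open>K \<subseteq> U\<close>]) (rule that)
  show ?thesis
  proof (rule that[OF d(1)])
    fix k :: 'a assume k: "norm k < d"
    have shift_pair: "(\<integral>\<^sup>+x. indicator B x + indicator B (x + k) \<partial>lborel) = emeasure lborel B + emeasure lborel B"
      if B [measurable]: "B \<in> sets borel" for B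
    proof -
      have "(\<integral>\<^sup>+x. indicator B x + indicator B (x + k) \<partial>lborel)
          = (\<integral>\<^sup>+x. indicator B x \<partial>lborel) + (\<integral>\<^sup>+x. indicator B (x + k) \<partial>lborel)"
        by (rule nn_integral_add) measurable
      also have "(\<integral>\<^sup>+x. indicator B (x + k) \<partial>lborel) = (\<integral>\<^sup>+x. indicator B x \<partial>(lborel :: 'a measure))"
        by (rule nn_integral_lborel_shift) measurable
      finally show ?thesis using B by simp
    qed
    have near: "x + k \<in> U" if "x \<in> K" for x
    proof -
      have "x + k \<in> ball x d" using k by (simp add: dist_norm)
      then show ?thesis using d(2) that by blast
    qed
    have near': "x \<in> U" if "x + k \<in> K" for x
    proof -
      have "x \<in> ball (x + k) d" using k by (simp add: dist_norm)
      then show ?thesis using d(2) that by blast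
    qed
    let ?K = "\<lambda>x. indicator (A - K) x :: ennreal" and ?U = "\<lambda>x. indicator (U - A) x :: ennreal"
    have "(\<integral>\<^sup>+x. ennreal \<bar>indicat_real A (x + k) - indicat_real A x\<bar> \<partial>lborel)
        \<le> (\<integral>\<^sup>+x. (?K x + ?K (x + k)) + (?U x + ?U (x + k)) \<partial>lborel)"
    proof (rule nn_integral_mono)
      fix x
      consider "x \<in> A" "x + k \<in> A" | "x \<notin> A" "x + k \<notin> A" | "x \<in> A" "x + k \<notin> A" | "x \<notin> A" "x + k \<in> A" by blast
      then show "ennreal \<bar>indicat_real A (x + k) - indicat_real A x\<bar> \<le> (?K x + ?K (x + k)) + (?U x + ?U (x + k))"
      proof cases
        case 3
        then show ?thesis using near[of x] by (cases "x \<in> K") auto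
      next
        case 4
        then show ?thesis using near'[of x] by (cases "x + k \<in> K") auto
      qed simp_all
    qed
    also have "\<dots> = (\<integral>\<^sup>+x. ?K x + ?K (x + k) \<partial>lborel) + (\<integral>\<^sup>+x. ?U x + ?U (x + k) \<partial>lborel)"
      by (rule nn_integral_add) measurable
    also have "(\<integral>\<^sup>+x. ?K x + ?K (x + k) \<partial>lborel) = emeasure lborel (A - K) + emeasure lborel (A - K)"
      by (rule shift_pair[OF bK])
    also have "(\<integral>\<^sup>+x. ?U x + ?U (x + k) \<partial>lborel) = emeasure lborel (U - A) + emeasure lborel (U - A)"
      by (rule shift_pair[OF bU])
    also have "(emeasure lborel (A - K) + emeasure lborel (A - K)) + (emeasure lborel (U - A) + emeasure lborel (U - A))
        \<le> (ennreal (e / 4) + ennreal (e / 4)) + (ennreal (e / 4) + ennreal (e / 4))"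
      by (intro add_mono K(3) mU)
    also have "\<dots> = ennreal e"
      using \<open>0 < e\<close> by (simp add: ennreal_plus[symmetric] del: ennreal_plus)
    finally show "(\<integral>\<^sup>+x. ennreal \<bar>indicat_real A (x + k) - indicat_real A x\<bar> \<partial>lborel) \<le> ennreal e" .
  qed
qed

text \<open>Indicator functions span a dense subspace, and the property is stable under sums and limits in \<open>L\<^sup>1\<close>.\<close>

lemma translation_continuous_L1:
  fixes f :: "'a::euclidean_space \<Rightarrow> 'b::{banach, second_countable_topology}"
  assumes "integrable lborel f"
  shows "\<forall>e>0. \<exists>d>0. \<forall>k. norm k < d \<longrightarrow> (\<integral>\<^sup>+x. ennreal (norm (f (x + k) - f x)) \<partial>lborel) \<le> ennreal e"
  using assms
proof (induction rule: integrable_induct)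
  case (base A c)
  show ?case
  proof (intro allI impI)
    fix e :: real assume "0 < e"
    then have "e / (1 + norm c) > 0" by (simp add: add_pos_nonneg)
    then obtain d where d: "d > 0" "\<And>k. norm k < d \<Longrightarrow>
        (\<integral>\<^sup>+x. ennreal \<bar>indicat_real A (x + k) - indicat_real A x\<bar> \<partial>lborel) \<le> ennreal (e / (1 + norm c))"
      using translation_continuous_indicator[of A "e / (1 + norm c)"] base by auto
    have "(\<integral>\<^sup>+x. ennreal (norm (indicat_real A (x + k) *\<^sub>R c - indicat_real A x *\<^sub>R c)) \<partial>lborel) \<le> ennreal e"
      if k: "norm k < d" for k
    proof -
      have [measurable]: "A \<in> sets borel" using base by simp
      have "(\<integral>\<^sup>+x. ennreal (norm (indicat_real A (x + k) *\<^sub>R c - indicat_real A x *\<^sub>R c)) \<partial>lborel)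
          = (\<integral>\<^sup>+x. ennreal (norm c) * ennreal \<bar>indicat_real A (x + k) - indicat_real A x\<bar> \<partial>lborel)"
        by (intro nn_integral_cong) (simp add: scaleR_diff_left[symmetric] ennreal_mult[symmetric] mult.commute)
      also have "\<dots> = ennreal (norm c) * (\<integral>\<^sup>+x. ennreal \<bar>indicat_real A (x + k) - indicat_real A x\<bar> \<partial>lborel)"
        by (rule nn_integral_cmult) measurable
      also have "\<dots> \<le> ennreal (norm c) * ennreal (e / (1 + norm c))"
        by (intro mult_left_mono d k) auto
      also have "\<dots> = ennreal (norm c * (e / (1 + norm c)))"
        using \<open>0 < e\<close> by (intro ennreal_mult[symmetric]) (auto simp: add_nonneg_nonneg)
      also have "\<dots> \<le> ennreal e"
        using \<open>0 < e\<close> by (intro ennreal_leI) (simp add: field_simps add_pos_nonneg)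
      finally show ?thesis .
    qed
    with d(1) show "\<exists>d>0. \<forall>k. norm k < d \<longrightarrow>
        (\<integral>\<^sup>+x. ennreal (norm (indicat_real A (x + k) *\<^sub>R c - indicat_real A x *\<^sub>R c)) \<partial>lborel) \<le> ennreal e"
      by blast
  qed
next
  case (add f g)
  have [measurable]: "f \<in> borel_measurable borel" "g \<in> borel_measurable borel" using add by auto
  show ?case
  proof (intro allI impI)
    fix e :: real assume "0 < e"
    then have e2: "e / 2 > 0" by simp
    obtain d1 where d1: "d1 > 0"
      "\<And>k. norm k < d1 \<Longrightarrow> (\<integral>\<^sup>+x. ennreal (norm (f (x + k) - f x)) \<partial>lborel) \<le> ennreal (e / 2)"
      using add.IH(1) e2 by blast
    obtain d2 where d2: "d2 > 0"
      "\<And>k. norm k < d2 \<Longrightarrow> (\<integral>\<^sup>+x. ennreal (norm (g (x + k) - g x)) \<partial>lborel) \<le> ennreal (e / 2)"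
      using add.IH(2) e2 by blast
    have "(\<integral>\<^sup>+x. ennreal (norm (f (x + k) + g (x + k) - (f x + g x))) \<partial>lborel) \<le> ennreal e"
      if k: "norm k < min d1 d2" for k
    proof -
      have "(\<integral>\<^sup>+x. ennreal (norm (f (x + k) + g (x + k) - (f x + g x))) \<partial>lborel)
          \<le> (\<integral>\<^sup>+x. ennreal (norm (f (x + k) - f x)) + ennreal (norm (g (x + k) - g x)) \<partial>lborel)"
        by (intro nn_integral_mono)
          (simp add: ennreal_plus[symmetric] norm_diff_triangle_ineq ennreal_leI del: ennreal_plus)
      also have "\<dots> = (\<integral>\<^sup>+x. ennreal (norm (f (x + k) - f x)) \<partial>lborel) + (\<integral>\<^sup>+x. ennreal (norm (g (x + k) - g x)) \<partial>lborel)"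
        by (rule nn_integral_add) measurable
      also have "\<dots> \<le> ennreal (e / 2) + ennreal (e / 2)"
        using k by (intro add_mono d1 d2) auto
      also have "\<dots> = ennreal e"
        using \<open>0 < e\<close> by (simp add: ennreal_plus[symmetric] del: ennreal_plus)
      finally show ?thesis .
    qed
    then show "\<exists>d>0. \<forall>k. norm k < d \<longrightarrow>
        (\<integral>\<^sup>+x. ennreal (norm (f (x + k) + g (x + k) - (f x + g x))) \<partial>lborel) \<le> ennreal e"
      using d1(1) d2(1) by (intro exI[of _ "min d1 d2"]) simp
  qed
next
  case (lim f s)
  have [measurable]: "f \<in> borel_measurable borel" "\<And>i. s i \<in> borel_measurable borel" using lim by auto
  have conv: "(\<lambda>i. \<integral>\<^sup>+x. norm (f x - s i x) \<partial>lborel) \<longlonglongrightarrow> 0"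
  proof (rule nn_integral_dominated_convergence_norm[where w="\<lambda>x. 2 * norm (f x)"])
    show "(\<integral>\<^sup>+x. ennreal (2 * norm (f x)) \<partial>lborel) < \<infinity>"
    proof -
      have "integrable lborel (\<lambda>x. 2 * norm (f x))"
        using \<open>integrable lborel f\<close> by (intro integrable_mult_right integrable_norm)
      then have "(\<integral>\<^sup>+x. ennreal (norm (2 * norm (f x))) \<partial>lborel) < \<infinity>"
        unfolding integrable_iff_bounded by blast
      then show ?thesis by simp
    qed
  qed (use lim in auto)
  show ?case
  proof (intro allI impI)
    fix e :: real assume e: "0 < e"
    then have "ennreal (e / 3) > 0" by simp
    from order_tendstoD(2)[OF conv this] obtain i where
      i: "(\<integral>\<^sup>+x. norm (f x - s i x) \<partial>lborel) < ennreal (e / 3)"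
      by (auto simp: eventually_sequentially)
    from e have "e / 3 > 0" by simp
    then obtain d where d: "d > 0"
      "\<And>k. norm k < d \<Longrightarrow> (\<integral>\<^sup>+x. ennreal (norm (s i (x + k) - s i x)) \<partial>lborel) \<le> ennreal (e / 3)"
      using lim.IH[of i] by blast
    have "(\<integral>\<^sup>+x. ennreal (norm (f (x + k) - f x)) \<partial>lborel) \<le> ennreal e" if k: "norm k < d" for k
    proof -
      have "(\<integral>\<^sup>+x. ennreal (norm (f (x + k) - f x)) \<partial>lborel)
          \<le> (\<integral>\<^sup>+x. (ennreal (norm (f (x + k) - s i (x + k))) + ennreal (norm (f x - s i x)))
              + ennreal (norm (s i (x + k) - s i x)) \<partial>lborel)"
      proof (rule nn_integral_mono)
        fix x
        have "norm (f (x + k) - f x) \<le> norm (f (x + k) - s i (x + k)) + norm (f x - s i x) + norm (s i (x + k) - s i x)"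
          using norm_triangle3[of "f (x + k) - s i (x + k)" "s i x - f x" "s i (x + k) - s i x"]
          by (simp add: norm_minus_commute[of "s i x" "f x"])
        then show "ennreal (norm (f (x + k) - f x)) \<le> (ennreal (norm (f (x + k) - s i (x + k))) + ennreal (norm (f x - s i x)))
              + ennreal (norm (s i (x + k) - s i x))"
          by (simp add: ennreal_plus[symmetric] ennreal_leI del: ennreal_plus)
      qed
      also have "\<dots> = ((\<integral>\<^sup>+x. ennreal (norm (f (x + k) - s i (x + k))) \<partial>lborel) + (\<integral>\<^sup>+x. ennreal (norm (f x - s i x)) \<partial>lborel))
          + (\<integral>\<^sup>+x. ennreal (norm (s i (x + k) - s i x)) \<partial>lborel)"
      proof -
        have "(\<integral>\<^sup>+x. (ennreal (norm (f (x + k) - s i (x + k))) + ennreal (norm (f x - s i x)))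
              + ennreal (norm (s i (x + k) - s i x)) \<partial>lborel)
            = (\<integral>\<^sup>+x. ennreal (norm (f (x + k) - s i (x + k))) + ennreal (norm (f x - s i x)) \<partial>lborel)
              + (\<integral>\<^sup>+x. ennreal (norm (s i (x + k) - s i x)) \<partial>lborel)"
          by (rule nn_integral_add) measurable
        also have "(\<integral>\<^sup>+x. ennreal (norm (f (x + k) - s i (x + k))) + ennreal (norm (f x - s i x)) \<partial>lborel)
            = (\<integral>\<^sup>+x. ennreal (norm (f (x + k) - s i (x + k))) \<partial>lborel) + (\<integral>\<^sup>+x. ennreal (norm (f x - s i x)) \<partial>lborel)"
          by (rule nn_integral_add) measurable
        finally show ?thesis .
      qed
      also have "(\<integral>\<^sup>+x. ennreal (norm (f (x + k) - s i (x + k))) \<partial>lborel) = (\<integral>\<^sup>+x. ennreal (norm (f x - s i x)) \<partial>lborel)"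
        by (rule nn_integral_lborel_shift[of "\<lambda>x. ennreal (norm (f x - s i x))"]) measurable
      also have "(\<integral>\<^sup>+x. ennreal (norm (f x - s i x)) \<partial>lborel) + (\<integral>\<^sup>+x. ennreal (norm (f x - s i x)) \<partial>lborel)
          + (\<integral>\<^sup>+x. ennreal (norm (s i (x + k) - s i x)) \<partial>lborel) \<le> ennreal (e / 3) + ennreal (e / 3) + ennreal (e / 3)"
        using i k by (intro add_mono d) auto
      also have "\<dots> = ennreal e"
        using e by (simp add: ennreal_plus[symmetric] del: ennreal_plus)
      finally show ?thesis .
    qed
    then show "\<exists>d>0. \<forall>k. norm k < d \<longrightarrow> (\<integral>\<^sup>+x. ennreal (norm (f (x + k) - f x)) \<partial>lborel) \<le> ennreal e"
      using d(1) by blast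
  qed
qed

text \<open>Cutting off large values changes \<open>f\<close> little in \<open>L\<^sup>p\<close>. The cut-off function is bounded by \<open>m\<close>, so the \<open>p\<close>-th
power of its increments is at most a constant times the increments, and continuity in \<open>L\<^sup>1\<close> applies.\<close>

lemma translation_continuous_Lp:
  fixes f :: "'a::euclidean_space \<Rightarrow> 'b::{banach, second_countable_topology}"
  assumes f: "integrable lborel f" and fp: "integrable lborel (\<lambda>x. norm (f x) powr p)" and p: "1 \<le> p" and e: "0 < e"
  obtains d where "0 < d"
    "\<And>k. norm k < d \<Longrightarrow> (\<integral>\<^sup>+x. ennreal (norm (f (x + k) - f x) powr p) \<partial>lborel) \<le> ennreal e"
proof -
  have [measurable]: "f \<in> borel_measurable borel" using f by auto
  define c where "c = 3 powr p"
  have c: "c > 0" by (simp add: c_def)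
  define cut where "cut m x = (if norm (f x) \<le> real m then f x else 0)" for m :: nat and x
  have [measurable]: "cut m \<in> borel_measurable borel" for m unfolding cut_def by measurable
  have "(\<lambda>m. LINT x|lborel. norm (f x - cut m x) powr p) \<longlonglongrightarrow> (LINT x|(lborel::'a measure). 0)"
  proof (rule integral_dominated_convergence[where w="\<lambda>x. norm (f x) powr p"])
    show "AE x in lborel. (\<lambda>m. norm (f x - cut m x) powr p) \<longlonglongrightarrow> 0"
    proof (rule AE_I2)
      fix x
      obtain M where "norm (f x) \<le> real M" using real_arch_simple by blast
      then have "\<forall>m\<ge>M. norm (f x - cut m x) powr p = 0" by (auto simp: cut_def)
      then show "(\<lambda>m. norm (f x - cut m x) powr p) \<longlonglongrightarrow> 0"
        by (intro tendsto_eventually) (auto simp: eventually_sequentially)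
    qed
    show "AE x in lborel. norm (norm (f x - cut m x) powr p) \<le> norm (f x) powr p" for m
      by (rule AE_I2) (simp add: cut_def)
  qed (use fp in simp_all)
  then have "\<forall>\<^sub>F m in sequentially. (LINT x|lborel. norm (f x - cut m x) powr p) < e / (3 * c)"
    using e c by (intro order_tendstoD(2)) auto
  then obtain m where m: "(LINT x|lborel. norm (f x - cut m x) powr p) < e / (3 * c)"
    by (auto simp: eventually_sequentially)
  have ip: "integrable lborel (\<lambda>x. norm (f x - cut m x) powr p)"
    by (rule Bochner_Integration.integrable_bound[OF fp]) (auto simp: cut_def)
  have rest: "(\<integral>\<^sup>+x. ennreal (norm (f x - cut m x) powr p) \<partial>lborel) \<le> ennreal (e / (3 * c))"
    using m by (subst nn_integral_eq_integral[OF ip]) (auto intro: ennreal_leI)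
  have ic: "integrable lborel (cut m)"
    by (rule Bochner_Integration.integrable_bound[OF f]) (auto simp: cut_def)
  \<comment> \<open>The increments of \<open>cut m\<close> are at most \<open>2 m\<close>; the summand \<open>1\<close> keeps \<open>B\<close> positive for \<open>m = 0\<close>.\<close>
  define B where "B = (2 * real m + 1) powr (p - 1)"
  have B: "B > 0" by (simp add: B_def)
  have "e / (3 * c * B) > 0" using e c B by simp
  then obtain d where d: "d > 0"
    "\<And>k. norm k < d \<Longrightarrow> (\<integral>\<^sup>+x. ennreal (norm (cut m (x + k) - cut m x)) \<partial>lborel) \<le> ennreal (e / (3 * c * B))"
    using translation_continuous_L1[OF ic] by blast
  show ?thesis
  proof (rule that[OF d(1)])
    fix k :: 'a assume k: "norm k < d"
    let ?r = "\<lambda>x. ennreal (norm (f x - cut m x) powr p)"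
    have "(\<integral>\<^sup>+x. ennreal (norm (f (x + k) - f x) powr p) \<partial>lborel)
        \<le> (\<integral>\<^sup>+x. ennreal c * ((?r (x + k) + ?r x) + ennreal B * ennreal (norm (cut m (x + k) - cut m x))) \<partial>lborel)"
    proof (rule nn_integral_mono)
      fix x
      let ?a = "norm (f (x + k) - cut m (x + k))" and ?b = "norm (f x - cut m x)" and ?d = "norm (cut m (x + k) - cut m x)"
      have "norm (f (x + k) - f x) \<le> ?a + ?b + ?d"
        using norm_triangle3[of "f (x + k) - cut m (x + k)" "cut m x - f x" "cut m (x + k) - cut m x"]
        by (simp add: norm_minus_commute[of "cut m x" "f x"])
      then have "norm (f (x + k) - f x) powr p \<le> (?a + ?b + ?d) powr p"
        using p by (intro powr_mono2) auto
      also have "\<dots> \<le> c * (?a powr p + ?b powr p + ?d powr p)"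
        unfolding c_def by (rule powr_sum3_le[OF p]) auto
      also have "?d powr p \<le> B * ?d"
      proof (cases "?d = 0")
        case False
        have "norm (cut m y) \<le> real m" for y by (simp add: cut_def)
        then have "?d \<le> 2 * real m + 1"
          using norm_triangle_ineq4[of "cut m (x + k)" "cut m x"] by (smt (verit))
        then have "?d powr (p - 1) \<le> B"
          unfolding B_def using p by (intro powr_mono2) auto
        then have "?d powr (p - 1) * ?d powr 1 \<le> B * ?d"
          by (simp add: mult_right_mono)
        moreover have "?d powr (p - 1) * ?d powr 1 = ?d powr p"
          by (subst powr_add[symmetric]) simp
        ultimately show ?thesis by simp
      qed simp
      finally have "norm (f (x + k) - f x) powr p \<le> c * (?a powr p + ?b powr p + B * ?d)"
        using c by (simp add: mult_left_mono)
      then have "ennreal (norm (f (x + k) - f x) powr p) \<le> ennreal (c * (?a powr p + ?b powr p + B * ?d))"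
        by (rule ennreal_leI)
      also have "\<dots> = ennreal c * ((?r (x + k) + ?r x) + ennreal B * ennreal (norm (cut m (x + k) - cut m x)))"
        using c B by (simp add: ennreal_mult ennreal_plus)
      finally show "ennreal (norm (f (x + k) - f x) powr p)
        \<le> ennreal c * ((?r (x + k) + ?r x) + ennreal B * ennreal (norm (cut m (x + k) - cut m x)))" .
    qed
    also have "\<dots> = ennreal c * (((\<integral>\<^sup>+x. ?r (x + k) \<partial>lborel) + (\<integral>\<^sup>+x. ?r x \<partial>lborel))
        + ennreal B * (\<integral>\<^sup>+x. ennreal (norm (cut m (x + k) - cut m x)) \<partial>lborel))"
    proof -
      have "(\<integral>\<^sup>+x. ennreal c * ((?r (x + k) + ?r x) + ennreal B * ennreal (norm (cut m (x + k) - cut m x))) \<partial>lborel)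
        = ennreal c * (\<integral>\<^sup>+x. (?r (x + k) + ?r x) + ennreal B * ennreal (norm (cut m (x + k) - cut m x)) \<partial>lborel)"
        by (rule nn_integral_cmult) measurable
      also have "(\<integral>\<^sup>+x. (?r (x + k) + ?r x) + ennreal B * ennreal (norm (cut m (x + k) - cut m x)) \<partial>lborel)
        = (\<integral>\<^sup>+x. ?r (x + k) + ?r x \<partial>lborel) + (\<integral>\<^sup>+x. ennreal B * ennreal (norm (cut m (x + k) - cut m x)) \<partial>lborel)"
        by (rule nn_integral_add) measurable
      also have "(\<integral>\<^sup>+x. ?r (x + k) + ?r x \<partial>lborel) = (\<integral>\<^sup>+x. ?r (x + k) \<partial>lborel) + (\<integral>\<^sup>+x. ?r x \<partial>lborel)"
        by (rule nn_integral_add) measurable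
      also have "(\<integral>\<^sup>+x. ennreal B * ennreal (norm (cut m (x + k) - cut m x)) \<partial>lborel)
        = ennreal B * (\<integral>\<^sup>+x. ennreal (norm (cut m (x + k) - cut m x)) \<partial>lborel)"
        by (rule nn_integral_cmult) measurable
      finally show ?thesis .
    qed
    also have "(\<integral>\<^sup>+x. ?r (x + k) \<partial>lborel) = (\<integral>\<^sup>+x. ?r x \<partial>lborel)"
      by (rule nn_integral_lborel_shift[of ?r]) measurable
    also have "ennreal c * (((\<integral>\<^sup>+x. ?r x \<partial>lborel) + (\<integral>\<^sup>+x. ?r x \<partial>lborel))
        + ennreal B * (\<integral>\<^sup>+x. ennreal (norm (cut m (x + k) - cut m x)) \<partial>lborel))
      \<le> ennreal c * ((ennreal (e / (3 * c)) + ennreal (e / (3 * c))) + ennreal B * ennreal (e / (3 * c * B)))"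
      using k by (intro mult_left_mono add_mono rest d) auto
    also have "\<dots> = ennreal (c * ((e / (3 * c) + e / (3 * c)) + B * (e / (3 * c * B))))"
      using e c B by (simp add: ennreal_mult[symmetric] ennreal_plus[symmetric] del: ennreal_plus)
    also have "c * ((e / (3 * c) + e / (3 * c)) + B * (e / (3 * c * B))) = e"
      using e c B by (simp add: field_simps)
    finally show "(\<integral>\<^sup>+x. ennreal (norm (f (x + k) - f x) powr p) \<partial>lborel) \<le> ennreal e" .
  qed
qed

section \<open>The boundary strip of a Lipschitz domain\<close>

lemma norm_remove_component:
  fixes k e :: "'a::real_inner"
  assumes "norm e = 1"
  shows "norm (k - (k \<bullet> e) *\<^sub>R e) \<le> norm k"
proof -
  have "e \<bullet> e = 1" using assms by (simp add: dot_square_norm)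
  then have "(k - (k \<bullet> e) *\<^sub>R e) \<bullet> (k - (k \<bullet> e) *\<^sub>R e) = k \<bullet> k - (k \<bullet> e)\<^sup>2"
    by (simp add: inner_diff_left inner_diff_right inner_commute power2_eq_square)
  also have "\<dots> \<le> k \<bullet> k" by simp
  finally show ?thesis by (simp add: norm_le)
qed

text \<open>The height \<open>H\<close> above the graph decides membership in \<open>\<Omega>\<close> within the chart. It grows by \<open>s\<close> under a move by
\<open>s e\<close>, and any move by \<open>k\<close> changes it by at most \<open>(L + 1) |k|\<close>. So after the ascent by \<open>(L + 1) |h|\<close> the move by
\<open>h\<close> cannot bring it to zero. The bound on the distance from \<open>z\<close> keeps all points inside the ball of the chart.\<close>

lemma chart_detour:
  fixes \<Omega> :: "(real^'n::finite) set"
  assumes e: "norm e = 1" and lip: "L-lipschitz_on {y. y \<bullet> e = 0} \<gamma>"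
    and chart: "\<Omega> \<inter> ball z r = {x \<in> ball z r. x \<bullet> e > \<gamma> (x - (x \<bullet> e) *\<^sub>R e)}"
    and x: "x \<in> \<Omega>" "x + h \<in> \<Omega>" and near: "dist x z + (L + 2) * norm h < r" and t: "0 \<le> t" "t \<le> 1"
  shows "x + t *\<^sub>R (((L + 1) * norm h) *\<^sub>R e) \<in> \<Omega>"
    and "x + h + t *\<^sub>R (((L + 1) * norm h) *\<^sub>R e) \<in> \<Omega>"
    and "x + ((L + 1) * norm h) *\<^sub>R e + t *\<^sub>R h \<in> \<Omega>"
proof -
  define H where "H y = y \<bullet> e - \<gamma> (y - (y \<bullet> e) *\<^sub>R e)" for y
  have ee: "e \<bullet> e = 1" using e by (simp add: dot_square_norm)
  have L: "0 \<le> L" using lip by (rule lipschitz_on_nonneg)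
  define c where "c = (L + 1) * norm h"
  have c: "0 \<le> c" using L by (simp add: c_def)
  have inside: "y \<in> \<Omega> \<longleftrightarrow> H y > 0" if "y \<in> ball z r" for y
    using chart that unfolding H_def by (auto simp: set_eq_iff)
  have up: "H (y + s *\<^sub>R e) = H y + s" for y s
    by (simp add: H_def inner_add_left ee algebra_simps)
  have Hlip: "H y - (L + 1) * norm k \<le> H (y + k)" for y k
  proof -
    let ?P = "\<lambda>y. y - (y \<bullet> e) *\<^sub>R e"
    have P: "?P y \<in> {y. y \<bullet> e = 0}" for y by (simp add: inner_diff_left ee)
    have "dist (\<gamma> (?P (y + k))) (\<gamma> (?P y)) \<le> L * dist (?P (y + k)) (?P y)"
      by (rule lipschitz_onD[OF lip P P])
    also have "dist (?P (y + k)) (?P y) = norm (?P k)"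
      by (simp add: dist_norm inner_add_left algebra_simps)
    also have "L * norm (?P k) \<le> L * norm k"
      using norm_remove_component[OF e] L by (intro mult_left_mono) auto
    finally have "\<gamma> (?P (y + k)) - \<gamma> (?P y) \<le> L * norm k"
      by (simp add: dist_real_def)
    moreover have "- norm k \<le> k \<bullet> e"
      using Cauchy_Schwarz_ineq2[of k e] e by (simp add: abs_le_iff)
    ultimately show ?thesis
      by (simp add: H_def inner_add_left algebra_simps)
  qed
  have ball: "x + y \<in> ball z r" if "norm y \<le> c + norm h" for y
  proof -
    have "dist (x + y) z \<le> dist x z + norm y"
      by (metis add.commute add_diff_cancel_left' dist_norm dist_triangle dist_commute)
    then show ?thesis
      using that near by (simp add: c_def algebra_simps dist_commute)
  qed
  have n1: "norm (t *\<^sub>R (c *\<^sub>R e)) \<le> c"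
    using e c t by (simp add: mult_left_le_one_le)
  have n2: "norm (t *\<^sub>R h) \<le> norm h"
    using t by (simp add: mult_left_le_one_le)
  have n3: "norm (c *\<^sub>R e) = c" using e c by simp
  have b1: "x + t *\<^sub>R (c *\<^sub>R e) \<in> ball z r"
    by (rule ball) (use n1 norm_ge_zero[of h] in linarith)
  have b2: "x + (h + t *\<^sub>R (c *\<^sub>R e)) \<in> ball z r"
    by (rule ball, rule order_trans[OF norm_triangle_ineq]) (use n1 in linarith)
  have b3: "x + (c *\<^sub>R e + t *\<^sub>R h) \<in> ball z r"
    by (rule ball, rule order_trans[OF norm_triangle_ineq]) (use n2 n3 in linarith)
  have b0: "x \<in> ball z r" "x + h \<in> ball z r"
    using ball[of 0] ball[of h] c by auto
  have Hx: "H x > 0" "H (x + h) > 0" using inside b0 x by auto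
  have "H (x + (t * c) *\<^sub>R e) > 0" unfolding up using Hx c t by (simp add: add_pos_nonneg)
  then show "x + t *\<^sub>R (((L + 1) * norm h) *\<^sub>R e) \<in> \<Omega>"
    using inside[OF b1] by (simp add: c_def)
  have "H (x + h + (t * c) *\<^sub>R e) > 0" unfolding up using Hx c t by (simp add: add_pos_nonneg)
  then show "x + h + t *\<^sub>R (((L + 1) * norm h) *\<^sub>R e) \<in> \<Omega>"
    using inside[OF b2] by (simp add: c_def add.assoc)
  have "H (x + c *\<^sub>R e) - (L + 1) * norm (t *\<^sub>R h) \<le> H (x + c *\<^sub>R e + t *\<^sub>R h)" by (rule Hlip)
  moreover have "(L + 1) * norm (t *\<^sub>R h) \<le> c"
    unfolding c_def using t L by (intro mult_left_mono) (auto simp: mult_left_le_one_le)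
  ultimately have "H (x + c *\<^sub>R e + t *\<^sub>R h) > 0" using Hx by (simp add: up)
  then show "x + ((L + 1) * norm h) *\<^sub>R e + t *\<^sub>R h \<in> \<Omega>"
    using inside[OF b3] by (simp add: c_def add.assoc)
qed

context sobolev_W1 begin

definition strip :: "real \<Rightarrow> (real^'n) set" where
  "strip \<delta> = \<Omega> \<inter> (\<Union>z\<in>frontier \<Omega>. ball z \<delta>)"

lemma strip_borel [measurable]: "strip \<delta> \<in> sets borel"
  unfolding strip_def using open_dom by (intro borel_open open_Int open_UN) auto

lemma dom_borel [measurable]: "\<Omega> \<in> sets borel"
  using open_dom by (rule borel_open)

lemma strip_subset: "strip \<delta> \<subseteq> \<Omega>"
  by (auto simp: strip_def)

lemma strip_mono: "\<delta> \<le> \<delta>' \<Longrightarrow> strip \<delta> \<subseteq> strip \<delta>'"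
  unfolding strip_def using subset_ball[of \<delta> \<delta>'] by blast

text \<open>A connected set that meets \<open>\<Omega>\<close> but not its frontier lies in \<open>\<Omega>\<close>.\<close>

lemma ball_inside_off_strip:
  assumes "x \<in> \<Omega>" "x \<notin> strip \<delta>"
  shows "ball x \<delta> \<subseteq> \<Omega>"
proof (rule ccontr)
  assume n: "\<not> ball x \<delta> \<subseteq> \<Omega>"
  then have "0 < \<delta>" by (metis ball_eq_empty empty_subsetI not_le)
  then have "x \<in> ball x \<delta> \<inter> \<Omega>" using assms(1) by simp
  then have "ball x \<delta> \<inter> \<Omega> \<noteq> {}" by blast
  then have "ball x \<delta> \<inter> frontier \<Omega> \<noteq> {}"
    using n by (intro connected_Int_frontier) auto
  then obtain z where "z \<in> frontier \<Omega>" "x \<in> ball z \<delta>" by (auto simp: dist_commute)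
  then show False using assms unfolding strip_def by blast
qed

lemma translate_dom_borel [measurable]: "{x. x + h \<in> \<Omega>} \<in> sets borel"
proof -
  have "(\<lambda>x. x + h) -` \<Omega> \<inter> space borel \<in> sets borel"
    by (rule measurable_sets[of _ borel borel]) measurable
  then show ?thesis by (simp add: vimage_def)
qed

definition "grad_mass S = (\<integral>\<^sup>+x\<in>S. ennreal (norm (g x) powr p) \<partial>lborel)"

lemma directional_mass_le:
  assumes [measurable]: "S \<in> sets borel" and "norm k \<le> c"
  shows "(\<integral>\<^sup>+x\<in>S. ennreal (\<bar>g x \<bullet> k\<bar> powr p) \<partial>lborel) \<le> ennreal (c powr p) * grad_mass S"
proof -
  have "(\<integral>\<^sup>+x\<in>S. ennreal (\<bar>g x \<bullet> k\<bar> powr p) \<partial>lborel)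
      \<le> (\<integral>\<^sup>+x. ennreal (c powr p) * (ennreal (norm (g x) powr p) * indicator S x) \<partial>lborel)"
  proof (rule nn_integral_mono)
    fix x
    have "\<bar>g x \<bullet> k\<bar> \<le> norm (g x) * norm k" by (rule Cauchy_Schwarz_ineq2)
    also have "\<dots> \<le> c * norm (g x)" using assms(2) by (simp add: mult.commute mult_right_mono)
    finally have "\<bar>g x \<bullet> k\<bar> powr p \<le> (c * norm (g x)) powr p"
      using p_ge_1 by (intro powr_mono2) auto
    also have "\<dots> = c powr p * norm (g x) powr p"
      by (rule powr_mult)
    finally show "ennreal (\<bar>g x \<bullet> k\<bar> powr p) * indicator S x
        \<le> ennreal (c powr p) * (ennreal (norm (g x) powr p) * indicator S x)"
      by (simp add: ennreal_mult[symmetric] ennreal_leI indicator_def)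
  qed
  also have "\<dots> = ennreal (c powr p) * grad_mass S"
    unfolding grad_mass_def by (rule nn_integral_cmult) measurable
  finally show ?thesis .
qed

text \<open>Split the increment into the three legs of the detour and apply \<open>increment_bound\<close> to each. The points visited lie
within \<open>(L + 2) |h| \<le> \<delta>\<close> of the strip of width \<open>\<delta>\<close>.\<close>

lemma chart_boundary_estimate:
  assumes e: "norm e = 1" and lip: "L-lipschitz_on {y. y \<bullet> e = 0} \<gamma>"
    and chart: "\<Omega> \<inter> ball z r = {x \<in> ball z r. x \<bullet> e > \<gamma> (x - (x \<bullet> e) *\<^sub>R e)}"
    and h: "(L + 2) * norm h \<le> \<delta>" "\<delta> < r / 2"
  shows "(\<integral>\<^sup>+x\<in>strip \<delta> \<inter> ball z (r / 2) \<inter> {x. x + h \<in> \<Omega>}. ennreal (\<bar>u (x + h) - u x\<bar> powr p) \<partial>lborel)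
      \<le> ennreal (3 powr p * 3 * ((L + 2) * norm h) powr p) * grad_mass (strip (2 * \<delta>))"
proof -
  define B where "B = strip \<delta> \<inter> ball z (r / 2) \<inter> {x. x + h \<in> \<Omega>}"
  have [measurable]: "B \<in> sets borel" unfolding B_def by measurable
  define c where "c = (L + 1) * norm h"
  define S where "S = strip (2 * \<delta>)"
  have [measurable]: "S \<in> sets borel" by (simp add: S_def)
  have L: "0 \<le> L" using lip by (rule lipschitz_on_nonneg)
  have c: "0 \<le> c" "c + norm h \<le> \<delta>" using L h by (auto simp: c_def algebra_simps)
  have stay: "y \<in> S" if xy: "x \<in> B" "y \<in> \<Omega>" "norm (y - x) \<le> c + norm h" for x y
  proof -
    obtain w where w: "w \<in> frontier \<Omega>" "x \<in> ball w \<delta>"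
      using xy(1) unfolding B_def strip_def by blast
    have "dist w y \<le> dist w x + norm (y - x)"
      by (metis dist_norm dist_triangle norm_minus_commute)
    then have "y \<in> ball w (2 * \<delta>)" using w xy(3) c by simp
    then show ?thesis using w xy by (auto simp: S_def strip_def)
  qed
  have x_in: "x \<in> \<Omega>" "x + h \<in> \<Omega>" "dist x z + (L + 2) * norm h < r" if "x \<in> B" for x
    using that h by (auto simp: B_def strip_def dist_commute)
  have nce: "norm (t *\<^sub>R (c *\<^sub>R e)) \<le> c" "norm (t *\<^sub>R h) \<le> norm h" if "0 \<le> t" "t \<le> 1" for t
    using that e c by (auto simp: mult_left_le_one_le)
  have p1: "x + t *\<^sub>R (c *\<^sub>R e) \<in> S" if x: "x \<in> B" and t: "0 \<le> t" "t \<le> 1" for x t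
  proof (rule stay[OF x])
    show "x + t *\<^sub>R (c *\<^sub>R e) \<in> \<Omega>"
      unfolding c_def by (rule chart_detour(1)[OF e lip chart x_in[OF x] t])
    show "norm (x + t *\<^sub>R (c *\<^sub>R e) - x) \<le> c + norm h"
      unfolding add_diff_cancel_left' using nce(1)[OF t] norm_ge_zero[of h] by linarith
  qed
  have p2: "x + c *\<^sub>R e + t *\<^sub>R h \<in> S" if x: "x \<in> B" and t: "0 \<le> t" "t \<le> 1" for x t
  proof (rule stay[OF x])
    show "x + c *\<^sub>R e + t *\<^sub>R h \<in> \<Omega>"
      unfolding c_def by (rule chart_detour(3)[OF e lip chart x_in[OF x] t])
    show "norm (x + c *\<^sub>R e + t *\<^sub>R h - x) \<le> c + norm h"
      using nce[OF t] norm_triangle_ineq[of "c *\<^sub>R e" "t *\<^sub>R h"] e c by simp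
  qed
  have p3: "x + h + t *\<^sub>R (c *\<^sub>R e) \<in> S" if x: "x \<in> B" and t: "0 \<le> t" "t \<le> 1" for x t
  proof (rule stay[OF x])
    show "x + h + t *\<^sub>R (c *\<^sub>R e) \<in> \<Omega>"
      unfolding c_def by (rule chart_detour(2)[OF e lip chart x_in[OF x] t])
    show "norm (x + h + t *\<^sub>R (c *\<^sub>R e) - x) \<le> c + norm h"
      using nce[OF t] norm_triangle_ineq[of h "t *\<^sub>R (c *\<^sub>R e)"] by simp
  qed
  define K where "K = ennreal (((L + 2) * norm h) powr p) * grad_mass S"
  have sub: "S \<subseteq> \<Omega>" unfolding S_def by (rule strip_subset)
  have "norm (c *\<^sub>R e) = c" using e c by simp
  moreover have "c \<le> (L + 2) * norm h" by (simp add: c_def algebra_simps)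
  ultimately have le1: "norm (c *\<^sub>R e) \<le> (L + 2) * norm h" by linarith
  have "1 * norm h \<le> (L + 2) * norm h" by (rule mult_right_mono) (use L in auto)
  then have le2: "norm h \<le> (L + 2) * norm h" by simp
  let ?f1 = "\<lambda>x. ennreal (\<bar>u (x + c *\<^sub>R e) - u x\<bar> powr p) * indicator B x"
  let ?f2 = "\<lambda>x. ennreal (\<bar>u (x + c *\<^sub>R e + h) - u (x + c *\<^sub>R e)\<bar> powr p) * indicator B x"
  let ?f3 = "\<lambda>x. ennreal (\<bar>u (x + h + c *\<^sub>R e) - u (x + h)\<bar> powr p) * indicator B x"
  have i1: "(\<integral>\<^sup>+x. ?f1 x \<partial>lborel) \<le> K"
    unfolding K_def by (rule order_trans[OF increment_bound_unshifted[OF _ _ sub p1] directional_mass_le[OF _ le1]]) auto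
  have i2: "(\<integral>\<^sup>+x. ?f2 x \<partial>lborel) \<le> K"
    unfolding K_def by (rule order_trans[OF increment_bound[OF _ _ sub p2] directional_mass_le[OF _ le2]]) auto
  have i3: "(\<integral>\<^sup>+x. ?f3 x \<partial>lborel) \<le> K"
    unfolding K_def by (rule order_trans[OF increment_bound[OF _ _ sub p3] directional_mass_le[OF _ le1]]) auto
  have "(\<integral>\<^sup>+x\<in>B. ennreal (\<bar>u (x + h) - u x\<bar> powr p) \<partial>lborel)
      \<le> (\<integral>\<^sup>+x. ennreal (3 powr p) * (?f1 x + ?f2 x + ?f3 x) \<partial>lborel)"
  proof (rule nn_integral_mono)
    fix x
    let ?a = "\<bar>u (x + c *\<^sub>R e) - u x\<bar>" and ?b = "\<bar>u (x + c *\<^sub>R e + h) - u (x + c *\<^sub>R e)\<bar>"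
      and ?d = "\<bar>u (x + h + c *\<^sub>R e) - u (x + h)\<bar>"
    have swap: "x + h + c *\<^sub>R e = x + c *\<^sub>R e + h" by simp
    have "\<bar>u (x + h) - u x\<bar> \<le> ?a + ?b + ?d" unfolding swap by linarith
    then have "\<bar>u (x + h) - u x\<bar> powr p \<le> (?a + ?b + ?d) powr p"
      using p_ge_1 by (intro powr_mono2) auto
    also have "\<dots> \<le> 3 powr p * (?a powr p + ?b powr p + ?d powr p)"
      by (rule powr_sum3_le[OF p_ge_1]) auto
    finally have "ennreal (\<bar>u (x + h) - u x\<bar> powr p) \<le> ennreal (3 powr p * (?a powr p + ?b powr p + ?d powr p))"
      by (rule ennreal_leI)
    also have "\<dots> = ennreal (3 powr p) * (ennreal (?a powr p) + ennreal (?b powr p) + ennreal (?d powr p))"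
      by (simp add: ennreal_mult ennreal_plus)
    finally show "ennreal (\<bar>u (x + h) - u x\<bar> powr p) * indicator B x \<le> ennreal (3 powr p) * (?f1 x + ?f2 x + ?f3 x)"
      by (cases "x \<in> B") auto
  qed
  also have "\<dots> = ennreal (3 powr p) * (\<integral>\<^sup>+x. ?f1 x + ?f2 x + ?f3 x \<partial>lborel)"
    by (rule nn_integral_cmult) measurable
  also have "(\<integral>\<^sup>+x. ?f1 x + ?f2 x + ?f3 x \<partial>lborel) = (\<integral>\<^sup>+x. ?f1 x + ?f2 x \<partial>lborel) + (\<integral>\<^sup>+x. ?f3 x \<partial>lborel)"
    by (rule nn_integral_add) measurable
  also have "(\<integral>\<^sup>+x. ?f1 x + ?f2 x \<partial>lborel) = (\<integral>\<^sup>+x. ?f1 x \<partial>lborel) + (\<integral>\<^sup>+x. ?f2 x \<partial>lborel)"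
    by (rule nn_integral_add) measurable
  also have "ennreal (3 powr p) * ((\<integral>\<^sup>+x. ?f1 x \<partial>lborel) + (\<integral>\<^sup>+x. ?f2 x \<partial>lborel) + (\<integral>\<^sup>+x. ?f3 x \<partial>lborel))
      \<le> ennreal (3 powr p) * (K + K + K)"
    by (intro mult_left_mono add_mono i1 i2 i3) auto
  also have "\<dots> = ennreal (3 powr p * 3 * ((L + 2) * norm h) powr p) * grad_mass S"
  proof -
    have "K + K + K = ennreal 3 * K"
      by (metis (no_types, lifting) ennreal_numeral distrib_right mult_1 one_add_one numeral_Bit1 numeral_One zero_le_numeral)
    then show ?thesis by (simp add: K_def ennreal_mult mult.assoc)
  qed
  finally show ?thesis by (simp add: B_def S_def)
qed

text \<open>The frontier is compact, so finitely many charts suffice, and for small \<open>\<delta>\<close> they cover the strip.\<close>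

lemma boundary_estimate:
  assumes "lipschitz_boundary \<Omega>"
  obtains \<delta>0 \<kappa> C where "0 < \<delta>0" "1 \<le> \<kappa>" "0 \<le> C"
    "\<And>\<delta> h. \<delta> \<le> \<delta>0 \<Longrightarrow> \<kappa> * norm h \<le> \<delta> \<Longrightarrow>
      (\<integral>\<^sup>+x\<in>strip \<delta> \<inter> {x. x + h \<in> \<Omega>}. ennreal (\<bar>u (x + h) - u x\<bar> powr p) \<partial>lborel)
        \<le> ennreal (C * norm h powr p) * grad_mass (strip (2 * \<delta>))"
proof -
  \<comment> \<open>The estimate near one boundary point; a radius and a constant for each point are then chosen together.\<close>
  define P where "P z \<rho> \<kappa> \<longleftrightarrow> 0 < \<rho> \<and> 0 \<le> \<kappa> \<and> (\<forall>\<delta> h. \<delta> < \<rho> \<longrightarrow> \<kappa> * norm h \<le> \<delta> \<longrightarrow>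
      (\<integral>\<^sup>+x\<in>strip \<delta> \<inter> ball z \<rho> \<inter> {x. x + h \<in> \<Omega>}. ennreal (\<bar>u (x + h) - u x\<bar> powr p) \<partial>lborel)
        \<le> ennreal (3 powr p * 3 * (\<kappa> * norm h) powr p) * grad_mass (strip (2 * \<delta>)))" for z \<rho> \<kappa>
  have "\<exists>q. P z (fst q) (snd q)" if z: "z \<in> frontier \<Omega>" for z
  proof -
    obtain r e \<gamma> L where r: "r > 0" and c: "norm e = 1" "L-lipschitz_on {y. y \<bullet> e = 0} \<gamma>"
        "\<Omega> \<inter> ball z r = {x \<in> ball z r. x \<bullet> e > \<gamma> (x - (x \<bullet> e) *\<^sub>R e)}"
      using assms z unfolding lipschitz_boundary_def by blast
    have "0 \<le> L" using c(2) by (rule lipschitz_on_nonneg)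
    then have "P z (r / 2) (L + 2)"
      unfolding P_def using r chart_boundary_estimate[OF c] by auto
    then show ?thesis by (intro exI[of _ "(r / 2, L + 2)"]) simp
  qed
  then obtain q where q: "\<And>z. z \<in> frontier \<Omega> \<Longrightarrow> P z (fst (q z)) (snd (q z))"
    using bchoice[of "frontier \<Omega>" "\<lambda>z q. P z (fst q) (snd q)"] by blast
  define \<rho> where "\<rho> z = fst (q z)" for z
  define k where "k z = snd (q z)" for z
  have pos: "0 < \<rho> z" "0 \<le> k z" if "z \<in> frontier \<Omega>" for z
    using q[OF that] by (auto simp: P_def \<rho>_def k_def)
  have cpt: "compact (frontier \<Omega>)" by (rule compact_frontier_bounded[OF bounded_dom])
  obtain D where D: "D \<subseteq> frontier \<Omega>" "finite D" "frontier \<Omega> \<subseteq> (\<Union>z\<in>D. ball z (\<rho> z))"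
  proof (rule compactE_image[OF cpt, of "frontier \<Omega>" "\<lambda>z. ball z (\<rho> z)"])
    show "frontier \<Omega> \<subseteq> (\<Union>z\<in>frontier \<Omega>. ball z (\<rho> z))"
      using pos by force
  qed auto
  obtain \<epsilon> where \<epsilon>: "\<epsilon> > 0" "(\<Union>x\<in>frontier \<Omega>. ball x \<epsilon>) \<subseteq> (\<Union>z\<in>D. ball z (\<rho> z))"
    by (rule compact_subset_open_imp_ball_epsilon_subset[OF cpt _ D(3)]) (auto intro: that)
  define m where "m = Min (insert 1 (\<rho> ` D))"
  have m: "0 < m" "\<And>z. z \<in> D \<Longrightarrow> m \<le> \<rho> z"
    using D(1,2) pos by (auto simp: m_def)
  define \<delta>0 where "\<delta>0 = min \<epsilon> (m / 2)"
  define \<kappa> where "\<kappa> = 1 + (\<Sum>z\<in>D. k z)"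
  have \<kappa>: "k z \<le> \<kappa>" if "z \<in> D" for z
    using member_le_sum[of z D k] that D pos unfolding \<kappa>_def by (smt (verit) DiffE subset_iff)
  define C where "C = (\<Sum>z\<in>D. 3 powr p * 3 * k z powr p)"
  show ?thesis
  proof (rule that[of \<delta>0 \<kappa> C])
    show "0 < \<delta>0" using \<epsilon>(1) m(1) by (simp add: \<delta>0_def)
    show "1 \<le> \<kappa>" using D(1) pos by (auto simp: \<kappa>_def intro!: sum_nonneg)
    show "0 \<le> C" by (auto simp: C_def intro!: sum_nonneg)
    fix \<delta> and h :: "real^'n" assume \<delta>: "\<delta> \<le> \<delta>0" and h: "\<kappa> * norm h \<le> \<delta>"
    let ?f = "\<lambda>x. ennreal (\<bar>u (x + h) - u x\<bar> powr p)"
    let ?B = "\<lambda>z. strip \<delta> \<inter> ball z (\<rho> z) \<inter> {x. x + h \<in> \<Omega>}"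
    let ?G = "grad_mass (strip (2 * \<delta>))"
    have Bm: "?B z \<in> sets borel" for z
      by (intro sets.Int strip_borel translate_dom_borel borel_open open_ball)
    have "(\<integral>\<^sup>+x\<in>strip \<delta> \<inter> {x. x + h \<in> \<Omega>}. ?f x \<partial>lborel) \<le> (\<integral>\<^sup>+x. (\<Sum>z\<in>D. ?f x * indicator (?B z) x) \<partial>lborel)"
    proof (rule nn_integral_mono)
      fix x
      show "?f x * indicator (strip \<delta> \<inter> {x. x + h \<in> \<Omega>}) x \<le> (\<Sum>z\<in>D. ?f x * indicator (?B z) x)"
      proof (cases "x \<in> strip \<delta> \<inter> {x. x + h \<in> \<Omega>}")
        case True
        then obtain w where "w \<in> frontier \<Omega>" "x \<in> ball w \<delta>" unfolding strip_def by blast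
        then have "x \<in> (\<Union>x\<in>frontier \<Omega>. ball x \<epsilon>)" using \<delta> by (force simp: \<delta>0_def)
        then obtain z where z: "z \<in> D" "x \<in> ball z (\<rho> z)" using \<epsilon>(2) by blast
        have "?f x * indicator (strip \<delta> \<inter> {x. x + h \<in> \<Omega>}) x = ?f x * indicator (?B z) x"
          using True z by simp
        also have "\<dots> \<le> (\<Sum>z\<in>D. ?f x * indicator (?B z) x)"
          by (rule member_le_sum[OF z(1)]) (use D(2) in auto)
        finally show ?thesis .
      qed simp
    qed
    also have "\<dots> = (\<Sum>z\<in>D. \<integral>\<^sup>+x\<in>?B z. ?f x \<partial>lborel)"
      using Bm by (intro nn_integral_sum borel_measurable_times_ennreal borel_measurable_indicator) measurable
    also have "\<dots> \<le> (\<Sum>z\<in>D. ennreal (3 powr p * 3 * k z powr p * norm h powr p) * ?G)"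
    proof (rule sum_mono)
      fix z assume z: "z \<in> D"
      then have zf: "z \<in> frontier \<Omega>" using D(1) by blast
      have "\<delta> < \<rho> z" using \<delta> m(1) m(2)[OF z] by (simp add: \<delta>0_def)
      moreover have "k z * norm h \<le> \<delta>"
        using mult_right_mono[OF \<kappa>[OF z] norm_ge_zero[of h]] h by linarith
      ultimately have "(\<integral>\<^sup>+x\<in>?B z. ?f x \<partial>lborel) \<le> ennreal (3 powr p * 3 * (k z * norm h) powr p) * ?G"
        using q[OF zf] unfolding P_def \<rho>_def k_def by blast
      also have "3 powr p * 3 * (k z * norm h) powr p = 3 powr p * 3 * k z powr p * norm h powr p"
        using pos(2)[OF zf] by (simp add: powr_mult)
      finally show "(\<integral>\<^sup>+x\<in>?B z. ?f x \<partial>lborel) \<le> ennreal (3 powr p * 3 * k z powr p * norm h powr p) * ?G" .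
    qed
    also have "\<dots> = ennreal (C * norm h powr p) * ?G"
      unfolding C_def sum_distrib_right[symmetric] by (subst sum_ennreal) (auto simp: sum_distrib_right)
    finally show "(\<integral>\<^sup>+x\<in>strip \<delta> \<inter> {x. x + h \<in> \<Omega>}. ?f x \<partial>lborel) \<le> ennreal (C * norm h powr p) * ?G" .
  qed
qed

section \<open>Energy of increments and energy of the gradient\<close>

text \<open>No point of \<open>\<Omega>\<close> lies in all strips, because \<open>\<Omega>\<close> is disjoint from its frontier.\<close>

lemma strip_mass_small:
  assumes "0 < \<epsilon>"
  obtains \<delta>1 where "0 < \<delta>1" "\<And>\<delta>. \<delta> \<le> \<delta>1 \<Longrightarrow> grad_mass (strip \<delta>) \<le> ennreal \<epsilon>"
proof -
  define r where "r m = 1 / real (Suc m)" for m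
  have "(\<lambda>m. LINT x|lborel. norm (g x) powr p * indicator (strip (r m)) x) \<longlonglongrightarrow> (LINT x|(lborel :: (real^'n) measure). 0)"
  proof (rule integral_dominated_convergence[where w="\<lambda>x. norm (g x) powr p"])
    show "AE x in lborel. (\<lambda>m. norm (g x) powr p * indicator (strip (r m)) x) \<longlonglongrightarrow> 0"
    proof (rule AE_I2)
      fix x
      have "\<forall>\<^sub>F m in sequentially. x \<notin> strip (r m)"
      proof (cases "x \<in> \<Omega>")
        case True
        then have "x \<notin> frontier \<Omega>" using open_dom by (simp add: frontier_def interior_open)
        then have "open (- frontier \<Omega>)" "x \<in> - frontier \<Omega>" by auto
        then obtain d where d: "d > 0" "ball x d \<subseteq> - frontier \<Omega>"
          by (meson open_contains_ball)
        have "r \<longlonglongrightarrow> 0" unfolding r_def by (rule LIMSEQ_Suc[OF lim_1_over_n])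
        then have "\<forall>\<^sub>F m in sequentially. r m < d" using d(1) by (rule order_tendstoD)
        then show ?thesis
        proof eventually_elim
          case (elim m)
          show ?case
          proof
            assume "x \<in> strip (r m)"
            then obtain z where "z \<in> frontier \<Omega>" "x \<in> ball z (r m)" unfolding strip_def by blast
            then have "z \<in> ball x d" using elim by (simp add: dist_commute)
            then show False using d(2) \<open>z \<in> frontier \<Omega>\<close> by blast
          qed
        qed
      qed (simp add: strip_def)
      then have "\<forall>\<^sub>F m in sequentially. norm (g x) powr p * indicator (strip (r m)) x = 0"
        by eventually_elim simp
      then show "(\<lambda>m. norm (g x) powr p * indicator (strip (r m)) x) \<longlonglongrightarrow> 0"
        by (rule tendsto_eventually)
    qed
    show "AE x in lborel. norm (norm (g x) powr p * indicator (strip (r m)) x) \<le> norm (g x) powr p" for m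
      by (rule AE_I2) (simp add: indicator_def)
  qed (use g_Lp in simp_all)
  then have "\<forall>\<^sub>F m in sequentially. (LINT x|lborel. norm (g x) powr p * indicator (strip (r m)) x) < \<epsilon>"
    using assms by (intro order_tendstoD(2)) auto
  then obtain m where m: "(LINT x|lborel. norm (g x) powr p * indicator (strip (r m)) x) < \<epsilon>"
    by (auto simp: eventually_sequentially)
  have int: "integrable lborel (\<lambda>x. norm (g x) powr p * indicator (strip (r m)) x)"
    by (rule Bochner_Integration.integrable_bound[OF g_Lp]) (auto simp: indicator_def)
  have eq: "grad_mass (strip (r m)) = ennreal (LINT x|lborel. norm (g x) powr p * indicator (strip (r m)) x)"
    unfolding grad_mass_def
    by (subst nn_integral_eq_integral[OF int, symmetric])
      (auto intro!: nn_integral_cong simp: indicator_def)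
  show ?thesis
  proof (rule that[of "r m"])
    show "0 < r m" by (simp add: r_def)
    fix \<delta> assume "\<delta> \<le> r m"
    then have "grad_mass (strip \<delta>) \<le> grad_mass (strip (r m))"
      unfolding grad_mass_def using strip_mono[of \<delta> "r m"]
      by (intro nn_integral_mono) (auto simp: indicator_def)
    also have "\<dots> \<le> ennreal \<epsilon>" unfolding eq using m by (intro ennreal_leI) simp
    finally show "grad_mass (strip \<delta>) \<le> ennreal \<epsilon>" .
  qed
qed

definition diff_energy :: "real^'n \<Rightarrow> ennreal" where
  "diff_energy h = (\<integral>\<^sup>+x\<in>\<Omega> \<inter> {x. x + h \<in> \<Omega>}. ennreal (\<bar>u (x + h) - u x\<bar> powr p) \<partial>lborel)"

definition grad_energy :: "real^'n \<Rightarrow> ennreal" where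
  "grad_energy h = (\<integral>\<^sup>+x. ennreal (\<bar>g x \<bullet> h\<bar> powr p) \<partial>lborel)"

definition total_mass :: real where
  "total_mass = (LINT x|lborel. norm (g x) powr p)"

lemma total_mass: "0 \<le> total_mass" "grad_mass UNIV = ennreal total_mass"
  by (auto simp: total_mass_def grad_mass_def nn_integral_eq_integral[OF g_Lp])

lemma grad_energy_le: "grad_energy h \<le> ennreal (norm h powr p * total_mass)"
  using directional_mass_le[of UNIV h "norm h"]
  by (simp add: grad_energy_def total_mass ennreal_mult)

text \<open>Off the strip of width \<open>\<delta>\<close> all segments of length less than \<open>\<delta>\<close> stay in \<open>\<Omega>\<close>, and \<open>increment_bound\<close> gives the
bound with constant \<open>1\<close>. The strip contributes only an error term.\<close>

lemma diff_energy_le: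
  assumes "lipschitz_boundary \<Omega>" and "0 < \<epsilon>"
  obtains \<eta> where "0 < \<eta>"
    "\<And>h. norm h < \<eta> \<Longrightarrow> diff_energy h \<le> grad_energy h + ennreal (\<epsilon> * norm h powr p)"
proof -
  obtain \<delta>0 \<kappa> C where bd: "0 < \<delta>0" "1 \<le> \<kappa>" "0 \<le> C"
    "\<And>\<delta> h. \<delta> \<le> \<delta>0 \<Longrightarrow> \<kappa> * norm h \<le> \<delta> \<Longrightarrow>
      (\<integral>\<^sup>+x\<in>strip \<delta> \<inter> {x. x + h \<in> \<Omega>}. ennreal (\<bar>u (x + h) - u x\<bar> powr p) \<partial>lborel)
        \<le> ennreal (C * norm h powr p) * grad_mass (strip (2 * \<delta>))"
    by (rule boundary_estimate[OF assms(1)]) (rule that)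
  \<comment> \<open>The gradient mass of the strip must beat the constant \<open>C\<close>, which may be zero.\<close>
  have "0 < \<epsilon> / (C + 1)" using assms(2) bd(3) by simp
  then obtain \<delta>1 where \<delta>1: "0 < \<delta>1" "\<And>\<delta>. \<delta> \<le> \<delta>1 \<Longrightarrow> grad_mass (strip \<delta>) \<le> ennreal (\<epsilon> / (C + 1))"
    by (rule strip_mass_small) (rule that)
  define \<delta> where "\<delta> = min \<delta>0 (\<delta>1 / 2)"
  have \<delta>: "0 < \<delta>" "\<delta> \<le> \<delta>0" "2 * \<delta> \<le> \<delta>1" using bd(1) \<delta>1(1) by (auto simp: \<delta>_def)
  show ?thesis
  proof (rule that[of "\<delta> / \<kappa>"])
    show "0 < \<delta> / \<kappa>" using \<delta>(1) bd(2) by simp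
    fix h :: "real^'n" assume "norm h < \<delta> / \<kappa>"
    then have kh: "\<kappa> * norm h < \<delta>" using bd(2) by (simp add: field_simps)
    moreover have "norm h \<le> \<kappa> * norm h" using mult_right_mono[OF bd(2) norm_ge_zero[of h]] by simp
    ultimately have h: "norm h < \<delta>" by linarith
    let ?f = "\<lambda>x. ennreal (\<bar>u (x + h) - u x\<bar> powr p)"
    define A where "A = \<Omega> - strip \<delta>"
    define B where "B = strip \<delta> \<inter> {x. x + h \<in> \<Omega>}"
    have [measurable]: "A \<in> sets borel" "B \<in> sets borel"
      unfolding A_def B_def by (intro sets.Diff sets.Int strip_borel dom_borel translate_dom_borel)+
    have "diff_energy h \<le> (\<integral>\<^sup>+x. ?f x * indicator B x + ?f x * indicator A x \<partial>lborel)"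
      unfolding diff_energy_def by (intro nn_integral_mono) (auto simp: A_def B_def indicator_def)
    also have "\<dots> = (\<integral>\<^sup>+x\<in>B. ?f x \<partial>lborel) + (\<integral>\<^sup>+x\<in>A. ?f x \<partial>lborel)"
      by (rule nn_integral_add) measurable
    also have "\<dots> \<le> ennreal (\<epsilon> * norm h powr p) + grad_energy h"
    proof (rule add_mono)
      have "(\<integral>\<^sup>+x\<in>B. ?f x \<partial>lborel) \<le> ennreal (C * norm h powr p) * grad_mass (strip (2 * \<delta>))"
        unfolding B_def using kh by (intro bd(4) \<delta>) simp
      also have "\<dots> \<le> ennreal (C * norm h powr p) * ennreal (\<epsilon> / (C + 1))"
        by (intro mult_left_mono \<delta>1 \<delta>) auto
      also have "\<dots> = ennreal (C * norm h powr p * (\<epsilon> / (C + 1)))"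
        using bd(3) assms(2) by (intro ennreal_mult[symmetric]) auto
      also have "\<dots> \<le> ennreal (\<epsilon> * norm h powr p)"
      proof (rule ennreal_leI)
        have "C / (C + 1) \<le> 1" using bd(3) by simp
        then have "(C / (C + 1)) * (\<epsilon> * norm h powr p) \<le> 1 * (\<epsilon> * norm h powr p)"
          using assms(2) by (intro mult_right_mono) auto
        then show "C * norm h powr p * (\<epsilon> / (C + 1)) \<le> \<epsilon> * norm h powr p" by (simp add: mult_ac)
      qed
      finally show "(\<integral>\<^sup>+x\<in>B. ?f x \<partial>lborel) \<le> ennreal (\<epsilon> * norm h powr p)" .
      have "(\<integral>\<^sup>+x\<in>A. ?f x \<partial>lborel) \<le> (\<integral>\<^sup>+x\<in>\<Omega>. ennreal (\<bar>g x \<bullet> h\<bar> powr p) \<partial>lborel)"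
      proof (rule increment_bound_unshifted)
        fix x and t :: real assume x: "x \<in> A" and t: "0 \<le> t" "t \<le> 1"
        have "norm (t *\<^sub>R h) \<le> norm h" using t by (simp add: mult_left_le_one_le)
        then have "x + t *\<^sub>R h \<in> ball x \<delta>" using h by (simp add: dist_norm)
        then show "x + t *\<^sub>R h \<in> \<Omega>" using ball_inside_off_strip[of x \<delta>] x unfolding A_def by blast
      qed auto
      also have "\<dots> \<le> grad_energy h"
        unfolding grad_energy_def by (intro nn_integral_mono) (auto simp: indicator_def)
      finally show "(\<integral>\<^sup>+x\<in>A. ?f x \<partial>lborel) \<le> grad_energy h" .
    qed
    finally show "diff_energy h \<le> grad_energy h + ennreal (\<epsilon> * norm h powr p)"
      by (simp add: add.commute)
  qed
qed

text \<open>Three errors of size \<open>\<epsilon> |h| powr p / 3\<close> occur: the mass of the gradient in a strip; the linearization error off the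
strip, which \<open>abs_powr_split\<close> multiplies by \<open>b\<close>; and the excess of the coefficient \<open>a\<close> over \<open>1\<close> in front of
\<open>diff_energy h\<close>, for which the crude bound \<open>diff_energy h \<le> J |h| powr p\<close> is used. The parameter \<open>s\<close> is
fixed first, then the width of the strip and the range of \<open>h\<close>.\<close>

lemma grad_energy_le_diff_energy:
  assumes lip: "lipschitz_boundary \<Omega>" and \<epsilon>: "0 < \<epsilon>"
  obtains \<eta> where "0 < \<eta>"
    "\<And>h. norm h < \<eta> \<Longrightarrow> grad_energy h \<le> diff_energy h + ennreal (\<epsilon> * norm h powr p)"
proof -
  define J where "J = total_mass + 1"
  have J: "1 \<le> J" using total_mass(1) by (simp add: J_def)
  obtain \<eta>1 where \<eta>1: "0 < \<eta>1"
    "\<And>h. norm h < \<eta>1 \<Longrightarrow> diff_energy h \<le> grad_energy h + ennreal (1 * norm h powr p)"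
    by (rule diff_energy_le[OF lip zero_less_one]) (rule that)
  have crude: "diff_energy h \<le> ennreal (J * norm h powr p)" if "norm h < \<eta>1" for h
  proof -
    have "diff_energy h \<le> ennreal (norm h powr p * total_mass) + ennreal (1 * norm h powr p)"
      by (rule order_trans[OF \<eta>1(2)[OF that] add_right_mono[OF grad_energy_le]])
    also have "\<dots> = ennreal (J * norm h powr p)"
      using total_mass(1) by (simp add: J_def ennreal_plus[symmetric] algebra_simps del: ennreal_plus)
    finally show ?thesis .
  qed
  have "((\<lambda>s. ((1 - s) powr (1 - p) - 1) * J) \<longlongrightarrow> ((1 - 0) powr (1 - p) - 1) * J) (at_right 0)"
    by (intro tendsto_intros) auto
  then have "\<forall>\<^sub>F s in at_right 0. ((1 - s) powr (1 - p) - 1) * J < \<epsilon> / 3"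
    using \<epsilon> by (intro order_tendstoD(2)) auto
  moreover have "\<forall>\<^sub>F s in at_right (0::real). 0 < s \<and> s < 1"
    unfolding eventually_at_right_field by (intro exI[of _ 1]) auto
  ultimately have "\<forall>\<^sub>F s in at_right 0. ((1 - s) powr (1 - p) - 1) * J < \<epsilon> / 3 \<and> 0 < s \<and> s < 1"
    by eventually_elim auto
  then obtain s where s: "((1 - s) powr (1 - p) - 1) * J < \<epsilon> / 3" "0 < s" "s < 1"
    using eventually_happens'[OF trivial_limit_at_right_real] by blast
  define a where "a = (1 - s) powr (1 - p)"
  have "(1 - s) powr 0 \<le> (1 - s) powr (1 - p)"
    using s p_ge_1 by (intro powr_mono') auto
  then have a: "1 \<le> a" "(a - 1) * J < \<epsilon> / 3" using s by (auto simp: a_def)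
  define b where "b = s powr (1 - p)"
  have b: "0 < b" using s by (simp add: b_def)
  obtain \<delta> where \<delta>: "0 < \<delta>" "grad_mass (strip \<delta>) \<le> ennreal (\<epsilon> / 3)"
    using strip_mass_small[of "\<epsilon> / 3"] \<epsilon> by (metis divide_pos_pos order_refl zero_less_numeral)
  have "0 < \<epsilon> / 3 / b" using \<epsilon> b by simp
  then obtain d where d: "0 < d"
    "\<And>k. norm k < d \<Longrightarrow> (\<integral>\<^sup>+x. ennreal (norm (g (x + k) - g x) powr p) \<partial>lborel) \<le> ennreal (\<epsilon> / 3 / b)"
    by (rule translation_continuous_Lp[OF g_L1 g_Lp p_ge_1]) (rule that)
  show ?thesis
  proof (rule that[of "min \<eta>1 (min \<delta> d)"])
    show "0 < min \<eta>1 (min \<delta> d)" using \<eta>1 \<delta> d by simp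
    fix h :: "real^'n" assume "norm h < min \<eta>1 (min \<delta> d)"
    then have h: "norm h < \<eta>1" "norm h < \<delta>" "norm h < d" by auto
    define A where "A = \<Omega> - strip \<delta>"
    have [measurable]: "A \<in> sets borel"
      unfolding A_def by (intro sets.Diff strip_borel dom_borel)
    define N where "N = norm h powr p"
    have N: "0 \<le> N" by (simp add: N_def)
    let ?G = "\<lambda>x. ennreal (\<bar>g x \<bullet> h\<bar> powr p)"
    let ?f = "\<lambda>x. ennreal (\<bar>u (x + h) - u x\<bar> powr p)"
    let ?e = "\<lambda>x. ennreal (\<bar>u (x + h) - u x - g x \<bullet> h\<bar> powr p)"
    have path: "x + t *\<^sub>R h \<in> \<Omega>" "norm (t *\<^sub>R h) < d" if x: "x \<in> A" and t: "0 \<le> t" "t \<le> 1" for x t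
    proof -
      have th: "norm (t *\<^sub>R h) \<le> norm h" using t by (simp add: mult_left_le_one_le)
      then show "norm (t *\<^sub>R h) < d" using h(3) by simp
      have "x + t *\<^sub>R h \<in> ball x \<delta>" using h th by (simp add: dist_norm)
      then show "x + t *\<^sub>R h \<in> \<Omega>" using ball_inside_off_strip[of x \<delta>] x unfolding A_def by blast
    qed
    have "grad_energy h \<le> (\<integral>\<^sup>+x. ?G x * indicator (strip \<delta>) x + ?G x * indicator A x \<partial>lborel)"
      unfolding grad_energy_def
    proof (rule nn_integral_mono)
      fix x
      show "?G x \<le> ?G x * indicator (strip \<delta>) x + ?G x * indicator A x"
        using g_outside[of x] p_ge_1 by (cases "x \<in> \<Omega>") (auto simp: A_def indicator_def)
    qed
    also have "\<dots> = (\<integral>\<^sup>+x\<in>strip \<delta>. ?G x \<partial>lborel) + (\<integral>\<^sup>+x\<in>A. ?G x \<partial>lborel)"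
      by (rule nn_integral_add) measurable
    also have "\<dots> \<le> ennreal (N * (\<epsilon> / 3)) + (ennreal a * diff_energy h + ennreal (N * (\<epsilon> / 3)))"
    proof (rule add_mono)
      have "(\<integral>\<^sup>+x\<in>strip \<delta>. ?G x \<partial>lborel) \<le> ennreal N * grad_mass (strip \<delta>)"
        unfolding N_def by (rule directional_mass_le) auto
      also have "\<dots> \<le> ennreal N * ennreal (\<epsilon> / 3)" by (intro mult_left_mono \<delta>) auto
      also have "\<dots> = ennreal (N * (\<epsilon> / 3))" using N \<epsilon> by (intro ennreal_mult[symmetric]) auto
      finally show "(\<integral>\<^sup>+x\<in>strip \<delta>. ?G x \<partial>lborel) \<le> ennreal (N * (\<epsilon> / 3))" .
      have "(\<integral>\<^sup>+x\<in>A. ?G x \<partial>lborel) \<le> (\<integral>\<^sup>+x. ennreal a * (?f x * indicator A x) + ennreal b * (?e x * indicator A x) \<partial>lborel)"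
      proof (rule nn_integral_mono)
        fix x
        have "\<bar>g x \<bullet> h\<bar> powr p \<le> a * \<bar>u (x + h) - u x\<bar> powr p + b * \<bar>u (x + h) - u x - g x \<bullet> h\<bar> powr p"
          unfolding a_def b_def by (rule abs_powr_split[OF p_ge_1 s(2,3)])
        then have "?G x \<le> ennreal (a * \<bar>u (x + h) - u x\<bar> powr p + b * \<bar>u (x + h) - u x - g x \<bullet> h\<bar> powr p)"
          by (rule ennreal_leI)
        also have "\<dots> = ennreal a * ?f x + ennreal b * ?e x"
          using a b by (simp add: ennreal_plus ennreal_mult)
        finally show "?G x * indicator A x \<le> ennreal a * (?f x * indicator A x) + ennreal b * (?e x * indicator A x)"
          by (simp add: indicator_def)
      qed
      also have "\<dots> = (\<integral>\<^sup>+x. ennreal a * (?f x * indicator A x) \<partial>lborel) + (\<integral>\<^sup>+x. ennreal b * (?e x * indicator A x) \<partial>lborel)"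
        by (rule nn_integral_add) measurable
      also have "(\<integral>\<^sup>+x. ennreal a * (?f x * indicator A x) \<partial>lborel) = ennreal a * (\<integral>\<^sup>+x\<in>A. ?f x \<partial>lborel)"
        by (rule nn_integral_cmult) measurable
      also have "(\<integral>\<^sup>+x. ennreal b * (?e x * indicator A x) \<partial>lborel) = ennreal b * (\<integral>\<^sup>+x\<in>A. ?e x \<partial>lborel)"
        by (rule nn_integral_cmult) measurable
      also have "ennreal a * (\<integral>\<^sup>+x\<in>A. ?f x \<partial>lborel) + ennreal b * (\<integral>\<^sup>+x\<in>A. ?e x \<partial>lborel)
          \<le> ennreal a * diff_energy h + ennreal b * (ennreal N * ennreal (\<epsilon> / 3 / b))"
      proof (intro add_mono mult_left_mono)
        have "x + h \<in> \<Omega>" if "x \<in> A" for x using path(1)[OF that, of 1] by simp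
        then show "(\<integral>\<^sup>+x\<in>A. ?f x \<partial>lborel) \<le> diff_energy h"
          unfolding diff_energy_def by (intro nn_integral_mono) (auto simp: A_def indicator_def)
        show "(\<integral>\<^sup>+x\<in>A. ?e x \<partial>lborel) \<le> ennreal N * ennreal (\<epsilon> / 3 / b)"
          unfolding N_def
        proof (rule linearization_bound)
          fix t :: real assume "0 \<le> t" "t \<le> 1"
          then have "norm (t *\<^sub>R h) \<le> norm h" by (simp add: mult_left_le_one_le)
          then show "(\<integral>\<^sup>+x. ennreal (norm (g (x + t *\<^sub>R h) - g x) powr p) \<partial>lborel) \<le> ennreal (\<epsilon> / 3 / b)"
            using h(3) by (intro d(2)) linarith
        qed (use path in auto)
      qed auto
      also have "ennreal b * (ennreal N * ennreal (\<epsilon> / 3 / b)) = ennreal (N * (\<epsilon> / 3))"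
      proof -
        have "ennreal b * (ennreal N * ennreal (\<epsilon> / 3 / b)) = ennreal (b * (N * (\<epsilon> / 3 / b)))"
          using b N \<epsilon> by (simp add: ennreal_mult[symmetric])
        also have "b * (N * (\<epsilon> / 3 / b)) = N * (\<epsilon> / 3)" using b by simp
        finally show ?thesis .
      qed
      finally show "(\<integral>\<^sup>+x\<in>A. ?G x \<partial>lborel) \<le> ennreal a * diff_energy h + ennreal (N * (\<epsilon> / 3))" .
    qed
    also have "ennreal a * diff_energy h \<le> diff_energy h + ennreal (N * (\<epsilon> / 3))"
    proof -
      have "ennreal a = 1 + ennreal (a - 1)"
        using a(1) by (metis diff_ge_0_iff_ge ennreal_1 ennreal_plus le_add_diff_inverse zero_le_one)
      then have "ennreal a * diff_energy h = diff_energy h + ennreal (a - 1) * diff_energy h"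
        by (simp add: distrib_right)
      also have "\<dots> \<le> diff_energy h + ennreal (a - 1) * ennreal (J * norm h powr p)"
        by (intro add_left_mono mult_left_mono crude h) auto
      also have "ennreal (a - 1) * ennreal (J * norm h powr p) = ennreal (((a - 1) * J) * N)"
        using a(1) J by (subst ennreal_mult[symmetric]) (auto simp: N_def mult.assoc)
      also have "\<dots> \<le> ennreal (N * (\<epsilon> / 3))"
        using mult_left_mono[OF less_imp_le[OF a(2)] N]
        by (intro ennreal_leI) (simp only: mult.commute[of "(a - 1) * J" N])
      finally show ?thesis by (simp add: add_left_mono)
    qed
    then have "ennreal (N * (\<epsilon> / 3)) + (ennreal a * diff_energy h + ennreal (N * (\<epsilon> / 3)))
        \<le> ennreal (N * (\<epsilon> / 3)) + ((diff_energy h + ennreal (N * (\<epsilon> / 3))) + ennreal (N * (\<epsilon> / 3)))"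
      by (intro add_left_mono add_right_mono)
    also have "\<dots> = diff_energy h + (ennreal (N * (\<epsilon> / 3)) + ennreal (N * (\<epsilon> / 3)) + ennreal (N * (\<epsilon> / 3)))"
      by (simp add: add_ac)
    also have "ennreal (N * (\<epsilon> / 3)) + ennreal (N * (\<epsilon> / 3)) + ennreal (N * (\<epsilon> / 3)) = ennreal (\<epsilon> * N)"
      using N \<epsilon> by (simp add: ennreal_plus[symmetric] mult.commute del: ennreal_plus)
    finally show "grad_energy h \<le> diff_energy h + ennreal (\<epsilon> * norm h powr p)"
      by (simp add: N_def)
  qed
qed

end

section \<open>Polar coordinates and rotations\<close>

lemma nn_integral_lborel_affine:
  fixes t :: "'a::euclidean_space" and f :: "'a \<Rightarrow> ennreal"
  assumes [measurable]: "f \<in> borel_measurable borel" and c: "c \<noteq> 0"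
  shows "(\<integral>\<^sup>+x. f x \<partial>lborel) = ennreal (\<bar>c\<bar> ^ DIM('a)) * (\<integral>\<^sup>+x. f (t + c *\<^sub>R x) \<partial>lborel)"
  by (subst lborel_affine[OF c, of t])
    (simp add: nn_integral_density nn_integral_distr nn_integral_cmult)

lemma ball_borel [measurable]: "ball (c::'a::euclidean_space) r \<in> sets borel"
  by simp

text \<open>The uniqueness argument for Haar measure. With the unit ball \<open>B\<close>, compute the integral of
\<open>\<phi> (f x) indicator B (y - f x)\<close> over \<open>x\<close> and \<open>y\<close> in two ways: integrating over \<open>y\<close> first yields
\<open>\<integral> \<phi> (f x) dx\<close> times the volume of \<open>B\<close>. Substituting \<open>f\<inverse> y - x\<close> for \<open>x\<close> exchanges the two factors, and
since \<open>f\<close> preserves \<open>B\<close> the result is \<open>\<integral> \<phi>\<close> times the same volume.\<close>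

lemma nn_integral_orthogonal:
  fixes f :: "'a::euclidean_space \<Rightarrow> 'a" and \<phi> :: "'a \<Rightarrow> ennreal"
  assumes f: "orthogonal_transformation f" and [measurable]: "\<phi> \<in> borel_measurable borel"
  shows "(\<integral>\<^sup>+x. \<phi> (f x) \<partial>lborel) = (\<integral>\<^sup>+x. \<phi> x \<partial>lborel)"
proof -
  have lin: "linear f" and nf: "\<And>x. norm (f x) = norm x"
    using f by (auto simp: orthogonal_transformation)
  have [measurable]: "f \<in> borel_measurable borel"
    using lin by (intro borel_measurable_continuous_onI linear_continuous_on linear_conv_bounded_linear[THEN iffD1])
  define B where "B = ball (0::'a) 1"
  have [measurable]: "B \<in> sets borel" by (simp add: B_def)
  define b where "b = emeasure lborel B"
  have b: "b \<noteq> 0" "b \<noteq> \<top>"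
    using emeasure_bounded_finite[of B] content_ball_pos[of 1 "0::'a"] 
    by (auto simp: b_def B_def measure_def zero_less_iff_neq_zero)
  have fB: "f x \<in> B \<longleftrightarrow> x \<in> B" for x using nf by (simp add: B_def)
  have "(\<integral>\<^sup>+x. \<phi> (f x) \<partial>lborel) * b = (\<integral>\<^sup>+x. \<integral>\<^sup>+y. \<phi> (f x) * indicator B (y - f x) \<partial>lborel \<partial>lborel)"
  proof -
    have "(\<integral>\<^sup>+y. \<phi> (f x) * indicator B (y - f x) \<partial>lborel) = \<phi> (f x) * b" for x
    proof -
      have "(\<integral>\<^sup>+y. \<phi> (f x) * indicator B (y - f x) \<partial>lborel) = \<phi> (f x) * (\<integral>\<^sup>+y. indicator B (y - f x) \<partial>lborel)"
        by (rule nn_integral_cmult) measurable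
      also have "(\<integral>\<^sup>+y. indicator B (y - f x) \<partial>lborel) = b"
        using nn_integral_lborel_shift[of "indicator B" "- f x"] by (simp add: b_def)
      finally show ?thesis .
    qed
    then show ?thesis by (simp add: nn_integral_multc)
  qed
  also have "\<dots> = (\<integral>\<^sup>+y. \<integral>\<^sup>+x. \<phi> (f x) * indicator B (y - f x) \<partial>lborel \<partial>lborel)"
    by (rule lborel_pair.Fubini'[symmetric]) measurable
  also have "\<dots> = (\<integral>\<^sup>+y. \<integral>\<^sup>+x. \<phi> (y - f x) * indicator B (f x) \<partial>lborel \<partial>lborel)"
  proof (rule nn_integral_cong)
    fix y
    obtain c where c: "f c = y"
      using orthogonal_transformation_surj[OF f] by (metis surj_def)
    have "f (c + (-1) *\<^sub>R x) = y - f x" for x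
      using c lin by (simp add: linear_diff)
    then show "(\<integral>\<^sup>+x. \<phi> (f x) * indicator B (y - f x) \<partial>lborel) = (\<integral>\<^sup>+x. \<phi> (y - f x) * indicator B (f x) \<partial>lborel)"
      using nn_integral_lborel_affine[of "\<lambda>x. \<phi> (f x) * indicator B (y - f x)" "-1" c] by simp
  qed
  also have "\<dots> = (\<integral>\<^sup>+x. \<integral>\<^sup>+y. \<phi> (y - f x) * indicator B (f x) \<partial>lborel \<partial>lborel)"
    by (rule lborel_pair.Fubini') measurable
  also have "\<dots> = (\<integral>\<^sup>+x. (\<integral>\<^sup>+y. \<phi> y \<partial>lborel) * indicator B x \<partial>lborel)"
  proof (rule nn_integral_cong)
    fix x
    have "(\<integral>\<^sup>+y. \<phi> (y - f x) * indicator B (f x) \<partial>lborel) = (\<integral>\<^sup>+y. \<phi> (y - f x) \<partial>lborel) * indicator B (f x)"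
      by (rule nn_integral_multc) measurable
    also have "(\<integral>\<^sup>+y. \<phi> (y - f x) \<partial>lborel) = (\<integral>\<^sup>+y. \<phi> y \<partial>lborel)"
      using nn_integral_lborel_shift[of \<phi> "- f x"] by simp
    finally show "(\<integral>\<^sup>+y. \<phi> (y - f x) * indicator B (f x) \<partial>lborel) = (\<integral>\<^sup>+y. \<phi> y \<partial>lborel) * indicator B x"
      by (simp add: fB indicator_def)
  qed
  also have "\<dots> = (\<integral>\<^sup>+x. \<phi> x \<partial>lborel) * b"
    unfolding b_def by (rule nn_integral_cmult_indicator) simp
  finally show ?thesis
    using b by (metis mult_divide_eq_ennreal)
qed

lemma homogeneous_ball:
  fixes W :: "'a::euclidean_space \<Rightarrow> ennreal"
  assumes [measurable]: "W \<in> borel_measurable borel" and hom: "\<And>c x. 0 < c \<Longrightarrow> W (c *\<^sub>R x) = W x" and "0 < r"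
  shows "(\<integral>\<^sup>+x\<in>ball 0 r. W x \<partial>lborel) = ennreal (r ^ DIM('a)) * (\<integral>\<^sup>+x\<in>ball 0 1. W x \<partial>lborel)"
proof -
  have "(\<integral>\<^sup>+x\<in>ball 0 r. W x \<partial>lborel)
      = ennreal (\<bar>r\<bar> ^ DIM('a)) * (\<integral>\<^sup>+x. W (0 + r *\<^sub>R x) * indicator (ball 0 r) (0 + r *\<^sub>R x) \<partial>lborel)"
  proof (rule nn_integral_lborel_affine)
    show "(\<lambda>x. W x * indicator (ball 0 r) x) \<in> borel_measurable borel" by measurable
  qed (use \<open>0 < r\<close> in simp)
  also have "(\<integral>\<^sup>+x. W (0 + r *\<^sub>R x) * indicator (ball 0 r) (0 + r *\<^sub>R x) \<partial>lborel) = (\<integral>\<^sup>+x\<in>ball 0 1. W x \<partial>lborel)"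
    using \<open>0 < r\<close> hom by (intro nn_integral_cong) (simp add: indicator_def)
  finally show ?thesis using \<open>0 < r\<close> by simp
qed

text \<open>Integration in polar coordinates for the density \<open>|x| powr (s - n)\<close>, by the layer-cake formula: for
\<open>0 < |x| < \<delta>\<close> the density is \<open>\<delta> powr (s - n)\<close> plus the integral of \<open>(n - s) t powr (s - n - 1)\<close> over
\<open>|x| < t \<le> \<delta>\<close>. Tonelli's theorem reduces the claim to the integrals of \<open>W\<close> over balls of radius \<open>t\<close>, which are
proportional to \<open>t ^ n\<close> by homogeneity.\<close>

lemma homogeneous_radial_integral:
  fixes W :: "'a::euclidean_space \<Rightarrow> ennreal" and s :: real
  assumes [measurable]: "W \<in> borel_measurable borel" and hom: "\<And>c x. 0 < c \<Longrightarrow> W (c *\<^sub>R x) = W x"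
    and \<delta>: "0 < \<delta>" and s: "0 < s" "s \<le> DIM('a)"
  shows "(\<integral>\<^sup>+x\<in>ball 0 \<delta>. W x * ennreal (norm x powr (s - DIM('a))) \<partial>lborel)
       = ennreal (DIM('a) / s * \<delta> powr s) * (\<integral>\<^sup>+x\<in>ball 0 1. W x \<partial>lborel)"
proof -
  define n where "n = real DIM('a)"
  have n: "0 < n" "s \<le> n" using s by (auto simp: n_def)
  define m where "m = (\<integral>\<^sup>+x\<in>ball 0 1. W x \<partial>lborel)"
  have hb: "(\<integral>\<^sup>+x\<in>ball 0 r. W x \<partial>lborel) = ennreal (r ^ DIM('a)) * m" if "0 < r" for r
    unfolding m_def by (rule homogeneous_ball[OF assms(1) hom that])
  define f where "f t = (n - s) * t powr (s - n - 1)" for t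
  have [measurable]: "f \<in> borel_measurable borel" unfolding f_def by measurable
  have f0: "0 \<le> f t" for t using n by (simp add: f_def)
  have layer: "ennreal (norm x powr (s - n))
      = ennreal (\<delta> powr (s - n)) + (\<integral>\<^sup>+t. ennreal (f t) * indicator {0<..\<delta>} t * indicator (ball 0 t) x \<partial>lborel)"
    if x: "x \<noteq> 0" "x \<in> ball 0 \<delta>" for x :: 'a
  proof -
    have nx: "0 < norm x" "norm x < \<delta>" using x by auto
    have "(\<integral>\<^sup>+t. ennreal (f t) * indicator {0<..\<delta>} t * indicator (ball 0 t) x \<partial>lborel)
        = (\<integral>\<^sup>+t. ennreal (f t) * indicator {norm x..\<delta>} t \<partial>lborel)"
    proof (rule nn_integral_cong_AE)
      have "AE t in lborel. t \<noteq> norm x" by (rule AE_lborel_singleton)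
      then show "AE t in lborel. ennreal (f t) * indicator {0<..\<delta>} t * indicator (ball 0 t) x
          = ennreal (f t) * indicator {norm x..\<delta>} t"
      proof eventually_elim
        case (elim t)
        show ?case
        proof (cases "norm x \<le> t")
          case True
          then have "0 < t" using nx(1) by (rule less_le_trans[rotated])
          then have a: "t \<in> {0<..\<delta>} \<longleftrightarrow> t \<in> {norm x..\<delta>}"
            unfolding greaterThanAtMost_iff atLeastAtMost_iff using True by blast
          have b: "x \<in> ball 0 t" using True elim by simp
          show ?thesis unfolding indicator_def using b by (simp only: a) simp
        qed (use elim in \<open>simp add: indicator_def\<close>)
      qed
    qed
    also have "\<dots> = ennreal (- (\<delta> powr (s - n)) - (- (norm x powr (s - n))))"
    proof (rule nn_integral_FTC_Icc)
      fix t assume t: "t \<in> {norm x..\<delta>}"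
      then have "norm x \<le> t" by simp
      with nx(1) have "0 < t" by (rule less_le_trans)
      then show "((\<lambda>t. - (t powr (s - n))) has_real_derivative f t) (at t)"
        using DERIV_minus[OF has_real_derivative_powr[of t "s - n"]]
        by (simp only: f_def minus_mult_left minus_diff_eq)
    qed (use f0 nx in auto)
    finally have "(\<integral>\<^sup>+t. ennreal (f t) * indicator {0<..\<delta>} t * indicator (ball 0 t) x \<partial>lborel)
        = ennreal (norm x powr (s - n) - \<delta> powr (s - n))" by simp
    moreover have "\<delta> powr (s - n) \<le> norm x powr (s - n)"
      using nx n by (intro powr_mono2') auto
    ultimately show ?thesis by (simp add: ennreal_plus[symmetric] del: ennreal_plus)
  qed
  have "(\<integral>\<^sup>+x\<in>ball 0 \<delta>. W x * ennreal (norm x powr (s - n)) \<partial>lborel)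
      = (\<integral>\<^sup>+x. ennreal (\<delta> powr (s - n)) * (W x * indicator (ball 0 \<delta>) x)
          + (\<integral>\<^sup>+t. ennreal (f t) * indicator {0<..\<delta>} t * (W x * indicator (ball 0 t) x) \<partial>lborel) \<partial>lborel)"
  proof (rule nn_integral_cong_AE)
    have "AE x in lborel. x \<noteq> (0::'a)" by (rule AE_lborel_singleton)
    then show "AE x in lborel. W x * ennreal (norm x powr (s - n)) * indicator (ball 0 \<delta>) x
      = ennreal (\<delta> powr (s - n)) * (W x * indicator (ball 0 \<delta>) x)
          + (\<integral>\<^sup>+t. ennreal (f t) * indicator {0<..\<delta>} t * (W x * indicator (ball 0 t) x) \<partial>lborel)"
    proof eventually_elim
      case (elim x)
      have pull: "(\<integral>\<^sup>+t. ennreal (f t) * indicator {0<..\<delta>} t * (W x * indicator (ball 0 t) x) \<partial>lborel)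
          = W x * (\<integral>\<^sup>+t. ennreal (f t) * indicator {0<..\<delta>} t * indicator (ball 0 t) x \<partial>lborel)"
      proof -
        have "(\<lambda>t. indicator (ball 0 t) x :: ennreal) = (\<lambda>t. indicator {norm x<..} t)"
          by (auto simp: fun_eq_iff indicator_def)
        then have [measurable]: "(\<lambda>t. indicator (ball 0 t) x :: ennreal) \<in> borel_measurable borel" by simp
        show ?thesis by (subst nn_integral_cmult[symmetric]) (auto simp: mult_ac)
      qed
      show ?case
      proof (cases "x \<in> ball 0 \<delta>")
        case True
        then show ?thesis unfolding pull using layer[OF elim True] by (simp add: distrib_left mult.commute)
      next
        case False
        then have "indicator {0<..\<delta>} t * indicator (ball 0 t) x = (0::ennreal)" for t
          by (auto simp: indicator_def)
        then have "ennreal (f t) * indicator {0<..\<delta>} t * (W x * indicator (ball 0 t) x) = 0" for t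
          by (metis mult.assoc mult.commute mult_zero_left)
        then have "(\<integral>\<^sup>+t. ennreal (f t) * indicator {0<..\<delta>} t * (W x * indicator (ball 0 t) x) \<partial>lborel) = (\<integral>\<^sup>+t. 0 \<partial>(lborel :: real measure))"
          by (intro nn_integral_cong)
        with False show ?thesis by (simp only:) simp
      qed
    qed
  qed
  also have "\<dots> = (\<integral>\<^sup>+x. ennreal (\<delta> powr (s - n)) * (W x * indicator (ball 0 \<delta>) x) \<partial>lborel)
      + (\<integral>\<^sup>+x. \<integral>\<^sup>+t. ennreal (f t) * indicator {0<..\<delta>} t * (W x * indicator {y. norm (fst y) < snd y} (x, t)) \<partial>lborel \<partial>lborel)"
    by (subst nn_integral_add[symmetric]) (simp_all add: indicator_def)
  also have "(\<integral>\<^sup>+x. ennreal (\<delta> powr (s - n)) * (W x * indicator (ball 0 \<delta>) x) \<partial>lborel)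
      = ennreal (\<delta> powr (s - n)) * (ennreal (\<delta> ^ DIM('a)) * m)"
    unfolding hb[OF \<delta>, symmetric] by (rule nn_integral_cmult) measurable
  also have "(\<integral>\<^sup>+x. \<integral>\<^sup>+t. ennreal (f t) * indicator {0<..\<delta>} t * (W x * indicator {y. norm (fst y) < snd y} (x, t)) \<partial>lborel \<partial>lborel)
      = (\<integral>\<^sup>+t. \<integral>\<^sup>+x. ennreal (f t) * indicator {0<..\<delta>} t * (W x * indicator {y. norm (fst y) < snd y} (x, t)) \<partial>lborel \<partial>lborel)"
    by (rule lborel_pair.Fubini'[symmetric]) measurable
  also have "\<dots> = (\<integral>\<^sup>+t. ennreal ((n - s) * (t powr (s - 1) * indicator {0..\<delta>} t)) * m \<partial>lborel)"
  proof (rule nn_integral_cong)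
    fix t :: real
    show "(\<integral>\<^sup>+x. ennreal (f t) * indicator {0<..\<delta>} t * (W x * indicator {y. norm (fst y) < snd y} (x, t)) \<partial>lborel)
        = ennreal ((n - s) * (t powr (s - 1) * indicator {0..\<delta>} t)) * m"
    proof (cases "0 < t \<and> t \<le> \<delta>")
      case True
      have "(\<integral>\<^sup>+x. ennreal (f t) * indicator {0<..\<delta>} t * (W x * indicator {y. norm (fst y) < snd y} (x, t)) \<partial>lborel)
          = (\<integral>\<^sup>+x. ennreal (f t) * (W x * indicator (ball 0 t) x) \<partial>lborel)"
        using True by (intro nn_integral_cong) (simp add: indicator_def)
      also have "\<dots> = ennreal (f t) * (ennreal (t ^ DIM('a)) * m)"
        unfolding hb[OF conjunct1[OF True], symmetric] by (rule nn_integral_cmult) measurable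
      also have "\<dots> = ennreal (f t * t ^ DIM('a)) * m"
        using f0 True by (simp add: ennreal_mult mult.assoc)
      also have "f t * t ^ DIM('a) = (n - s) * (t powr (s - 1) * indicator {0..\<delta>} t)"
      proof -
        have "t powr (s - n - 1) * t ^ DIM('a) = t powr (s - n - 1) * t powr n"
          using True by (simp add: n_def powr_realpow)
        also have "\<dots> = t powr (s - 1)" by (subst powr_add[symmetric]) simp
        finally show ?thesis using True by (simp add: f_def mult.assoc)
      qed
      finally show ?thesis .
    next
      case False
      then have "t \<le> 0 \<or> \<delta> < t" by auto
      then show ?thesis
      proof
        assume "t \<le> 0"
        then show ?thesis by (cases "t = 0") (auto simp: indicator_def)
      qed (auto simp: indicator_def)
    qed
  qed
  also have "\<dots> = (\<integral>\<^sup>+t. ennreal ((n - s) * (t powr (s - 1) * indicator {0..\<delta>} t)) \<partial>lborel) * m"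
    by (rule nn_integral_multc) measurable
  also have "(\<integral>\<^sup>+t. ennreal ((n - s) * (t powr (s - 1) * indicator {0..\<delta>} t)) \<partial>lborel) = ennreal ((n - s) * (\<delta> powr s / s))"
  proof (rule nn_integral_has_integral_lborel)
    show "0 \<le> (n - s) * (t powr (s - 1) * indicator {0..\<delta>} t)" for t using n by simp
    have "((\<lambda>t. t powr (s - 1)) has_integral (\<delta> powr (s - 1 + 1) / (s - 1 + 1))) {0..\<delta>}"
      using s \<delta> by (intro has_integral_powr_from_0) auto
    then have "((\<lambda>t. if t \<in> {0..\<delta>} then t powr (s - 1) else 0) has_integral (\<delta> powr s / s)) UNIV"
      by (subst has_integral_restrict_UNIV) simp
    then have "((\<lambda>t. t powr (s - 1) * indicator {0..\<delta>} t) has_integral (\<delta> powr s / s)) UNIV"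
      by (rule has_integral_eq[rotated]) (simp add: indicator_def)
    then show "((\<lambda>t. (n - s) * (t powr (s - 1) * indicator {0..\<delta>} t)) has_integral ((n - s) * (\<delta> powr s / s))) UNIV"
      by (rule has_integral_mult_right)
  qed measurable
  also have "ennreal (\<delta> powr (s - n)) * (ennreal (\<delta> ^ DIM('a)) * m) = ennreal (\<delta> powr s) * m"
  proof -
    have "\<delta> powr (s - n) * \<delta> ^ DIM('a) = \<delta> powr (s - n) * \<delta> powr n"
      using \<delta> by (simp add: n_def powr_realpow)
    also have "\<dots> = \<delta> powr s" by (subst powr_add[symmetric]) simp
    finally have "ennreal (\<delta> powr (s - n)) * ennreal (\<delta> ^ DIM('a)) = ennreal (\<delta> powr s)"
      using \<delta> by (subst ennreal_mult[symmetric]) auto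
    then show ?thesis by (simp only: mult.assoc[symmetric])
  qed
  also have "ennreal (\<delta> powr s) * m + ennreal ((n - s) * (\<delta> powr s / s)) * m = ennreal (n / s * \<delta> powr s) * m"
  proof -
    have "ennreal (\<delta> powr s) + ennreal ((n - s) * (\<delta> powr s / s)) = ennreal (\<delta> powr s + (n - s) * (\<delta> powr s / s))"
      using n s by (intro ennreal_plus[symmetric]) auto
    also have "\<delta> powr s + (n - s) * (\<delta> powr s / s) = n / s * \<delta> powr s"
      using s by (simp add: field_simps)
    finally show ?thesis by (simp add: distrib_right[symmetric])
  qed
  finally show ?thesis by (simp add: n_def m_def)
qed

text \<open>By definition of the surface measure this is \<open>K / n\<close>, expressed as an integral over the unit ball.\<close>

definition angular_mass :: "real \<Rightarrow> real^'n \<Rightarrow> ennreal" where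
  "angular_mass p \<nu> = (\<integral>\<^sup>+x\<in>ball 0 1. ennreal (\<bar>sgn x \<bullet> \<nu>\<bar> powr p) \<partial>lborel)"

lemma borel_measurable_sgn_vec [measurable]: "(sgn :: real^'n::finite \<Rightarrow> real^'n) \<in> borel_measurable borel"
  unfolding sgn_div_norm[abs_def] by measurable

lemma angular_mass_rotation:
  fixes \<nu> \<nu>' :: "real^'n::finite"
  assumes "norm \<nu> = 1" "norm \<nu>' = 1"
  shows "angular_mass p \<nu> = angular_mass p \<nu>'"
proof -
  obtain f where f: "orthogonal_transformation f" "f \<nu>' = \<nu>"
    by (rule orthogonal_transformation_exists_1[OF assms(2,1)]) (rule that)
  have nf: "norm (f x) = norm x" for x
    using f(1) by (simp add: orthogonal_transformation)
  have inn: "f x \<bullet> f y = x \<bullet> y" for x y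
    using f(1) by (simp add: orthogonal_transformation_def)
  have "angular_mass p \<nu> = (\<integral>\<^sup>+x. ennreal (\<bar>sgn (f x) \<bullet> \<nu>\<bar> powr p) * indicator (ball 0 1) (f x) \<partial>lborel)"
    unfolding angular_mass_def by (rule nn_integral_orthogonal[OF f(1), symmetric]) measurable
  also have "\<dots> = angular_mass p \<nu>'"
    unfolding angular_mass_def
    by (intro nn_integral_cong) (simp add: sgn_div_norm nf inn f(2)[symmetric] indicator_def)
  finally show ?thesis .
qed

lemma angular_mass_finite:
  fixes \<nu> :: "real^'n::finite"
  assumes "0 \<le> p" "norm \<nu> = 1"
  shows "angular_mass p \<nu> < \<infinity>"
proof -
  have "angular_mass p \<nu> \<le> (\<integral>\<^sup>+x. indicator (ball 0 1) x \<partial>(lborel :: (real^'n) measure))"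
    unfolding angular_mass_def
  proof (rule nn_integral_mono)
    fix x :: "real^'n"
    have "\<bar>sgn x \<bullet> \<nu>\<bar> \<le> norm (sgn x) * norm \<nu>" by (rule Cauchy_Schwarz_ineq2)
    also have "\<dots> \<le> 1" using assms(2) by (simp add: norm_sgn)
    finally have "\<bar>sgn x \<bullet> \<nu>\<bar> powr p \<le> 1 powr p" using assms(1) by (intro powr_mono2) auto
    then have "ennreal (\<bar>sgn x \<bullet> \<nu>\<bar> powr p) \<le> ennreal 1" by (intro ennreal_leI) simp
    then show "ennreal (\<bar>sgn x \<bullet> \<nu>\<bar> powr p) * indicator (ball 0 1) x \<le> indicator (ball 0 1) x"
      by (auto simp: indicator_def)
  qed
  also have "\<dots> = emeasure lborel (ball (0::real^'n) 1)" by simp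
  also have "\<dots> < \<infinity>" using emeasure_bounded_finite[OF bounded_ball] by simp
  finally show ?thesis .
qed

lemma K_const_eq_angular_mass:
  fixes \<nu> :: "real^'n::finite"
  assumes "0 \<le> p" "norm \<nu> = 1"
  shows "ennreal (K_const p \<nu>) = ennreal (real CARD('n)) * angular_mass p \<nu>" and "0 \<le> K_const p \<nu>"
proof -
  let ?B = "ball 0 1 - {0} :: (real^'n) set"
  let ?S = "restrict_space borel (sphere 0 1) :: (real^'n) measure"
  let ?D = "distr (restrict_space lborel ?B) ?S sgn"
  have sgn_m: "sgn \<in> restrict_space lborel ?B \<rightarrow>\<^sub>M ?S"
  proof (rule measurable_restrict_space2)
    show "sgn \<in> space (restrict_space lborel ?B) \<rightarrow> sphere 0 1"
      by (auto simp: space_restrict_space norm_sgn)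
    show "sgn \<in> borel_measurable (restrict_space lborel ?B)"
      by (rule measurable_restrict_space1) simp
  qed
  have w [measurable]: "(\<lambda>\<omega>. \<bar>\<omega> \<bullet> \<nu>\<bar> powr p) \<in> borel_measurable ?S"
    by (rule measurable_restrict_space1) measurable
  have wD: "(\<lambda>\<omega>. ennreal (\<bar>\<omega> \<bullet> \<nu>\<bar> powr p)) \<in> borel_measurable ?D"
    by (subst measurable_distr_eq1) measurable
  have "(\<integral>\<^sup>+\<omega>. ennreal (\<bar>\<omega> \<bullet> \<nu>\<bar> powr p) \<partial>sphere_measure) = of_nat CARD('n) * (\<integral>\<^sup>+\<omega>. ennreal (\<bar>\<omega> \<bullet> \<nu>\<bar> powr p) \<partial>?D)"
    unfolding sphere_measure_def by (rule nn_integral_scale_measure[OF wD])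
  also have "(\<integral>\<^sup>+\<omega>. ennreal (\<bar>\<omega> \<bullet> \<nu>\<bar> powr p) \<partial>?D) = (\<integral>\<^sup>+x. ennreal (\<bar>sgn x \<bullet> \<nu>\<bar> powr p) \<partial>restrict_space lborel ?B)"
    by (rule nn_integral_distr[OF sgn_m]) measurable
  also have "\<dots> = (\<integral>\<^sup>+x. ennreal (\<bar>sgn x \<bullet> \<nu>\<bar> powr p) * indicator ?B x \<partial>lborel)"
    by (rule nn_integral_restrict_space) simp
  also have "\<dots> = angular_mass p \<nu>"
    unfolding angular_mass_def
  proof (rule nn_integral_cong_AE)
    have "AE x in lborel. x \<noteq> (0::real^'n)" by (rule AE_lborel_singleton)
    then show "AE x in lborel. ennreal (\<bar>sgn x \<bullet> \<nu>\<bar> powr p) * indicator ?B x = ennreal (\<bar>sgn x \<bullet> \<nu>\<bar> powr p) * indicator (ball 0 1) x"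
      by eventually_elim (simp add: indicator_def)
  qed
  finally have eq: "(\<integral>\<^sup>+\<omega>. ennreal (\<bar>\<omega> \<bullet> \<nu>\<bar> powr p) \<partial>sphere_measure) = of_nat CARD('n) * angular_mass p \<nu>" .
  have m: "(\<lambda>\<omega>. \<bar>\<omega> \<bullet> \<nu>\<bar> powr p) \<in> borel_measurable sphere_measure"
    using w by (simp add: sphere_measure_def measurable_def space_scale_measure)
  have K: "K_const p \<nu> = enn2real (of_nat CARD('n) * angular_mass p \<nu>)"
    unfolding K_const_def eq[symmetric] by (rule integral_eq_nn_integral[OF m]) simp
  have "of_nat CARD('n) * angular_mass p \<nu> < \<top>"
    using angular_mass_finite[OF assms] by (simp add: ennreal_mult_less_top of_nat_less_top)
  then show "ennreal (K_const p \<nu>) = ennreal (real CARD('n)) * angular_mass p \<nu>"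
    unfolding K by (simp add: ennreal_of_nat_eq_real_of_nat)
  show "0 \<le> K_const p \<nu>" unfolding K by simp
qed

text \<open>Up to the factor \<open>|w| powr p\<close> the integrand is \<open>|h| powr (s - n)\<close> times a function of \<open>h / |h|\<close> alone. By rotation
invariance the direction of \<open>w\<close> does not influence the constant.\<close>

lemma directional_kernel_integral:
  fixes w \<nu> :: "real^'n::finite"
  assumes p: "1 \<le> p" and \<nu>: "norm \<nu> = 1" and \<eta>: "0 < \<eta>" and s: "0 < s" "s \<le> 1"
  shows "(\<integral>\<^sup>+h\<in>ball 0 \<eta>. ennreal (\<bar>w \<bullet> h\<bar> powr p) * ennreal (norm h powr (s - p - real CARD('n))) \<partial>lborel)
       = ennreal (K_const p \<nu> / s * \<eta> powr s * norm w powr p)"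
proof (cases "w = 0")
  case False
  define W where "W h = ennreal (\<bar>sgn h \<bullet> sgn w\<bar> powr p)" for h
  have [measurable]: "W \<in> borel_measurable borel" unfolding W_def by measurable
  have sw: "norm (sgn w) = 1" using False by (simp add: norm_sgn)
  have "1 \<le> real CARD('n)" by (simp add: Suc_leI)
  then have sn: "s \<le> real CARD('n)" using s by linarith
  have "(\<integral>\<^sup>+h\<in>ball 0 \<eta>. ennreal (\<bar>w \<bullet> h\<bar> powr p) * ennreal (norm h powr (s - p - real CARD('n))) \<partial>lborel)
      = (\<integral>\<^sup>+h. ennreal (norm w powr p) * (W h * ennreal (norm h powr (s - real CARD('n))) * indicator (ball 0 \<eta>) h) \<partial>lborel)"
  proof (rule nn_integral_cong)
    fix h :: "real^'n"
    have "\<bar>w \<bullet> h\<bar> powr p * norm h powr (s - p - real CARD('n))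
        = norm w powr p * (\<bar>sgn h \<bullet> sgn w\<bar> powr p * norm h powr (s - real CARD('n)))"
    proof (cases "h = 0")
      case False
      have "w \<bullet> h = norm w * norm h * (sgn h \<bullet> sgn w)"
        using False \<open>w \<noteq> 0\<close> by (simp add: sgn_div_norm inner_commute field_simps)
      then have "\<bar>w \<bullet> h\<bar> powr p = norm w powr p * norm h powr p * \<bar>sgn h \<bullet> sgn w\<bar> powr p"
        by (simp add: abs_mult powr_mult)
      moreover have "norm h powr p * norm h powr (s - p - real CARD('n)) = norm h powr (s - real CARD('n))"
        by (subst powr_add[symmetric]) simp
      ultimately show ?thesis by (simp add: mult_ac)
    qed simp
    then show "ennreal (\<bar>w \<bullet> h\<bar> powr p) * ennreal (norm h powr (s - p - real CARD('n))) * indicator (ball 0 \<eta>) h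
        = ennreal (norm w powr p) * (W h * ennreal (norm h powr (s - real CARD('n))) * indicator (ball 0 \<eta>) h)"
      unfolding W_def by (simp add: ennreal_mult[symmetric] mult.assoc[symmetric])
  qed
  also have "\<dots> = ennreal (norm w powr p) * (\<integral>\<^sup>+h\<in>ball 0 \<eta>. W h * ennreal (norm h powr (s - real CARD('n))) \<partial>lborel)"
    by (rule nn_integral_cmult) measurable
  also have "(\<integral>\<^sup>+h\<in>ball 0 \<eta>. W h * ennreal (norm h powr (s - real CARD('n))) \<partial>lborel)
      = ennreal (real CARD('n) / s * \<eta> powr s) * angular_mass p (sgn w)"
  proof -
    have "W (c *\<^sub>R h) = W h" if "0 < c" for c h using that by (simp add: W_def sgn_scaleR)
    from homogeneous_radial_integral[OF _ this \<eta> s(1)] sn show ?thesis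
      by (simp add: W_def angular_mass_def)
  qed
  also have "\<dots> = ennreal (\<eta> powr s / s) * (ennreal (real CARD('n)) * angular_mass p (sgn w))"
  proof -
    have "ennreal (real CARD('n) / s * \<eta> powr s) = ennreal (\<eta> powr s / s) * ennreal (real CARD('n))"
      using s by (subst ennreal_mult[symmetric]) (auto simp: mult.commute)
    then show ?thesis by (simp only: mult.assoc)
  qed
  also have "ennreal (real CARD('n)) * angular_mass p (sgn w) = ennreal (K_const p \<nu>)"
    using p by (simp add: K_const_eq_angular_mass[OF _ \<nu>] angular_mass_rotation[OF sw \<nu>])
  also have "ennreal (norm w powr p) * (ennreal (\<eta> powr s / s) * ennreal (K_const p \<nu>))
      = ennreal (K_const p \<nu> / s * \<eta> powr s * norm w powr p)"
    using s p K_const_eq_angular_mass(2)[OF _ \<nu>, of p] by (simp add: ennreal_mult[symmetric] mult_ac)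
  finally show ?thesis .
qed (use p in simp)

lemma plain_kernel_integral:
  assumes \<eta>: "0 < \<eta>" and s: "0 < s" "s \<le> 1"
  shows "(\<integral>\<^sup>+h\<in>ball (0::real^'n::finite) \<eta>. ennreal (norm h powr p) * ennreal (norm h powr (s - p - real CARD('n))) \<partial>lborel)
       = ennreal (real CARD('n) * measure lborel (ball (0::real^'n) 1) / s * \<eta> powr s)"
proof -
  have "1 \<le> real CARD('n)" by (simp add: Suc_leI)
  then have sn: "s \<le> real CARD('n)" using s by linarith
  have "(\<integral>\<^sup>+h\<in>ball (0::real^'n) \<eta>. ennreal (norm h powr p) * ennreal (norm h powr (s - p - real CARD('n))) \<partial>lborel)
      = (\<integral>\<^sup>+h\<in>ball (0::real^'n) \<eta>. 1 * ennreal (norm h powr (s - real DIM(real^'n))) \<partial>lborel)"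
    by (intro nn_integral_cong) (simp add: ennreal_mult[symmetric] powr_add[symmetric])
  also have "\<dots> = ennreal (real DIM(real^'n) / s * \<eta> powr s) * (\<integral>\<^sup>+x\<in>ball (0::real^'n) 1. 1 \<partial>lborel)"
    by (rule homogeneous_radial_integral[of "\<lambda>_::real^'n. 1"]) (use \<eta> s sn in auto)
  also have "(\<integral>\<^sup>+x\<in>ball (0::real^'n) 1. 1 \<partial>lborel) = ennreal (measure lborel (ball (0::real^'n) 1))"
    using emeasure_bounded_finite[OF bounded_ball, of "0::real^'n" 1] by (simp add: emeasure_eq_ennreal_measure)
  finally show ?thesis
    using s by (simp add: ennreal_mult[symmetric] mult_ac)
qed

section \<open>The limit for one Sobolev function\<close>

context sobolev_W1 begin

text \<open>In this form the integrand is jointly measurable in \<open>x\<close> and \<open>h\<close>.\<close>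

lemma diff_energy_alt:
  "diff_energy h = (\<integral>\<^sup>+x. ennreal (\<bar>u (x + h) - u x\<bar> powr p) * (indicator \<Omega> x * indicator \<Omega> (x + h)) \<partial>lborel)"
  unfolding diff_energy_def by (intro nn_integral_cong) (simp add: indicator_def)

lemma diff_energy_borel [measurable]: "diff_energy \<in> borel_measurable borel"
  unfolding diff_energy_alt[abs_def] by measurable

lemma grad_energy_borel [measurable]: "grad_energy \<in> borel_measurable borel"
  unfolding grad_energy_def[abs_def] by measurable

text \<open>The exponent \<open>s - p - n\<close> is \<open>- (n + p \<sigma>)\<close> for \<open>s = p (1 - \<sigma>)\<close>.\<close>

lemma near_grad_energy:
  fixes \<nu> :: "real^'n"
  assumes \<nu>: "norm \<nu> = 1" and \<eta>: "0 < \<eta>" and s: "0 < s" "s \<le> 1"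
  shows "(\<integral>\<^sup>+h\<in>ball 0 \<eta>. grad_energy h * ennreal (norm h powr (s - p - real CARD('n))) \<partial>lborel)
       = ennreal (K_const p \<nu> / s * \<eta> powr s * total_mass)"
proof -
  let ?k = "\<lambda>h::real^'n. ennreal (norm h powr (s - p - real CARD('n)))"
  have K: "0 \<le> K_const p \<nu>" using K_const_eq_angular_mass(2)[OF _ \<nu>, of p] p_ge_1 by simp
  have "(\<integral>\<^sup>+h\<in>ball 0 \<eta>. grad_energy h * ?k h \<partial>lborel)
      = (\<integral>\<^sup>+h. \<integral>\<^sup>+x. ennreal (\<bar>g x \<bullet> h\<bar> powr p) * ?k h * indicator (ball 0 \<eta>) h \<partial>lborel \<partial>lborel)"
  proof (rule nn_integral_cong)
    fix h :: "real^'n"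
    show "grad_energy h * ?k h * indicator (ball 0 \<eta>) h
        = (\<integral>\<^sup>+x. ennreal (\<bar>g x \<bullet> h\<bar> powr p) * ?k h * indicator (ball 0 \<eta>) h \<partial>lborel)"
      unfolding grad_energy_def mult.assoc by (rule nn_integral_multc[symmetric]) measurable
  qed
  also have "\<dots> = (\<integral>\<^sup>+x. \<integral>\<^sup>+h. ennreal (\<bar>g x \<bullet> h\<bar> powr p) * ?k h * indicator (ball 0 \<eta>) h \<partial>lborel \<partial>lborel)"
    by (rule lborel_pair.Fubini'[symmetric]) measurable
  also have "\<dots> = (\<integral>\<^sup>+x. ennreal (K_const p \<nu> / s * \<eta> powr s) * ennreal (norm (g x) powr p) \<partial>lborel)"
    unfolding directional_kernel_integral[OF p_ge_1 \<nu> \<eta> s]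
    using K s by (intro nn_integral_cong ennreal_mult) auto
  also have "\<dots> = ennreal (K_const p \<nu> / s * \<eta> powr s) * ennreal total_mass"
    unfolding total_mass(2)[symmetric] grad_mass_def by (subst nn_integral_cmult) auto
  also have "\<dots> = ennreal (K_const p \<nu> / s * \<eta> powr s * total_mass)"
    using K s total_mass(1) by (intro ennreal_mult[symmetric]) auto
  finally show ?thesis .
qed

lemma diff_energy_integrable: "(\<integral>\<^sup>+h. diff_energy h \<partial>lborel) < \<infinity>"
proof -
  let ?U = "\<lambda>x. ennreal (\<bar>u x\<bar> powr p)"
  have shift: "(\<integral>\<^sup>+h. f (x + h) \<partial>lborel) = (\<integral>\<^sup>+h. f h \<partial>lborel)"
    if "f \<in> borel_measurable borel" for f :: "real^'n \<Rightarrow> ennreal" and x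
    using nn_integral_lborel_shift[OF that, of x] by (simp add: add.commute)
  define U where "U = (\<integral>\<^sup>+x. ?U x \<partial>lborel)"
  define V where "V = emeasure lborel \<Omega>"
  have U: "U < \<infinity>" using u_Lp by (simp add: U_def integrable_iff_bounded)
  have V: "V < \<infinity>" using emeasure_bounded_finite[OF bounded_dom] by (simp add: V_def)
  have "(\<integral>\<^sup>+h. diff_energy h \<partial>lborel)
      \<le> (\<integral>\<^sup>+h. \<integral>\<^sup>+x. ennreal (3 powr p) * (indicator \<Omega> x * ?U (x + h) + ?U x * indicator \<Omega> (x + h)) \<partial>lborel \<partial>lborel)"
    unfolding diff_energy_alt
  proof (intro nn_integral_mono)
    fix h x
    have "\<bar>u (x + h) - u x\<bar> powr p \<le> (\<bar>u (x + h)\<bar> + \<bar>u x\<bar> + 0) powr p"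
      using p_ge_1 by (intro powr_mono2) auto
    also have "\<dots> \<le> 3 powr p * (\<bar>u (x + h)\<bar> powr p + \<bar>u x\<bar> powr p + 0 powr p)"
      by (rule powr_sum3_le[OF p_ge_1]) auto
    finally have "ennreal (\<bar>u (x + h) - u x\<bar> powr p) \<le> ennreal (3 powr p * (\<bar>u (x + h)\<bar> powr p + \<bar>u x\<bar> powr p))"
      by (intro ennreal_leI) simp
    also have "\<dots> = ennreal (3 powr p) * (?U (x + h) + ?U x)"
      by (simp add: ennreal_mult ennreal_plus)
    finally show "ennreal (\<bar>u (x + h) - u x\<bar> powr p) * (indicator \<Omega> x * indicator \<Omega> (x + h))
        \<le> ennreal (3 powr p) * (indicator \<Omega> x * ?U (x + h) + ?U x * indicator \<Omega> (x + h))"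
      by (cases "x \<in> \<Omega>"; cases "x + h \<in> \<Omega>") auto
  qed
  also have "\<dots> = (\<integral>\<^sup>+x. \<integral>\<^sup>+h. ennreal (3 powr p) * (indicator \<Omega> x * ?U (x + h) + ?U x * indicator \<Omega> (x + h)) \<partial>lborel \<partial>lborel)"
    by (rule lborel_pair.Fubini'[symmetric]) measurable
  also have "\<dots> = (\<integral>\<^sup>+x. ennreal (3 powr p) * (indicator \<Omega> x * U + ?U x * V) \<partial>lborel)"
  proof (rule nn_integral_cong)
    fix x
    have "(\<integral>\<^sup>+h. ennreal (3 powr p) * (indicator \<Omega> x * ?U (x + h) + ?U x * indicator \<Omega> (x + h)) \<partial>lborel)
        = ennreal (3 powr p) * (\<integral>\<^sup>+h. indicator \<Omega> x * ?U (x + h) + ?U x * indicator \<Omega> (x + h) \<partial>lborel)"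
      by (rule nn_integral_cmult) measurable
    also have "(\<integral>\<^sup>+h. indicator \<Omega> x * ?U (x + h) + ?U x * indicator \<Omega> (x + h) \<partial>lborel)
        = (\<integral>\<^sup>+h. indicator \<Omega> x * ?U (x + h) \<partial>lborel) + (\<integral>\<^sup>+h. ?U x * indicator \<Omega> (x + h) \<partial>lborel)"
      by (rule nn_integral_add) measurable
    also have "(\<integral>\<^sup>+h. indicator \<Omega> x * ?U (x + h) \<partial>lborel) = indicator \<Omega> x * (\<integral>\<^sup>+h. ?U (x + h) \<partial>lborel)"
      by (rule nn_integral_cmult) measurable
    also have "(\<integral>\<^sup>+h. ?U (x + h) \<partial>lborel) = U"
      unfolding U_def by (rule shift) measurable
    also have "(\<integral>\<^sup>+h. ?U x * indicator \<Omega> (x + h) \<partial>lborel) = ?U x * (\<integral>\<^sup>+h. indicator \<Omega> (x + h) \<partial>lborel)"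
      by (rule nn_integral_cmult) measurable
    also have "(\<integral>\<^sup>+h. indicator \<Omega> (x + h) \<partial>lborel) = (\<integral>\<^sup>+h. indicator \<Omega> h \<partial>(lborel :: (real^'n) measure))"
      by (rule shift) measurable
    also have "\<dots> = V" by (simp add: V_def)
    finally show "(\<integral>\<^sup>+h. ennreal (3 powr p) * (indicator \<Omega> x * ?U (x + h) + ?U x * indicator \<Omega> (x + h)) \<partial>lborel)
        = ennreal (3 powr p) * (indicator \<Omega> x * U + ?U x * V)" .
  qed
  also have "\<dots> = ennreal (3 powr p) * (\<integral>\<^sup>+x. indicator \<Omega> x * U + ?U x * V \<partial>lborel)"
    by (rule nn_integral_cmult) measurable
  also have "(\<integral>\<^sup>+x. indicator \<Omega> x * U + ?U x * V \<partial>lborel) = (\<integral>\<^sup>+x. indicator \<Omega> x * U \<partial>lborel) + (\<integral>\<^sup>+x. ?U x * V \<partial>lborel)"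
    by (rule nn_integral_add) measurable
  also have "(\<integral>\<^sup>+x. indicator \<Omega> x * U \<partial>lborel) = V * U"
    by (subst nn_integral_multc) (auto simp: V_def)
  also have "(\<integral>\<^sup>+x. ?U x * V \<partial>lborel) = U * V"
    by (subst nn_integral_multc) (auto simp: U_def)
  also have "ennreal (3 powr p) * (V * U + U * V) < \<infinity>"
    using U V by (simp add: ennreal_mult_less_top)
  finally show ?thesis .
qed

text \<open>The bound is uniform in \<open>s\<close>, hence in \<open>\<sigma>\<close>, so that the factor \<open>1 - \<sigma>\<close> eliminates it in the limit.\<close>

lemma far_diff_energy:
  assumes \<eta>: "0 < \<eta>"
  obtains D where "0 \<le> D" "\<And>s. 0 \<le> s \<Longrightarrow> s \<le> p \<Longrightarrow>
    (\<integral>\<^sup>+h\<in>- ball 0 \<eta>. diff_energy h * ennreal (norm h powr (s - p - real CARD('n))) \<partial>lborel) \<le> ennreal D"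
proof -
  define c where "c = 1 + \<eta> powr (- p - real CARD('n))"
  define E where "E = enn2real (\<integral>\<^sup>+h. diff_energy h \<partial>lborel)"
  have E: "(\<integral>\<^sup>+h. diff_energy h \<partial>lborel) = ennreal E"
    using diff_energy_integrable by (simp add: E_def)
  have c: "0 \<le> c" by (simp add: c_def)
  have bound: "norm h powr (s - p - real CARD('n)) \<le> c" if h: "\<eta> \<le> norm h" and s: "0 \<le> s" "s \<le> p" for h :: "real^'n" and s
  proof (cases "norm h \<le> 1")
    case True
    have "norm h powr (s - p - real CARD('n)) \<le> norm h powr (- p - real CARD('n))"
      using True h \<eta> s by (intro powr_mono') auto
    also have "\<dots> \<le> \<eta> powr (- p - real CARD('n))"
      using h \<eta> p_ge_1 by (intro powr_mono2') auto
    finally show ?thesis by (simp add: c_def)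
  next
    case False
    then have "norm h powr (s - p - real CARD('n)) \<le> norm h powr 0"
      using s by (intro powr_mono) auto
    also have "\<dots> \<le> c" using False by (simp add: c_def)
    finally show ?thesis .
  qed
  show ?thesis
  proof (rule that[of "E * c"])
    show "0 \<le> E * c" using c by (simp add: E_def)
    fix s assume s: "0 \<le> s" "s \<le> p"
    have "(\<integral>\<^sup>+h\<in>- ball 0 \<eta>. diff_energy h * ennreal (norm h powr (s - p - real CARD('n))) \<partial>lborel)
        \<le> (\<integral>\<^sup>+h. diff_energy h * ennreal c \<partial>lborel)"
    proof (rule nn_integral_mono)
      fix h :: "real^'n"
      show "diff_energy h * ennreal (norm h powr (s - p - real CARD('n))) * indicator (- ball 0 \<eta>) h \<le> diff_energy h * ennreal c"
      proof (cases "h \<in> ball 0 \<eta>")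
        case False
        then have "ennreal (norm h powr (s - p - real CARD('n))) \<le> ennreal c"
          using bound[of h s] s by (intro ennreal_leI) auto
        with False show ?thesis by (simp add: mult_left_mono)
      qed simp
    qed
    also have "\<dots> = ennreal E * ennreal c"
      unfolding E[symmetric] by (rule nn_integral_multc) measurable
    also have "\<dots> = ennreal (E * c)"
      using c by (intro ennreal_mult[symmetric]) (auto simp: E_def)
    finally show "(\<integral>\<^sup>+h\<in>- ball 0 \<eta>. diff_energy h * ennreal (norm h powr (s - p - real CARD('n))) \<partial>lborel) \<le> ennreal (E * c)" .
  qed
qed

text \<open>The \<open>p\<close>-th power of the Gagliardo semi-norm of order \<open>\<sigma>\<close>, after the substitution \<open>y = x + h\<close>; see
\<open>gagliardo_energy_double_integral\<close>.\<close>

definition gagliardo_energy :: "real \<Rightarrow> ennreal" where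
  "gagliardo_energy \<sigma> = (\<integral>\<^sup>+h. diff_energy h * ennreal (norm h powr (- (real CARD('n) + p * \<sigma>))) \<partial>lborel)"

lemma gagliardo_energy_bounds:
  fixes \<nu> :: "real^'n"
  assumes lip: "lipschitz_boundary \<Omega>" and \<nu>: "norm \<nu> = 1" and \<epsilon>: "0 < \<epsilon>"
  obtains \<eta> D where "0 < \<eta>" "0 \<le> D"
    "\<And>s. 0 < s \<Longrightarrow> s \<le> 1 \<Longrightarrow> gagliardo_energy (1 - s / p) \<le>
      ennreal (K_const p \<nu> / s * \<eta> powr s * total_mass + \<epsilon> * (real CARD('n) * measure lborel (ball (0::real^'n) 1) / s * \<eta> powr s) + D)"
    "\<And>s. 0 < s \<Longrightarrow> s \<le> 1 \<Longrightarrow> ennreal (K_const p \<nu> / s * \<eta> powr s * total_mass) \<le>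
      gagliardo_energy (1 - s / p) + ennreal (\<epsilon> * (real CARD('n) * measure lborel (ball (0::real^'n) 1) / s * \<eta> powr s))"
proof -
  obtain \<eta>1 where \<eta>1: "0 < \<eta>1" "\<And>h. norm h < \<eta>1 \<Longrightarrow> diff_energy h \<le> grad_energy h + ennreal (\<epsilon> * norm h powr p)"
    by (rule diff_energy_le[OF lip \<epsilon>]) (rule that)
  obtain \<eta>2 where \<eta>2: "0 < \<eta>2" "\<And>h. norm h < \<eta>2 \<Longrightarrow> grad_energy h \<le> diff_energy h + ennreal (\<epsilon> * norm h powr p)"
    by (rule grad_energy_le_diff_energy[OF lip \<epsilon>]) (rule that)
  define \<eta> where "\<eta> = min \<eta>1 \<eta>2"
  have \<eta>: "0 < \<eta>" using \<eta>1 \<eta>2 by (simp add: \<eta>_def)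
  obtain D where D: "0 \<le> D" "\<And>s. 0 \<le> s \<Longrightarrow> s \<le> p \<Longrightarrow>
    (\<integral>\<^sup>+h\<in>- ball 0 \<eta>. diff_energy h * ennreal (norm h powr (s - p - real CARD('n))) \<partial>lborel) \<le> ennreal D"
    by (rule far_diff_energy[OF \<eta>]) (rule that)
  let ?b = "measure lborel (ball (0::real^'n) 1)"
  have K: "0 \<le> K_const p \<nu>" using K_const_eq_angular_mass(2)[OF _ \<nu>, of p] p_ge_1 by simp
  show ?thesis
  proof (rule that[OF \<eta> D(1)])
    fix s :: real assume s: "0 < s" "s \<le> 1"
    define k where "k h = ennreal (norm h powr (s - p - real CARD('n)))" for h :: "real^'n"
    have [measurable]: "k \<in> borel_measurable borel" unfolding k_def by measurable
    have kern: "gagliardo_energy (1 - s / p) = (\<integral>\<^sup>+h. diff_energy h * k h \<partial>lborel)"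
    proof -
      have "- (real CARD('n) + p * (1 - s / p)) = s - p - real CARD('n)"
        using p_ge_1 by (simp add: field_simps)
      then show ?thesis by (simp add: gagliardo_energy_def k_def)
    qed
    have nb: "(\<integral>\<^sup>+h\<in>ball 0 \<eta>. grad_energy h * k h \<partial>lborel) = ennreal (K_const p \<nu> / s * \<eta> powr s * total_mass)"
      unfolding k_def by (rule near_grad_energy[OF \<nu> \<eta> s])
    have eb: "(\<integral>\<^sup>+h\<in>ball 0 \<eta>. ennreal (\<epsilon> * norm h powr p) * k h \<partial>lborel) = ennreal (\<epsilon> * (real CARD('n) * ?b / s * \<eta> powr s))"
    proof -
      have "(\<integral>\<^sup>+h\<in>ball 0 \<eta>. ennreal (\<epsilon> * norm h powr p) * k h \<partial>lborel)
          = (\<integral>\<^sup>+h. ennreal \<epsilon> * (ennreal (norm h powr p) * k h * indicator (ball 0 \<eta>) h) \<partial>lborel)"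
        using \<epsilon> by (intro nn_integral_cong) (simp add: ennreal_mult mult.assoc)
      also have "\<dots> = ennreal \<epsilon> * (\<integral>\<^sup>+h\<in>ball 0 \<eta>. ennreal (norm h powr p) * k h \<partial>lborel)"
        by (rule nn_integral_cmult) measurable
      also have "(\<integral>\<^sup>+h\<in>ball 0 \<eta>. ennreal (norm h powr p) * k h \<partial>lborel) = ennreal (real CARD('n) * ?b / s * \<eta> powr s)"
        unfolding k_def by (rule plain_kernel_integral[OF \<eta> s])
      also have "ennreal \<epsilon> * ennreal (real CARD('n) * ?b / s * \<eta> powr s) = ennreal (\<epsilon> * (real CARD('n) * ?b / s * \<eta> powr s))"
        using \<epsilon> s by (intro ennreal_mult[symmetric]) auto
      finally show ?thesis .
    qed
    have comb: "(\<integral>\<^sup>+h\<in>ball 0 \<eta>. (F h + ennreal (\<epsilon> * norm h powr p)) * k h \<partial>lborel)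
        = (\<integral>\<^sup>+h\<in>ball 0 \<eta>. F h * k h \<partial>lborel) + ennreal (\<epsilon> * (real CARD('n) * ?b / s * \<eta> powr s))"
      if [measurable]: "F \<in> borel_measurable borel" for F :: "real^'n \<Rightarrow> ennreal"
      unfolding eb[symmetric] distrib_right by (rule nn_integral_add) measurable
    have near: "(\<integral>\<^sup>+h\<in>ball 0 \<eta>. diff_energy h * k h \<partial>lborel)
        \<le> (\<integral>\<^sup>+h\<in>ball 0 \<eta>. (grad_energy h + ennreal (\<epsilon> * norm h powr p)) * k h \<partial>lborel)"
    proof (rule nn_integral_mono)
      fix h :: "real^'n"
      show "diff_energy h * k h * indicator (ball 0 \<eta>) h
          \<le> (grad_energy h + ennreal (\<epsilon> * norm h powr p)) * k h * indicator (ball 0 \<eta>) h"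
        using \<eta>1(2)[of h] by (cases "h \<in> ball 0 \<eta>") (auto simp: \<eta>_def intro: mult_right_mono)
    qed
    have near': "(\<integral>\<^sup>+h\<in>ball 0 \<eta>. grad_energy h * k h \<partial>lborel)
        \<le> (\<integral>\<^sup>+h\<in>ball 0 \<eta>. (diff_energy h + ennreal (\<epsilon> * norm h powr p)) * k h \<partial>lborel)"
    proof (rule nn_integral_mono)
      fix h :: "real^'n"
      show "grad_energy h * k h * indicator (ball 0 \<eta>) h
          \<le> (diff_energy h + ennreal (\<epsilon> * norm h powr p)) * k h * indicator (ball 0 \<eta>) h"
        using \<eta>2(2)[of h] by (cases "h \<in> ball 0 \<eta>") (auto simp: \<eta>_def intro: mult_right_mono)
    qed
    have split: "gagliardo_energy (1 - s / p) = (\<integral>\<^sup>+h\<in>ball 0 \<eta>. diff_energy h * k h \<partial>lborel) + (\<integral>\<^sup>+h\<in>- ball 0 \<eta>. diff_energy h * k h \<partial>lborel)"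
    proof -
      have "gagliardo_energy (1 - s / p) = (\<integral>\<^sup>+h. diff_energy h * k h * indicator (ball 0 \<eta>) h + diff_energy h * k h * indicator (- ball 0 \<eta>) h \<partial>lborel)"
        unfolding kern by (intro nn_integral_cong) (simp add: indicator_def)
      also have "\<dots> = (\<integral>\<^sup>+h\<in>ball 0 \<eta>. diff_energy h * k h \<partial>lborel) + (\<integral>\<^sup>+h\<in>- ball 0 \<eta>. diff_energy h * k h \<partial>lborel)"
        by (rule nn_integral_add) measurable
      finally show ?thesis .
    qed
    have far: "(\<integral>\<^sup>+h\<in>- ball 0 \<eta>. diff_energy h * k h \<partial>lborel) \<le> ennreal D"
      unfolding k_def using s p_ge_1 by (intro D(2)) auto
    have "gagliardo_energy (1 - s / p) \<le> (ennreal (K_const p \<nu> / s * \<eta> powr s * total_mass) + ennreal (\<epsilon> * (real CARD('n) * ?b / s * \<eta> powr s))) + ennreal D"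
      unfolding split using near[unfolded comb[OF grad_energy_borel] nb] far by (rule add_mono)
    also have "\<dots> = ennreal (K_const p \<nu> / s * \<eta> powr s * total_mass + \<epsilon> * (real CARD('n) * ?b / s * \<eta> powr s) + D)"
      using K s \<epsilon> D(1) total_mass(1) by (subst ennreal_plus[symmetric]; (subst ennreal_plus[symmetric])?) auto
    finally show "gagliardo_energy (1 - s / p) \<le>
      ennreal (K_const p \<nu> / s * \<eta> powr s * total_mass + \<epsilon> * (real CARD('n) * ?b / s * \<eta> powr s) + D)" .
    have "ennreal (K_const p \<nu> / s * \<eta> powr s * total_mass)
        \<le> (\<integral>\<^sup>+h\<in>ball 0 \<eta>. diff_energy h * k h \<partial>lborel) + ennreal (\<epsilon> * (real CARD('n) * ?b / s * \<eta> powr s))"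
      using near' unfolding comb[OF diff_energy_borel] nb .
    also have "\<dots> \<le> gagliardo_energy (1 - s / p) + ennreal (\<epsilon> * (real CARD('n) * ?b / s * \<eta> powr s))"
      unfolding split by (intro add_right_mono) simp
    finally show "ennreal (K_const p \<nu> / s * \<eta> powr s * total_mass)
        \<le> gagliardo_energy (1 - s / p) + ennreal (\<epsilon> * (real CARD('n) * ?b / s * \<eta> powr s))" .
  qed
qed

text \<open>Multiply the bounds by \<open>1 - \<sigma> = s / p\<close>: the main term becomes \<open>T \<eta> powr s\<close> with the claimed limit \<open>T\<close>, the error
\<open>\<epsilon> V \<eta> powr s\<close>, and the far part \<open>(1 - \<sigma>) D\<close>. Here \<open>\<eta>\<close> and \<open>D\<close> do not depend on \<open>\<sigma>\<close>, and \<open>\<eta> powr s\<close> tends to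
\<open>1\<close>.\<close>

theorem gagliardo_energy_limit:
  fixes \<nu> :: "real^'n"
  assumes lip: "lipschitz_boundary \<Omega>" and \<nu>: "norm \<nu> = 1"
  shows "((\<lambda>\<sigma>. ennreal (1 - \<sigma>) * gagliardo_energy \<sigma>) \<longlongrightarrow> ennreal (inverse p * K_const p \<nu> * total_mass)) (at_left 1)"
proof -
  let ?b = "measure lborel (ball (0::real^'n) 1)"
  define T where "T = inverse p * K_const p \<nu> * total_mass"
  define V where "V = inverse p * real CARD('n) * ?b"
  have p0: "0 < p" using p_ge_1 by simp
  have K: "0 \<le> K_const p \<nu>" using K_const_eq_angular_mass(2)[OF _ \<nu>, of p] p_ge_1 by simp
  have T: "0 \<le> T" using K p0 total_mass(1) by (simp add: T_def)
  have V: "0 \<le> V" using p0 by (simp add: V_def)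
  define q where "q \<sigma> = enn2real (ennreal (1 - \<sigma>) * gagliardo_energy \<sigma>)" for \<sigma>
  have near1: "\<forall>\<^sub>F \<sigma> in at_left (1::real). 1 - 1 / p < \<sigma> \<and> \<sigma> < 1"
    unfolding eventually_at_left_field using p0 by (intro exI[of _ "1 - 1 / p"]) auto
  have key: "\<forall>\<^sub>F \<sigma> in at_left 1. ennreal (1 - \<sigma>) * gagliardo_energy \<sigma> < \<infinity> \<and> \<bar>q \<sigma> - T\<bar> < e" if e: "0 < e" for e
  proof -
    \<comment> \<open>Then \<open>\<epsilon> V < e\<close>, which leaves room for the terms that vanish in the limit.\<close>
    define \<epsilon> where "\<epsilon> = e / (V + 1)"
    have \<epsilon>: "0 < \<epsilon>" using e V by (simp add: \<epsilon>_def)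
    have "\<epsilon> * V < \<epsilon> * (V + 1)" using \<epsilon> by simp
    also have "\<dots> = e" using V by (simp add: \<epsilon>_def)
    finally have \<epsilon>V: "\<epsilon> * V < e" .
    obtain \<eta> D where \<eta>: "0 < \<eta>" and D: "0 \<le> D" and
      up: "\<And>s. 0 < s \<Longrightarrow> s \<le> 1 \<Longrightarrow> gagliardo_energy (1 - s / p) \<le>
      ennreal (K_const p \<nu> / s * \<eta> powr s * total_mass + \<epsilon> * (real CARD('n) * ?b / s * \<eta> powr s) + D)" and
      lo: "\<And>s. 0 < s \<Longrightarrow> s \<le> 1 \<Longrightarrow> ennreal (K_const p \<nu> / s * \<eta> powr s * total_mass) \<le>
      gagliardo_energy (1 - s / p) + ennreal (\<epsilon> * (real CARD('n) * ?b / s * \<eta> powr s))"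
      by (rule gagliardo_energy_bounds[OF lip \<nu> \<epsilon>]) (rule that)
    have lim1: "((\<lambda>\<sigma>. \<eta> powr (p * (1 - \<sigma>)) * (T + \<epsilon> * V) + (1 - \<sigma>) * D) \<longlongrightarrow> \<eta> powr (p * (1 - 1)) * (T + \<epsilon> * V) + (1 - 1) * D) (at_left 1)"
      using \<eta> by (intro tendsto_intros) auto
    have lim2: "((\<lambda>\<sigma>. \<eta> powr (p * (1 - \<sigma>)) * (T - \<epsilon> * V)) \<longlongrightarrow> \<eta> powr (p * (1 - 1)) * (T - \<epsilon> * V)) (at_left 1)"
      using \<eta> by (intro tendsto_intros) auto
    have "\<forall>\<^sub>F \<sigma> in at_left 1. \<eta> powr (p * (1 - \<sigma>)) * (T + \<epsilon> * V) + (1 - \<sigma>) * D < T + e"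
      by (rule order_tendstoD(2)[OF lim1]) (use \<eta> \<epsilon>V in simp)
    moreover have "\<forall>\<^sub>F \<sigma> in at_left 1. T - e < \<eta> powr (p * (1 - \<sigma>)) * (T - \<epsilon> * V)"
      by (rule order_tendstoD(1)[OF lim2]) (use \<eta> \<epsilon>V in simp)
    ultimately show ?thesis
      using near1
    proof eventually_elim
      case (elim \<sigma>)
      define s where "s = p * (1 - \<sigma>)"
      have "1 - \<sigma> < 1 / p" using elim(3) by linarith
      then have s: "0 < s" "s \<le> 1" using elim(3) p0 by (auto simp: s_def field_simps)
      have \<sigma>: "1 - s / p = \<sigma>" "(1 - \<sigma>) / s = inverse p" using p0 s by (auto simp: s_def field_simps)
      have \<sigma>1: "0 < 1 - \<sigma>" using elim(3) by simp
      have rT: "(1 - \<sigma>) * (K_const p \<nu> / s * \<eta> powr s * total_mass) = \<eta> powr s * T"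
        unfolding T_def \<sigma>(2)[symmetric] by simp
      have rV: "(1 - \<sigma>) * (\<epsilon> * (real CARD('n) * ?b / s * \<eta> powr s)) = \<eta> powr s * (\<epsilon> * V)"
        unfolding V_def \<sigma>(2)[symmetric] by simp
      have "ennreal (1 - \<sigma>) * gagliardo_energy \<sigma> \<le> ennreal (1 - \<sigma>) *
          ennreal (K_const p \<nu> / s * \<eta> powr s * total_mass + \<epsilon> * (real CARD('n) * ?b / s * \<eta> powr s) + D)"
        using up[OF s] unfolding \<sigma>(1) by (intro mult_left_mono) auto
      also have "\<dots> = ennreal ((1 - \<sigma>) * (K_const p \<nu> / s * \<eta> powr s * total_mass + \<epsilon> * (real CARD('n) * ?b / s * \<eta> powr s) + D))"
        using \<sigma>1 K s \<epsilon> D total_mass(1) by (intro ennreal_mult[symmetric]) auto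
      also have "(1 - \<sigma>) * (K_const p \<nu> / s * \<eta> powr s * total_mass + \<epsilon> * (real CARD('n) * ?b / s * \<eta> powr s) + D)
          = \<eta> powr s * (T + \<epsilon> * V) + (1 - \<sigma>) * D"
        unfolding distrib_left rT rV ..
      finally have upper: "ennreal (1 - \<sigma>) * gagliardo_energy \<sigma> \<le> ennreal (\<eta> powr s * (T + \<epsilon> * V) + (1 - \<sigma>) * D)" .
      then have fin: "ennreal (1 - \<sigma>) * gagliardo_energy \<sigma> < \<infinity>"
        by (rule le_less_trans) simp
      then have qe: "ennreal (1 - \<sigma>) * gagliardo_energy \<sigma> = ennreal (q \<sigma>)" and q0: "0 \<le> q \<sigma>"
        by (auto simp: q_def)
      have "q \<sigma> \<le> \<eta> powr s * (T + \<epsilon> * V) + (1 - \<sigma>) * D"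
        using upper T V \<epsilon> D \<sigma>1 unfolding qe by (subst (asm) ennreal_le_iff) auto
      then have q1: "q \<sigma> < T + e" using elim(1) by (simp add: s_def)
      have "ennreal (1 - \<sigma>) * ennreal (K_const p \<nu> / s * \<eta> powr s * total_mass)
          \<le> ennreal (1 - \<sigma>) * (gagliardo_energy \<sigma> + ennreal (\<epsilon> * (real CARD('n) * ?b / s * \<eta> powr s)))"
        using lo[OF s] unfolding \<sigma>(1) by (intro mult_left_mono) auto
      also have "\<dots> = ennreal (q \<sigma>) + ennreal (1 - \<sigma>) * ennreal (\<epsilon> * (real CARD('n) * ?b / s * \<eta> powr s))"
        unfolding distrib_left qe ..
      also have "ennreal (1 - \<sigma>) * ennreal (\<epsilon> * (real CARD('n) * ?b / s * \<eta> powr s)) = ennreal (\<eta> powr s * (\<epsilon> * V))"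
        unfolding rV[symmetric] using \<sigma>1 \<epsilon> s by (intro ennreal_mult[symmetric]) auto
      also have "ennreal (1 - \<sigma>) * ennreal (K_const p \<nu> / s * \<eta> powr s * total_mass) = ennreal (\<eta> powr s * T)"
        unfolding rT[symmetric] using \<sigma>1 K s total_mass(1) by (intro ennreal_mult[symmetric]) auto
      also have "ennreal (q \<sigma>) + ennreal (\<eta> powr s * (\<epsilon> * V)) = ennreal (q \<sigma> + \<eta> powr s * (\<epsilon> * V))"
        using q0 \<epsilon> V by (intro ennreal_plus[symmetric]) auto
      finally have "\<eta> powr s * T \<le> q \<sigma> + \<eta> powr s * (\<epsilon> * V)"
        using q0 \<epsilon> V by (subst (asm) ennreal_le_iff) auto
      then have "\<eta> powr s * (T - \<epsilon> * V) \<le> q \<sigma>" by (simp add: right_diff_distrib)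
      then have q2: "T - e < q \<sigma>" using elim(2) by (simp add: s_def)
      show ?case using fin q1 q2 by auto
    qed
  qed
  have "(q \<longlongrightarrow> T) (at_left 1)"
  proof (rule tendstoI)
    fix e :: real assume "0 < e"
    from key[OF this] show "\<forall>\<^sub>F \<sigma> in at_left 1. dist (q \<sigma>) T < e"
      by eventually_elim (simp add: dist_real_def)
  qed
  then have "((\<lambda>\<sigma>. ennreal (q \<sigma>)) \<longlongrightarrow> ennreal T) (at_left 1)"
    by (rule tendsto_ennrealI)
  moreover have "\<forall>\<^sub>F \<sigma> in at_left 1. ennreal (q \<sigma>) = ennreal (1 - \<sigma>) * gagliardo_energy \<sigma>"
    using key[OF zero_less_one] by eventually_elim (simp add: q_def)
  ultimately show ?thesis
    unfolding T_def[symmetric] by (rule Lim_transform_eventually)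
qed

lemma gagliardo_energy_double_integral:
  "gagliardo_energy \<sigma> = (\<integral>\<^sup>+x. \<integral>\<^sup>+y. ennreal (\<bar>u x - u y\<bar> powr p / norm (x - y) powr (real CARD('n) + p * \<sigma>))
      * indicator (\<Omega> \<times> \<Omega>) (x, y) \<partial>lborel \<partial>lborel)"
proof -
  define a where "a = real CARD('n) + p * \<sigma>"
  let ?F = "\<lambda>x y. ennreal (\<bar>u x - u y\<bar> powr p / norm (x - y) powr a) * indicator (\<Omega> \<times> \<Omega>) (x, y)"
  have "(\<integral>\<^sup>+x. \<integral>\<^sup>+y. ?F x y \<partial>lborel \<partial>lborel) = (\<integral>\<^sup>+x. \<integral>\<^sup>+h. ?F x (x + h) \<partial>lborel \<partial>lborel)"
  proof (rule nn_integral_cong)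
    fix x
    have "?F x = (\<lambda>y. ennreal (\<bar>u x - u y\<bar> powr p / norm (x - y) powr a) * (indicator \<Omega> x * indicator \<Omega> y))"
      by (auto simp: fun_eq_iff indicator_def)
    also have "\<dots> \<in> borel_measurable borel" by measurable
    finally have [measurable]: "?F x \<in> borel_measurable borel" .
    show "(\<integral>\<^sup>+y. ?F x y \<partial>lborel) = (\<integral>\<^sup>+h. ?F x (x + h) \<partial>lborel)"
      using nn_integral_lborel_shift[of "?F x" x] by (simp add: add.commute)
  qed
  also have "\<dots> = (\<integral>\<^sup>+x. \<integral>\<^sup>+h. ennreal (\<bar>u (x + h) - u x\<bar> powr p) * (indicator \<Omega> x * indicator \<Omega> (x + h)) * ennreal (norm h powr (- a)) \<partial>lborel \<partial>lborel)"
    by (intro nn_integral_cong)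
      (auto simp: indicator_times powr_minus_divide ennreal_mult[symmetric] abs_minus_commute indicator_def)
  also have "\<dots> = (\<integral>\<^sup>+h. \<integral>\<^sup>+x. ennreal (\<bar>u (x + h) - u x\<bar> powr p) * (indicator \<Omega> x * indicator \<Omega> (x + h)) * ennreal (norm h powr (- a)) \<partial>lborel \<partial>lborel)"
    by (rule lborel_pair.Fubini') measurable
  also have "\<dots> = (\<integral>\<^sup>+h. diff_energy h * ennreal (norm h powr (- a)) \<partial>lborel)"
    unfolding diff_energy_alt by (intro nn_integral_cong nn_integral_multc) measurable
  finally show ?thesis by (simp add: gagliardo_energy_def a_def)
qed

end

section \<open>Borel representatives and the semi-norms of higher order\<close>

lemma Lp_borel_representative:
  fixes f :: "real^'n::finite \<Rightarrow> real"
  assumes "open \<Omega>" and f: "f \<in> Lp_space p \<Omega>"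
  obtains F where "F \<in> borel_measurable borel" "\<And>x. x \<notin> \<Omega> \<Longrightarrow> F x = 0"
    "AE x in lebesgue. x \<in> \<Omega> \<longrightarrow> f x = F x" "integrable lborel (\<lambda>x. \<bar>F x\<bar> powr p)"
proof -
  have \<Omega>: "\<Omega> \<in> sets borel" "\<Omega> \<in> sets lebesgue" using assms(1) by auto
  have fm: "(\<lambda>x. if x \<in> \<Omega> then f x else 0) \<in> borel_measurable lebesgue"
    using f \<Omega>(2) by (intro borel_measurable_if_I) (auto simp: Lp_space_def)
  obtain G where G: "G \<in> borel_measurable lborel" "AE x in lborel. (if x \<in> \<Omega> then f x else 0) = G x"
    using completion_ex_borel_measurable_real[OF fm] by blast
  define F where "F x = indicator \<Omega> x * G x" for x
  have F: "F \<in> borel_measurable borel"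
    using G(1) \<Omega>(1) unfolding F_def by (intro borel_measurable_times borel_measurable_indicator) auto
  have ae: "AE x in lebesgue. x \<in> \<Omega> \<longrightarrow> f x = F x"
    using AE_completion[OF G(2)] by eventually_elim (auto simp: F_def)
  have Fp: "(\<lambda>x. \<bar>F x\<bar> powr p) \<in> borel_measurable borel"
    using F by measurable
  have "integrable lebesgue (\<lambda>x. indicator \<Omega> x *\<^sub>R \<bar>f x\<bar> powr p)"
    using f \<Omega>(2) by (subst integrable_restrict_space[symmetric]) (auto simp: Lp_space_def)
  moreover have "AE x in lebesgue. indicator \<Omega> x *\<^sub>R \<bar>f x\<bar> powr p = \<bar>F x\<bar> powr p"
    using ae by eventually_elim (auto simp: F_def indicator_def)
  ultimately have "integrable lebesgue (\<lambda>x. \<bar>F x\<bar> powr p)"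
    using Fp by (subst integrable_cong_AE[symmetric]) (auto intro: measurable_completion)
  then have "integrable lborel (\<lambda>x. \<bar>F x\<bar> powr p)"
    using Fp by (subst integrable_completion[symmetric]) auto
  moreover have "F x = 0" if "x \<notin> \<Omega>" for x using that by (simp add: F_def)
  ultimately show ?thesis
    using that[OF F] ae by blast
qed

lemma test_integral_representative:
  fixes f :: "real^'n::finite \<Rightarrow> real"
  assumes "open \<Omega>" and F [measurable]: "F \<in> borel_measurable borel" and zero: "\<And>x. x \<notin> \<Omega> \<Longrightarrow> F x = 0"
    and ae: "AE x in lebesgue. x \<in> \<Omega> \<longrightarrow> f x = F x"
    and \<phi> [measurable]: "\<phi> \<in> borel_measurable borel"
  shows "(LINT x|lebesgue_on \<Omega>. f x * \<phi> x) = (LINT x|lborel. F x * \<phi> x)"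
proof -
  have \<Omega>: "\<Omega> \<in> sets lebesgue" using assms(1) by auto
  have Fm: "(\<lambda>x. F x * \<phi> x) \<in> borel_measurable lebesgue"
    by (rule measurable_completion) measurable
  have ae': "AE x in lebesgue. F x * \<phi> x = indicator \<Omega> x *\<^sub>R (f x * \<phi> x)"
    using ae by eventually_elim (auto simp: indicator_def zero)
  have "(LINT x|lebesgue_on \<Omega>. f x * \<phi> x) = (LINT x|lebesgue. indicator \<Omega> x *\<^sub>R (f x * \<phi> x))"
    using \<Omega> by (subst integral_restrict_space) auto
  also have "\<dots> = (LINT x|lebesgue. F x * \<phi> x)"
    by (rule integral_cong_AE[symmetric, OF Fm borel_measurable_AE[OF Fm ae'] ae'])
  also have "\<dots> = (LINT x|lborel. F x * \<phi> x)"
    by (rule integral_completion) measurable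
  finally show ?thesis .
qed

lemma norm_powr_le_sum:
  fixes w :: "real^'n::finite"
  assumes "1 \<le> p"
  shows "norm w powr p \<le> real CARD('n) powr p * (\<Sum>i\<in>UNIV. \<bar>w $ i\<bar> powr p)"
proof -
  obtain k where k: "\<And>i. \<bar>w $ i\<bar> \<le> \<bar>w $ k\<bar>"
  proof -
    have "Max (range (\<lambda>i. \<bar>w $ i\<bar>)) \<in> range (\<lambda>i. \<bar>w $ i\<bar>)" by (rule Max_in) auto
    then obtain k where "Max (range (\<lambda>i. \<bar>w $ i\<bar>)) = \<bar>w $ k\<bar>" by blast
    then have "\<bar>w $ i\<bar> \<le> \<bar>w $ k\<bar>" for i by (metis Max_ge finite finite_imageI rangeI)
    then show ?thesis by (rule that)
  qed
  have "norm w \<le> (\<Sum>i\<in>UNIV. \<bar>w $ i\<bar>)" by (rule norm_le_l1_cart)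
  also have "\<dots> \<le> real CARD('n) * \<bar>w $ k\<bar>"
    using sum_bounded_above[of UNIV "\<lambda>i. \<bar>w $ i\<bar>" "\<bar>w $ k\<bar>"] k by simp
  finally have "norm w powr p \<le> (real CARD('n) * \<bar>w $ k\<bar>) powr p"
    using assms by (intro powr_mono2) auto
  also have "\<dots> = real CARD('n) powr p * \<bar>w $ k\<bar> powr p" by (rule powr_mult)
  also have "\<dots> \<le> real CARD('n) powr p * (\<Sum>i\<in>UNIV. \<bar>w $ i\<bar> powr p)"
    by (intro mult_left_mono member_le_sum) auto
  finally show ?thesis .
qed

text \<open>A null set in one factor times the whole space is a null set of the product. Hence the double integrals do not depend
on the chosen representatives.\<close>

lemma AE_fst_lborel:
  assumes "AE x in (lborel :: 'a::euclidean_space measure). P x"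
  shows "AE z in (lborel :: ('a \<times> 'b::euclidean_space) measure). P (fst z)"
    and "AE z in (lborel :: ('b \<times> 'a) measure). P (snd z)"
proof -
  obtain N where N: "N \<in> null_sets lborel" "{x. \<not> P x} \<subseteq> N"
    using assms by (auto simp: eventually_ae_filter)
  then have [measurable]: "N \<in> sets borel" and N0: "emeasure lborel N = 0" by auto
  have "N \<times> (UNIV::'b set) \<in> null_sets (lborel \<Otimes>\<^sub>M lborel)"
    using N0 by (intro null_setsI) (auto simp: lborel.emeasure_pair_measure_Times)
  then have "N \<times> UNIV \<in> null_sets (lborel :: ('a \<times> 'b) measure)" by (simp only: lborel_prod)
  then show "AE z in (lborel :: ('a \<times> 'b) measure). P (fst z)"
    by (rule AE_I') (use N(2) in auto)
  have "(UNIV::'b set) \<times> N \<in> null_sets (lborel \<Otimes>\<^sub>M lborel)"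
    using N0 by (intro null_setsI) (auto simp: lborel.emeasure_pair_measure_Times)
  then have "UNIV \<times> N \<in> null_sets (lborel :: ('b \<times> 'a) measure)" by (simp only: lborel_prod)
  then show "AE z in (lborel :: ('b \<times> 'a) measure). P (snd z)"
    by (rule AE_I') (use N(2) in auto)
qed

lemma gagliardo_double_integral:
  fixes f F :: "real^'n::finite \<Rightarrow> real"
  assumes "open \<Omega>" and [measurable]: "F \<in> borel_measurable borel"
    and ae: "AE x in lebesgue. x \<in> \<Omega> \<longrightarrow> f x = F x"
  shows "(\<integral>\<^sup>+(x, y). ennreal (\<bar>f x - f y\<bar> powr p / norm (x - y) powr a) \<partial>lebesgue_on (\<Omega> \<times> \<Omega>))
       = (\<integral>\<^sup>+x. \<integral>\<^sup>+y. ennreal (\<bar>F x - F y\<bar> powr p / norm (x - y) powr a) * indicator (\<Omega> \<times> \<Omega>) (x, y) \<partial>lborel \<partial>lborel)"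
proof -
  have [measurable]: "\<Omega> \<in> sets borel" using assms(1) by simp
  have O2: "open (\<Omega> \<times> \<Omega>)" using assms(1) by (intro open_Times)
  let ?k = "\<lambda>f z. ennreal (\<bar>f (fst z) - f (snd z)\<bar> powr p / norm (fst z - snd z) powr a) * indicator (\<Omega> \<times> \<Omega>) z"
  have aeb: "AE x in lborel. x \<in> \<Omega> \<longrightarrow> f x = F x" using ae by (simp add: AE_completion_iff)
  have "AE z in lborel. ?k f z = ?k F z"
    using AE_fst_lborel(1)[OF aeb, where 'b="real^'n"] AE_fst_lborel(2)[OF aeb, where 'b="real^'n"]
    by eventually_elim (auto simp: indicator_def)
  then have cong: "AE z in lebesgue. ?k f z = ?k F z" by (rule AE_completion)
  have "(\<integral>\<^sup>+(x, y). ennreal (\<bar>f x - f y\<bar> powr p / norm (x - y) powr a) \<partial>lebesgue_on (\<Omega> \<times> \<Omega>))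
      = (\<integral>\<^sup>+z. ?k f z \<partial>lebesgue)"
    using O2 by (subst nn_integral_restrict_space) (auto simp: case_prod_beta)
  also have "\<dots> = (\<integral>\<^sup>+z. ?k F z \<partial>lebesgue)" by (rule nn_integral_cong_AE[OF cong])
  also have "\<dots> = (\<integral>\<^sup>+z. ?k F z \<partial>lborel)" by (rule nn_integral_completion)
  also have "\<dots> = (\<integral>\<^sup>+z. ?k F z \<partial>(lborel \<Otimes>\<^sub>M lborel))" by (simp only: lborel_prod)
  also have "\<dots> = (\<integral>\<^sup>+x. \<integral>\<^sup>+y. ?k F (x, y) \<partial>lborel \<partial>lborel)"
    by (rule lborel.nn_integral_fst[symmetric]) measurable
  finally show ?thesis by simp
qed

text \<open>One summand of the semi-norm. The function and its weak partial derivatives are replaced by Borel representatives, to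
which the locale applies.\<close>

lemma gagliardo_term_limit:
  fixes \<Omega> :: "(real^'n::finite) set" and \<nu> :: "real^'n"
  assumes \<Omega>: "open \<Omega>" "bounded \<Omega>" and lip: "lipschitz_boundary \<Omega>" and p: "1 \<le> p" and \<nu>: "norm \<nu> = 1"
    and f: "f0 \<in> Lp_space p \<Omega>" "AE x in lebesgue. x \<in> \<Omega> \<longrightarrow> f x = f0 x"
    and w: "\<And>i. w i \<in> Lp_space p \<Omega>" "\<And>i. has_weak_deriv \<Omega> (mi_unit i) f (w i)"
  shows "((\<lambda>\<sigma>. ennreal (1 - \<sigma>) * (\<integral>\<^sup>+(x, y). ennreal (\<bar>f x - f y\<bar> powr p
                        / norm (x - y) powr (real CARD('n) + p * \<sigma>)) \<partial>lebesgue_on (\<Omega> \<times> \<Omega>)))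
            \<longlongrightarrow> ennreal (inverse p * K_const p \<nu> * grad_norm0 p \<Omega> f powr p)) (at_left 1)"
proof -
  have \<Omega>l: "\<Omega> \<in> sets lebesgue" using \<Omega>(1) by auto
  obtain F where F: "F \<in> borel_measurable borel" "\<And>x. x \<notin> \<Omega> \<Longrightarrow> F x = 0"
    "AE x in lebesgue. x \<in> \<Omega> \<longrightarrow> f0 x = F x" "integrable lborel (\<lambda>x. \<bar>F x\<bar> powr p)"
    by (rule Lp_borel_representative[OF \<Omega>(1) f(1)]) (rule that)
  have fF: "AE x in lebesgue. x \<in> \<Omega> \<longrightarrow> f x = F x"
    using f(2) F(3) by eventually_elim simp
  have "\<exists>G. G \<in> borel_measurable borel \<and> (\<forall>x. x \<notin> \<Omega> \<longrightarrow> G x = 0) \<and>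
    (AE x in lebesgue. x \<in> \<Omega> \<longrightarrow> w i x = G x) \<and> integrable lborel (\<lambda>x. \<bar>G x\<bar> powr p)" for i
    by (rule Lp_borel_representative[OF \<Omega>(1) w(1)[of i]]) blast
  then have "\<exists>G. \<forall>i. G i \<in> borel_measurable borel \<and> (\<forall>x. x \<notin> \<Omega> \<longrightarrow> G i x = 0) \<and>
    (AE x in lebesgue. x \<in> \<Omega> \<longrightarrow> w i x = G i x) \<and> integrable lborel (\<lambda>x. \<bar>G i x\<bar> powr p)"
    by (intro choice allI)
  then obtain G where G: "\<And>i. G i \<in> borel_measurable borel" "\<And>i x. x \<notin> \<Omega> \<Longrightarrow> G i x = 0"
    "\<And>i. AE x in lebesgue. x \<in> \<Omega> \<longrightarrow> w i x = G i x" "\<And>i. integrable lborel (\<lambda>x. \<bar>G i x\<bar> powr p)"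
    by blast
  define g where "g x = (\<chi> i. G i x)" for x
  have gm [measurable]: "g \<in> borel_measurable borel"
    unfolding g_def using G(1) by (subst borel_measurable_euclidean_space) (auto simp: Basis_vec_def inner_axis)
  interpret sobolev_W1 \<Omega> F g p
  proof
    show "integrable lborel (\<lambda>x. norm (g x) powr p)"
    proof (rule Bochner_Integration.integrable_bound)
      show "integrable lborel (\<lambda>x. real CARD('n) powr p * (\<Sum>i\<in>UNIV. \<bar>G i x\<bar> powr p))"
        using G(4) by (intro integrable_mult_right Bochner_Integration.integrable_sum) auto
      show "(\<lambda>x. norm (g x) powr p) \<in> borel_measurable lborel" by measurable
      show "AE x in lborel. norm (norm (g x) powr p) \<le> norm (real CARD('n) powr p * (\<Sum>i\<in>UNIV. \<bar>G i x\<bar> powr p))"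
        using norm_powr_le_sum[OF p, of "g _"] by (intro AE_I2) (simp add: g_def sum_nonneg)
    qed
    show "(LINT x|lborel. F x * partial_deriv i \<phi> x) = - (LINT x|lborel. g x $ i * \<phi> x)"
      if tf: "test_function \<Omega> \<phi>" for \<phi> i
    proof -
      have sm: "C_infinity \<phi>" using tf by (simp add: test_function_def)
      have "(LINT x|lborel. F x * partial_deriv i \<phi> x) = (LINT x|lebesgue_on \<Omega>. f x * partial_deriv i \<phi> x)"
        by (intro test_integral_representative[symmetric] \<Omega> F fF C_infinity_borel_measurable C_infinity_partial_deriv sm)
      also have "\<dots> = (LINT x|lebesgue_on \<Omega>. f x * mi_deriv (mi_unit i) \<phi> x)"
        by (simp add: mi_deriv_unit[OF sm])
      also have "\<dots> = - (LINT x|lebesgue_on \<Omega>. w i x * \<phi> x)"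
        using w(2)[of i] tf by (simp add: has_weak_deriv_def mi_order_unit)
      also have "(LINT x|lebesgue_on \<Omega>. w i x * \<phi> x) = (LINT x|lborel. G i x * \<phi> x)"
        by (intro test_integral_representative \<Omega> G C_infinity_borel_measurable sm)
      finally show ?thesis by (simp add: g_def)
    qed
  qed (use \<Omega> p F G gm in \<open>auto simp: g_def vec_eq_iff\<close>)
  have energy: "(\<integral>\<^sup>+(x, y). ennreal (\<bar>f x - f y\<bar> powr p / norm (x - y) powr (real CARD('n) + p * \<sigma>)) \<partial>lebesgue_on (\<Omega> \<times> \<Omega>))
      = gagliardo_energy \<sigma>" for \<sigma>
    unfolding gagliardo_energy_double_integral by (rule gagliardo_double_integral[OF \<Omega>(1) F(1) fF])
  have grad: "grad_norm0 p \<Omega> f powr p = total_mass"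
  proof -
    have "AE x in lebesgue. x \<in> \<Omega> \<longrightarrow> weak_deriv \<Omega> (mi_unit i) f x = G i x" for i
      using weak_deriv_unique[OF \<Omega>(1) has_weak_deriv_weak_deriv[OF w(2)[of i]] w(2)[of i]] G(3)[of i]
      by eventually_elim simp
    then have "AE x in lebesgue. \<forall>i\<in>UNIV. x \<in> \<Omega> \<longrightarrow> weak_deriv \<Omega> (mi_unit i) f x = G i x"
      by (subst AE_ball_countable) (auto simp: countable_finite)
    then have ae: "AE x in lebesgue. norm (g x) powr p = indicator \<Omega> x *\<^sub>R norm (weak_grad \<Omega> f x) powr p"
    proof eventually_elim
      case (elim x)
      show ?case
      proof (cases "x \<in> \<Omega>")
        case True
        with elim have "weak_grad \<Omega> f x = g x" by (simp add: weak_grad_def g_def vec_eq_iff)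
        with True show ?thesis by simp
      qed (simp add: g_outside)
    qed
    have m: "(\<lambda>x. norm (g x) powr p) \<in> borel_measurable lebesgue"
      by (rule measurable_completion) measurable
    have "(LINT x|lebesgue_on \<Omega>. norm (weak_grad \<Omega> f x) powr p) = (LINT x|lebesgue. indicator \<Omega> x *\<^sub>R norm (weak_grad \<Omega> f x) powr p)"
      using \<Omega>l by (subst integral_restrict_space) auto
    also have "\<dots> = (LINT x|lebesgue. norm (g x) powr p)"
      by (rule integral_cong_AE[symmetric, OF m borel_measurable_AE[OF m ae] ae])
    also have "\<dots> = total_mass"
      unfolding total_mass_def by (rule integral_completion) measurable
    finally have "(LINT x|lebesgue_on \<Omega>. norm (weak_grad \<Omega> f x) powr p) = total_mass" .
    then show ?thesis
      using p total_mass(1) by (simp add: grad_norm0_def powr_powr)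
  qed
  show ?thesis
    unfolding energy grad by (rule gagliardo_energy_limit[OF lip \<nu>])
qed

theorem theorem3p1:
  fixes \<Omega> :: "(real^'n) set" and p :: real and l :: nat
    and v :: "real^'n \<Rightarrow> real" and \<nu> :: "real^'n"
  assumes "open \<Omega>" and "connected \<Omega>" and "\<Omega> \<noteq> {}" and "bounded \<Omega>"
    and "lipschitz_boundary \<Omega>"
    and "1 \<le> p"
    and "v \<in> sobolev_space (l + 1) p \<Omega>"
    and "norm \<nu> = 1"
  shows "((\<lambda>\<sigma>. ennreal (1 - \<sigma>) * gagliardo_pow l \<sigma> p \<Omega> v)
            \<longlongrightarrow> ennreal (inverse p * K_const p \<nu> * grad_seminorm l p \<Omega> v powr p)) (at_left 1)"
proof -
  let ?A = "{\<alpha> :: 'n \<Rightarrow> nat. mi_order \<alpha> = l}"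
  let ?E = "\<lambda>\<alpha> \<sigma>. \<integral>\<^sup>+(x, y). ennreal (\<bar>weak_deriv \<Omega> \<alpha> v x - weak_deriv \<Omega> \<alpha> v y\<bar> powr p
                        / norm (x - y) powr (real CARD('n) + p * \<sigma>)) \<partial>lebesgue_on (\<Omega> \<times> \<Omega>)"
  let ?T = "\<lambda>\<alpha>. grad_norm0 p \<Omega> (weak_deriv \<Omega> \<alpha> v) powr p"
  have K: "0 \<le> K_const p \<nu>" using assms by (intro K_const_eq_angular_mass(2)) auto
  have ex: "\<exists>g\<in>Lp_space p \<Omega>. has_weak_deriv \<Omega> \<alpha> v g" if "mi_order \<alpha> \<le> l + 1" for \<alpha>
    using assms(7) that unfolding sobolev_space_def by blast
  have term_limit: "((\<lambda>\<sigma>. ennreal (1 - \<sigma>) * ?E \<alpha> \<sigma>) \<longlongrightarrow> ennreal (inverse p * K_const p \<nu> * ?T \<alpha>)) (at_left 1)"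
    if \<alpha>: "\<alpha> \<in> ?A" for \<alpha>
  proof -
    obtain f0 where f0: "f0 \<in> Lp_space p \<Omega>" "has_weak_deriv \<Omega> \<alpha> v f0"
      using ex[of \<alpha>] \<alpha> by auto
    have wd: "has_weak_deriv \<Omega> \<alpha> v (weak_deriv \<Omega> \<alpha> v)"
      by (rule has_weak_deriv_weak_deriv[OF f0(2)])
    have "\<exists>w\<in>Lp_space p \<Omega>. has_weak_deriv \<Omega> (\<lambda>j. \<alpha> j + mi_unit i j) v w" for i
      using \<alpha> by (intro ex) (simp add: mi_order_add_unit)
    then have "\<exists>w. \<forall>i. w i \<in> Lp_space p \<Omega> \<and> has_weak_deriv \<Omega> (\<lambda>j. \<alpha> j + mi_unit i j) v (w i)"
      by (intro choice allI) blast
    then obtain w where w: "\<And>i. w i \<in> Lp_space p \<Omega>" "\<And>i. has_weak_deriv \<Omega> (\<lambda>j. \<alpha> j + mi_unit i j) v (w i)"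
      by blast
    show ?thesis
      by (rule gagliardo_term_limit[OF assms(1,4,5,6,8) f0(1) weak_deriv_unique[OF assms(1) wd f0(2)]
            w(1) has_weak_deriv_iterated[OF wd w(2)]])
  qed
  have "((\<lambda>\<sigma>. \<Sum>\<alpha>\<in>?A. ennreal (1 - \<sigma>) * ?E \<alpha> \<sigma>) \<longlongrightarrow> (\<Sum>\<alpha>\<in>?A. ennreal (inverse p * K_const p \<nu> * ?T \<alpha>))) (at_left 1)"
    by (rule tendsto_sum) (rule term_limit)
  moreover have "(\<Sum>\<alpha>\<in>?A. ennreal (1 - \<sigma>) * ?E \<alpha> \<sigma>) = ennreal (1 - \<sigma>) * gagliardo_pow l \<sigma> p \<Omega> v" for \<sigma>
    unfolding gagliardo_pow_def by (rule sum_distrib_left[symmetric])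
  moreover have "(\<Sum>\<alpha>\<in>?A. ennreal (inverse p * K_const p \<nu> * ?T \<alpha>))
      = ennreal (inverse p * K_const p \<nu> * grad_seminorm l p \<Omega> v powr p)"
  proof -
    have "grad_seminorm l p \<Omega> v powr p = (\<Sum>\<alpha>\<in>?A. ?T \<alpha>)"
      using assms(6) by (simp add: grad_seminorm_def powr_powr sum_nonneg)
    moreover have "(\<Sum>\<alpha>\<in>?A. ennreal (inverse p * K_const p \<nu> * ?T \<alpha>)) = ennreal (\<Sum>\<alpha>\<in>?A. inverse p * K_const p \<nu> * ?T \<alpha>)"
      using K assms(6) by (intro sum_ennreal) auto
    ultimately show ?thesis by (simp add: sum_distrib_left)
  qed
  ultimately show ?thesis by simp
qed

end
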